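(* Let $H$ be a finite-dimensional ribbon Hopf algebra over a field $\Bbbk$ and $\lambda\in H^*$ a non-zero right integral for $H^*$. Then $\mathcal I(H)$ consists of the elements $z\in L(H)$ satisfying (a) $T(z)-z\in N(H)$, that is, $\lambda(T(z)a)=\lambda(za)$ for all $a\in Z(H)$; (b) $\sum_i\lambda(zx_{i(1)})\,\lambda(zx_{i(2)}y_i)=\sum_i\lambda(zx_i)\,\lambda(zy_i)$ for all $X=\sum_ix_i\otimes y_i\in V_2(H)$. In particular, $\mathcal I(H)$ contains the elements $z\in L(H)$ satisfying $T(z)=z$ and $\lambda(zx_{(1)})\,zx_{(2)}=\lambda(zx)\,z$ for all $x\in H$. Moreover, an element $z\in\mathcal I(H)$ belongs to $\mathcal I(H)^{\mathrm{norm}}$ if and only if $\lambda(z\theta)\neq0\neq\lambda(z\theta^{-1})$.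
   Context: **Ribbon Hopf algebras.** $H$ is a finite-dimensional Hopf algebra over $\Bbbk$ (coproduct $\Delta(x)=x_{(1)}\otimes x_{(2)}$, counit $\varepsilon$, antipode $S$, center $Z(H)$), with an R-matrix $R=\sum_ia_i\otimes b_i$ (invertible, $R\Delta(x)=\sigma\Delta(x)R$, $(\mathrm{id}\otimes\Delta)(R)=R_{13}R_{12}$, $(\Delta\otimes\mathrm{id})(R)=R_{13}R_{23}$, $\sigma$ the flip) and a twist $\theta\in H$ (invertible, central, $S(\theta)=\theta$, $\Delta(\theta)=(\theta\otimes\theta)R_{21}R$). $u=\sum_iS(b_i)a_i$ is the Drinfeld element and $G=\theta u$ the special grouplike element. A right integral for $H^*$ is $\lambda\in H^*$ with $\lambda(x_{(1)})x_{(2)}=\lambda(x)1$ for all $x$. $\nu\in H^*$ is the distinguished grouplike element of $H^*$: the algebra map $\nu:H\to\Bbbk$ with $\Lambda x=\nu(x)\Lambda$ for every left integral $\Lambda\in H$ (i.e. $x\Lambda=\varepsilon(x)\Lambda$) and $x\in H$. $h_\nu=(\mathrm{id}_H\otimes\nu)(R)$. For $f\in H^*$, $h,x\in H$: $\langle f\cdot h,x\rangle=f(hx)$ and $x\leftharpoonup f=f(x_{(1)})x_{(2)}$. Set $T(z)=(S(z)\leftharpoonup\nu)h_\nu$ for $z\in H$; $L(H)=\{z\in H:(x\leftharpoonup\nu)z=zx\ \forall x\in H\}$; $N(H)=\{z\in L(H):\lambda(za)=0\ \forall a\in Z(H)\}$; $V_2(H)=\{X\in H\otimes H:X\triangleleft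 h=\varepsilon(h)X\ \forall h\in H\}$, where $(x\otimes y)\triangleleft h=S(h_{(1)})xh_{(2)}\otimes S(h_{(3)})yh_{(4)}$. **The category $\mathrm{rep}_H$ and $\mathcal I(H)$.** $\mathrm{rep}_H$ is the ribbon category of finite-dimensional left $H$-modules: tensor product via $\Delta$, unit $\Bbbk$, $M^*=\mathrm{Hom}_\Bbbk(M,\Bbbk)$ with $(hf)(m)=f(S(h)m)$ and the usual (co)evaluation $\mathrm{ev}_M:M^*\otimes M\to\Bbbk$, $\mathrm{coev}_M:\Bbbk\to M\otimes M^*$, braiding $c_{M,N}(m\otimes n)=\sum_ib_in\otimes a_im$, twist $\theta_M=$ multiplication by $\theta$. In a ribbon category put $\widetilde{\mathrm{ev}}_X=\mathrm{ev}_Xc_{X,X^*}(\theta_X\otimes\mathrm{id})$ and $\mathrm{tr}_q(f)=\widetilde{\mathrm{ev}}_X(f\otimes\mathrm{id})\mathrm{coev}_X$; a morphism $f:X\to Y$ is negligible if $\mathrm{tr}_q(gf)=0$ for all $g:Y\to X$. The functor $(M,N)\mapsto M^*\otimes N$ on $\mathrm{rep}_H$ has the coend $(A,i)$ with $A=H^*$, action $\langle h\triangleright f,x\rangle=f(S(h_{(1)})xh_{(2)})$, and $i_M:M^*\otimes M\to A$, $\langle i_M(l\otimes m),x\rangle=l(xm)$. $A$ is a Hopf algebra in $\mathrm{rep}_H$ with structure morphisms determined by $\Delta_Ai_X=(i_X\otimes i_X)(\mathrm{id}\otimes\mathrm{coev}_X\otimes\mathrm{id})$, $\varepsilon_Ai_X=\mathrm{ev}_X$,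 $\eta_A=i_{\Bbbk}$, $m_A(i_X\otimes i_Y)=i_{Y\otimes X}(\gamma_{X,Y}\otimes\mathrm{id})(\mathrm{id}_{X^*}\otimes c_{X,Y^*\otimes Y})$ with $\gamma_{X,Y}:X^*\otimes Y^*\simeq(Y\otimes X)^*$ canonical, $S_Ai_X=i_{X^*}(\beta_X\otimes\theta_{X^*})c_{X^*,X}$ with $\beta_X=(\widetilde{\mathrm{ev}}_X\otimes\mathrm{id}_{X^{**}})(\mathrm{id}_X\otimes\mathrm{coev}_{X^*}):X\simeq X^{**}$. With $\Gamma_l=(\mathrm{id}_A\otimes m_A)(\Delta_A\otimes\mathrm{id}_A)$ and $\Theta_\pm:A\to\Bbbk$ given by $\Theta_\pm i_X=\mathrm{ev}_X(\mathrm{id}\otimes\theta_X^{\pm1})$, $\mathcal I(\mathrm{rep}_H)$ is the set of $H$-linear $\alpha:\Bbbk\to A$ such that $S_A\alpha-\alpha$ and $\Gamma_l(\alpha\otimes\alpha)-\alpha\otimes\alpha$ are negligible, and $\mathcal I(\mathrm{rep}_H)^{\mathrm{norm}}$ is the set of $\alpha\in\mathcal I(\mathrm{rep}_H)$ with $\Theta_+\alpha\neq0\neq\Theta_-\alpha$. For $z\in H$ let $\phi_z:\Bbbk\to H^*$ be $1\mapsto\lambda\cdot z$; $z\mapsto\phi_z$ restricts to a $\Bbbk$-isomorphism $\phi:L(H)\to\mathrm{Hom}_{\mathrm{rep}_H}(\Bbbk,A)$. Then $\mathcal I(H)=\phi^{-1}(\mathcal I(\mathrm{rep}_H))$ and $\mathcal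 I(H)^{\mathrm{norm}}=\phi^{-1}(\mathcal I(\mathrm{rep}_H)^{\mathrm{norm}})$, subsets of $L(H)$. *)

theory Defs
  imports Complex_Main "HOL-Library.Groups_Big_Fun"
begin

section \<open>Finite-dimensional ribbon Hopf algebras\<close>

text \<open>
  The underlying algebra is a type \<open>'h\<close> of class \<open>ring_1\<close> with a scalar multiplication
  by the field \<open>'k\<close>.  The field \<open>bas\<close> is an arbitrary finite basis; it is used to
  represent tensors: an element \<open>t\<close> of \<open>H \<otimes> H\<close> is the family of its coordinates,
  \<open>t = (\<Sum>(b,c)\<in>bas\<times>bas. t (b,c) b \<otimes> c)\<close>, extended by 0 outside \<open>bas \<times> bas\<close>, and
  similarly for threefold tensors.
\<close>

record ('k, 'h) ribbon_data =
  scal   :: "'k \<Rightarrow> 'h \<Rightarrow> 'h"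
  bas    :: "'h set"
  cop    :: "'h \<Rightarrow> 'h \<times> 'h \<Rightarrow> 'k"
  counit :: "'h \<Rightarrow> 'k"
  antip  :: "'h \<Rightarrow> 'h"
  Rmat   :: "'h \<times> 'h \<Rightarrow> 'k"
  twist  :: 'h

definition crd :: "('k::field, 'h::ring_1) ribbon_data \<Rightarrow> 'h \<Rightarrow> 'h \<Rightarrow> 'k" where
  "crd H x = module.representation (scal H) (bas H) x"

definition tensor2 :: "('k::field, 'h::ring_1) ribbon_data \<Rightarrow> ('h \<times> 'h \<Rightarrow> 'k) set" where
  "tensor2 H = {t. \<forall>p. p \<notin> bas H \<times> bas H \<longrightarrow> t p = 0}"

text \<open>\<open>pure2 H x y\<close> is \<open>x \<otimes> y\<close> and \<open>pure3 H x y z\<close> is \<open>x \<otimes> y \<otimes> z\<close>.\<close>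

definition pure2 :: "('k::field, 'h::ring_1) ribbon_data \<Rightarrow> 'h \<Rightarrow> 'h \<Rightarrow> 'h \<times> 'h \<Rightarrow> 'k" where
  "pure2 H x y = (\<lambda>(b, c). crd H x b * crd H y c)"

definition pure3 ::
  "('k::field, 'h::ring_1) ribbon_data \<Rightarrow> 'h \<Rightarrow> 'h \<Rightarrow> 'h \<Rightarrow> 'h \<times> 'h \<times> 'h \<Rightarrow> 'k" where
  "pure3 H x y z = (\<lambda>(a, b, c). crd H x a * crd H y b * crd H z c)"

text \<open>
  The linear extension of a multilinear map \<open>f\<close>, evaluated at a tensor: for
  \<open>t = (\<Sum>i. x\<^sub>i \<otimes> y\<^sub>i)\<close> the value of \<open>ext2 H t f\<close> is \<open>\<Sum>i. f x\<^sub>i y\<^sub>i\<close>.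
  In particular \<open>ext2 H (cop H x) f\<close> is the Sweedler expression \<open>f(x\<^sub>(\<^sub>1\<^sub>), x\<^sub>(\<^sub>2\<^sub>))\<close>.
  The version \<open>ext2H\<close> is for \<open>H\<close>-valued \<open>f\<close>.
\<close>

definition ext2 ::
  "('k::field, 'h::ring_1) ribbon_data \<Rightarrow> ('h \<times> 'h \<Rightarrow> 'k) \<Rightarrow> ('h \<Rightarrow> 'h \<Rightarrow> 'k) \<Rightarrow> 'k" where
  "ext2 H t f = (\<Sum>(b, c) \<in> bas H \<times> bas H. t (b, c) * f b c)"

definition ext2H ::
  "('k::field, 'h::ring_1) ribbon_data \<Rightarrow> ('h \<times> 'h \<Rightarrow> 'k) \<Rightarrow> ('h \<Rightarrow> 'h \<Rightarrow> 'h) \<Rightarrow> 'h" where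
  "ext2H H t f = (\<Sum>(b, c) \<in> bas H \<times> bas H. scal H (t (b, c)) (f b c))"

definition ext3 ::
  "('k::field, 'h::ring_1) ribbon_data \<Rightarrow> ('h \<times> 'h \<times> 'h \<Rightarrow> 'k) \<Rightarrow> ('h \<Rightarrow> 'h \<Rightarrow> 'h \<Rightarrow> 'k) \<Rightarrow> 'k" where
  "ext3 H t f = (\<Sum>(a, b, c) \<in> bas H \<times> bas H \<times> bas H. t (a, b, c) * f a b c)"

definition mult2 ::
  "('k::field, 'h::ring_1) ribbon_data \<Rightarrow> ('h \<times> 'h \<Rightarrow> 'k) \<Rightarrow> ('h \<times> 'h \<Rightarrow> 'k) \<Rightarrow> 'h \<times> 'h \<Rightarrow> 'k" where
  "mult2 H s t = (\<lambda>p. ext2 H s (\<lambda>a b. ext2 H t (\<lambda>c d. pure2 H (a * c) (b * d) p)))"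

definition mult3 ::
  "('k::field, 'h::ring_1) ribbon_data \<Rightarrow> ('h \<times> 'h \<times> 'h \<Rightarrow> 'k) \<Rightarrow> ('h \<times> 'h \<times> 'h \<Rightarrow> 'k)
    \<Rightarrow> 'h \<times> 'h \<times> 'h \<Rightarrow> 'k" where
  "mult3 H s t = (\<lambda>p. ext3 H s (\<lambda>a b c. ext3 H t (\<lambda>d e f. pure3 H (a * d) (b * e) (c * f) p)))"

definition flip2 :: "('h \<times> 'h \<Rightarrow> 'k) \<Rightarrow> 'h \<times> 'h \<Rightarrow> 'k" where
  "flip2 t = (\<lambda>(b, c). t (c, b))"

definition cop_id ::
  "('k::field, 'h::ring_1) ribbon_data \<Rightarrow> ('h \<times> 'h \<Rightarrow> 'k) \<Rightarrow> 'h \<times> 'h \<times> 'h \<Rightarrow> 'k" where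
  "cop_id H t = (\<lambda>(a, b, c). ext2 H t (\<lambda>x y. cop H x (a, b) * crd H y c))"

definition id_cop ::
  "('k::field, 'h::ring_1) ribbon_data \<Rightarrow> ('h \<times> 'h \<Rightarrow> 'k) \<Rightarrow> 'h \<times> 'h \<times> 'h \<Rightarrow> 'k" where
  "id_cop H t = (\<lambda>(a, b, c). ext2 H t (\<lambda>x y. crd H x a * cop H y (b, c)))"

abbreviation lin_form :: "('k::field, 'h::ring_1) ribbon_data \<Rightarrow> ('h \<Rightarrow> 'k) \<Rightarrow> bool" where
  "lin_form H f \<equiv> Vector_Spaces.linear (scal H) (*) f"

definition alg_character :: "('k::field, 'h::ring_1) ribbon_data \<Rightarrow> ('h \<Rightarrow> 'k) \<Rightarrow> bool" where
  "alg_character H f \<longleftrightarrow> lin_form H f \<and> f 1 = 1 \<and> (\<forall>x y. f (x * y) = f x * f y)"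

definition fd_algebra :: "('k::field, 'h::ring_1) ribbon_data \<Rightarrow> bool" where
  "fd_algebra H \<longleftrightarrow>
     finite_dimensional_vector_space (scal H) (bas H) \<and>
     (\<forall>c x y. scal H c (x * y) = scal H c x * y) \<and>
     (\<forall>c x y. scal H c (x * y) = x * scal H c y)"

definition hopf_algebra :: "('k::field, 'h::ring_1) ribbon_data \<Rightarrow> bool" where
  "hopf_algebra H \<longleftrightarrow>
     fd_algebra H \<and>
     (\<forall>x. cop H x \<in> tensor2 H) \<and>
     (\<forall>p. lin_form H (\<lambda>x. cop H x p)) \<and>
     (\<forall>x. cop_id H (cop H x) = id_cop H (cop H x)) \<and>
     cop H 1 = pure2 H 1 1 \<and>
     (\<forall>x y. cop H (x * y) = mult2 H (cop H x) (cop H y)) \<and>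
     alg_character H (counit H) \<and>
     (\<forall>x. ext2H H (cop H x) (\<lambda>x1 x2. scal H (counit H x1) x2) = x) \<and>
     (\<forall>x. ext2H H (cop H x) (\<lambda>x1 x2. scal H (counit H x2) x1) = x) \<and>
     Vector_Spaces.linear (scal H) (scal H) (antip H) \<and>
     (\<forall>x. ext2H H (cop H x) (\<lambda>x1 x2. antip H x1 * x2) = scal H (counit H x) 1) \<and>
     (\<forall>x. ext2H H (cop H x) (\<lambda>x1 x2. x1 * antip H x2) = scal H (counit H x) 1)"

definition R12 :: "('k::field, 'h::ring_1) ribbon_data \<Rightarrow> 'h \<times> 'h \<times> 'h \<Rightarrow> 'k" where
  "R12 H = (\<lambda>p. ext2 H (Rmat H) (\<lambda>a b. pure3 H a b 1 p))"

definition R13 :: "('k::field, 'h::ring_1) ribbon_data \<Rightarrow> 'h \<times> 'h \<times> 'h \<Rightarrow> 'k" where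
  "R13 H = (\<lambda>p. ext2 H (Rmat H) (\<lambda>a b. pure3 H a 1 b p))"

definition R23 :: "('k::field, 'h::ring_1) ribbon_data \<Rightarrow> 'h \<times> 'h \<times> 'h \<Rightarrow> 'k" where
  "R23 H = (\<lambda>p. ext2 H (Rmat H) (\<lambda>a b. pure3 H 1 a b p))"

definition is_Rmatrix :: "('k::field, 'h::ring_1) ribbon_data \<Rightarrow> bool" where
  "is_Rmatrix H \<longleftrightarrow>
     Rmat H \<in> tensor2 H \<and>
     (\<exists>Q \<in> tensor2 H. mult2 H (Rmat H) Q = pure2 H 1 1 \<and> mult2 H Q (Rmat H) = pure2 H 1 1) \<and>
     (\<forall>x. mult2 H (Rmat H) (cop H x) = mult2 H (flip2 (cop H x)) (Rmat H)) \<and>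
     id_cop H (Rmat H) = mult3 H (R13 H) (R12 H) \<and>
     cop_id H (Rmat H) = mult3 H (R13 H) (R23 H)"

definition is_twist :: "('k::field, 'h::ring_1) ribbon_data \<Rightarrow> bool" where
  "is_twist H \<longleftrightarrow>
     (\<exists>y. twist H * y = 1 \<and> y * twist H = 1) \<and>
     (\<forall>x. twist H * x = x * twist H) \<and>
     antip H (twist H) = twist H \<and>
     cop H (twist H) =
       mult2 H (pure2 H (twist H) (twist H)) (mult2 H (flip2 (Rmat H)) (Rmat H))"

definition ribbon_hopf_algebra :: "('k::field, 'h::ring_1) ribbon_data \<Rightarrow> bool" where
  "ribbon_hopf_algebra H \<longleftrightarrow> hopf_algebra H \<and> is_Rmatrix H \<and> is_twist H"

definition twist_inv :: "('k::field, 'h::ring_1) ribbon_data \<Rightarrow> 'h" where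
  "twist_inv H = (THE y. twist H * y = 1 \<and> y * twist H = 1)"

definition Z_center :: "('k::field, 'h::ring_1) ribbon_data \<Rightarrow> 'h set" where
  "Z_center H = {a. \<forall>x. a * x = x * a}"


section \<open>Integrals, the distinguished grouplike element, and the sets of the theorem\<close>

text \<open>\<open>ract H x f\<close> is \<open>x \<leftharpoonup> f = f(x\<^sub>(\<^sub>1\<^sub>)) x\<^sub>(\<^sub>2\<^sub>)\<close>.\<close>

definition ract :: "('k::field, 'h::ring_1) ribbon_data \<Rightarrow> 'h \<Rightarrow> ('h \<Rightarrow> 'k) \<Rightarrow> 'h" where
  "ract H x f = ext2H H (cop H x) (\<lambda>x1 x2. scal H (f x1) x2)"

definition right_integral_dual :: "('k::field, 'h::ring_1) ribbon_data \<Rightarrow> ('h \<Rightarrow> 'k) \<Rightarrow> bool" where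
  "right_integral_dual H lam \<longleftrightarrow>
     lin_form H lam \<and>
     (\<forall>x. ext2H H (cop H x) (\<lambda>x1 x2. scal H (lam x1) x2) = scal H (lam x) 1)"

definition left_integral :: "('k::field, 'h::ring_1) ribbon_data \<Rightarrow> 'h \<Rightarrow> bool" where
  "left_integral H L \<longleftrightarrow> (\<forall>x. x * L = scal H (counit H x) L)"

definition nu :: "('k::field, 'h::ring_1) ribbon_data \<Rightarrow> 'h \<Rightarrow> 'k" where
  "nu H = (THE f. alg_character H f \<and> (\<forall>L x. left_integral H L \<longrightarrow> L * x = scal H (f x) L))"

definition h_nu :: "('k::field, 'h::ring_1) ribbon_data \<Rightarrow> 'h" where
  "h_nu H = ext2H H (Rmat H) (\<lambda>a b. scal H (nu H b) a)"

definition T_op :: "('k::field, 'h::ring_1) ribbon_data \<Rightarrow> 'h \<Rightarrow> 'h" where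
  "T_op H z = ract H (antip H z) (nu H) * h_nu H"

definition L_set :: "('k::field, 'h::ring_1) ribbon_data \<Rightarrow> 'h set" where
  "L_set H = {z. \<forall>x. ract H x (nu H) * z = z * x}"

definition N_set :: "('k::field, 'h::ring_1) ribbon_data \<Rightarrow> ('h \<Rightarrow> 'k) \<Rightarrow> 'h set" where
  "N_set H lam = {z \<in> L_set H. \<forall>a \<in> Z_center H. lam (z * a) = 0}"

text \<open>
  \<open>(x \<otimes> y) \<triangleleft> h = S(h\<^sub>(\<^sub>1\<^sub>)) x h\<^sub>(\<^sub>2\<^sub>) \<otimes> S(h\<^sub>(\<^sub>3\<^sub>)) y h\<^sub>(\<^sub>4\<^sub>)\<close>, with the fourfold coproduct
  taken as \<open>(\<Delta> \<otimes> \<Delta>)\<Delta>\<close>.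
\<close>

definition tri2 ::
  "('k::field, 'h::ring_1) ribbon_data \<Rightarrow> ('h \<times> 'h \<Rightarrow> 'k) \<Rightarrow> 'h \<Rightarrow> 'h \<times> 'h \<Rightarrow> 'k" where
  "tri2 H X h = (\<lambda>p.
     ext2 H X (\<lambda>x y.
       ext2 H (cop H h) (\<lambda>h' h''.
         ext2 H (cop H h') (\<lambda>h1 h2.
           ext2 H (cop H h'') (\<lambda>h3 h4.
             pure2 H (antip H h1 * x * h2) (antip H h3 * y * h4) p)))))"

definition V2_set :: "('k::field, 'h::ring_1) ribbon_data \<Rightarrow> ('h \<times> 'h \<Rightarrow> 'k) set" where
  "V2_set H = {X \<in> tensor2 H. \<forall>h. tri2 H X h = (\<lambda>p. counit H h * X p)}"


section \<open>The ribbon category of finite-dimensional modules\<close>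

text \<open>
  Finite-dimensional vector spaces are coordinate spaces \<open>k\<^sup>I\<close> with \<open>I\<close> a finite index
  set.  A linear map \<open>k\<^sup>I \<rightarrow> k\<^sup>J\<close> is a matrix \<open>f\<close>, with \<open>f j i\<close> the coefficient of \<open>e\<^sub>j\<close> in
  \<open>f(e\<^sub>i)\<close>, extended by 0 outside \<open>J \<times> I\<close>.  As all matrices have finite support,
  composition needs no reference to the intermediate index set.
\<close>

definition mcomp :: "('c \<Rightarrow> 'b \<Rightarrow> 'k::field) \<Rightarrow> ('b \<Rightarrow> 'a \<Rightarrow> 'k) \<Rightarrow> 'c \<Rightarrow> 'a \<Rightarrow> 'k"
    (infixr \<open>\<odot>\<close> 70) where
  "g \<odot> f = (\<lambda>k i. Sum_any (\<lambda>j. g k j * f j i))"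

definition mtens ::
  "('c \<Rightarrow> 'a \<Rightarrow> 'k::field) \<Rightarrow> ('d \<Rightarrow> 'b \<Rightarrow> 'k) \<Rightarrow> 'c \<times> 'd \<Rightarrow> 'a \<times> 'b \<Rightarrow> 'k"
    (infixr \<open>\<otimes>\<close> 75) where
  "f \<otimes> g = (\<lambda>(k, l) (i, j). f k i * g l j)"

text \<open>The matrix of the linear map on \<open>k\<^sup>I\<close> sending \<open>e\<^sub>i\<close> to the basis vector with index \<open>r i\<close>.\<close>

definition reindex :: "'a set \<Rightarrow> ('a \<Rightarrow> 'b) \<Rightarrow> 'b \<Rightarrow> 'a \<Rightarrow> 'k::field" where
  "reindex I r = (\<lambda>j i. if i \<in> I \<and> j = r i then 1 else 0)"

record ('k, 'h, 'a) hmod =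
  idx :: "'a set"
  act :: "'h \<Rightarrow> 'a \<Rightarrow> 'a \<Rightarrow> 'k"

definition is_hmod ::
  "('k::field, 'h::ring_1) ribbon_data \<Rightarrow> ('k, 'h, 'a) hmod \<Rightarrow> bool" where
  "is_hmod H M \<longleftrightarrow>
     finite (idx M) \<and>
     (\<forall>h i j. i \<notin> idx M \<or> j \<notin> idx M \<longrightarrow> act M h i j = 0) \<and>
     (\<forall>i j. lin_form H (\<lambda>h. act M h i j)) \<and>
     act M 1 = reindex (idx M) id \<and>
     (\<forall>x y. act M (x * y) = act M x \<odot> act M y)"

definition hom ::
  "('k::field, 'h::ring_1, 'a) hmod \<Rightarrow> ('k, 'h, 'b) hmod \<Rightarrow> ('b \<Rightarrow> 'a \<Rightarrow> 'k) set" where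
  "hom M N = {f. (\<forall>j i. j \<notin> idx N \<or> i \<notin> idx M \<longrightarrow> f j i = 0) \<and>
                 (\<forall>h. f \<odot> act M h = act N h \<odot> f)}"

definition id_mor :: "('k::field, 'h::ring_1, 'a) hmod \<Rightarrow> 'a \<Rightarrow> 'a \<Rightarrow> 'k" where
  "id_mor M = reindex (idx M) id"

definition unit_mod :: "('k::field, 'h::ring_1) ribbon_data \<Rightarrow> ('k, 'h, unit) hmod" where
  "unit_mod H = \<lparr>idx = UNIV, act = (\<lambda>h _ _. counit H h)\<rparr>"

definition tens_mod ::
  "('k::field, 'h::ring_1) ribbon_data \<Rightarrow> ('k, 'h, 'a) hmod \<Rightarrow> ('k, 'h, 'b) hmod
    \<Rightarrow> ('k, 'h, 'a \<times> 'b) hmod" where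
  "tens_mod H M N =
     \<lparr>idx = idx M \<times> idx N,
      act = (\<lambda>h p q. ext2 H (cop H h) (\<lambda>h1 h2. (act M h1 \<otimes> act N h2) p q))\<rparr>"

text \<open>\<open>M\<^sup>*\<close> carries the dual basis, so \<open>h\<close> acts by the transpose of the matrix of \<open>S(h)\<close>.\<close>

definition dual_mod ::
  "('k::field, 'h::ring_1) ribbon_data \<Rightarrow> ('k, 'h, 'a) hmod \<Rightarrow> ('k, 'h, 'a) hmod" where
  "dual_mod H M = \<lparr>idx = idx M, act = (\<lambda>h i j. act M (antip H h) j i)\<rparr>"

definition ev :: "('k::field, 'h::ring_1, 'a) hmod \<Rightarrow> unit \<Rightarrow> 'a \<times> 'a \<Rightarrow> 'k" where
  "ev M = (\<lambda>_ (i, j). if i \<in> idx M \<and> i = j then 1 else 0)"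

definition coev :: "('k::field, 'h::ring_1, 'a) hmod \<Rightarrow> 'a \<times> 'a \<Rightarrow> unit \<Rightarrow> 'k" where
  "coev M = (\<lambda>(i, j) _. if i \<in> idx M \<and> i = j then 1 else 0)"

text \<open>The braiding \<open>m \<otimes> n \<mapsto> \<Sum>i. b\<^sub>i n \<otimes> a\<^sub>i m\<close> for \<open>R = (\<Sum>i. a\<^sub>i \<otimes> b\<^sub>i)\<close>.\<close>

definition braid ::
  "('k::field, 'h::ring_1) ribbon_data \<Rightarrow> ('k, 'h, 'a) hmod \<Rightarrow> ('k, 'h, 'b) hmod
    \<Rightarrow> 'b \<times> 'a \<Rightarrow> 'a \<times> 'b \<Rightarrow> 'k" where
  "braid H M N = (\<lambda>(q, p) (i, j). ext2 H (Rmat H) (\<lambda>a b. act N b q j * act M a p i))"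

definition theta_mor ::
  "('k::field, 'h::ring_1) ribbon_data \<Rightarrow> ('k, 'h, 'a) hmod \<Rightarrow> 'a \<Rightarrow> 'a \<Rightarrow> 'k" where
  "theta_mor H M = act M (twist H)"

definition theta_inv_mor ::
  "('k::field, 'h::ring_1) ribbon_data \<Rightarrow> ('k, 'h, 'a) hmod \<Rightarrow> 'a \<Rightarrow> 'a \<Rightarrow> 'k" where
  "theta_inv_mor H M = act M (twist_inv H)"

text \<open>
  Associativity and unit isomorphisms, which are suppressed in the usual notation:
  \<open>assoc : (M\<otimes>N)\<otimes>P \<rightarrow> M\<otimes>(N\<otimes>P)\<close>, \<open>lunit : k\<otimes>M \<rightarrow> M\<close>; the suffix \<open>_inv\<close> is for the
  inverses, and \<open>runit_inv : M \<rightarrow> M\<otimes>k\<close>.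
\<close>

definition assoc ::
  "('k::field, 'h::ring_1, 'a) hmod \<Rightarrow> ('k, 'h, 'b) hmod \<Rightarrow> ('k, 'h, 'c) hmod
    \<Rightarrow> 'a \<times> ('b \<times> 'c) \<Rightarrow> ('a \<times> 'b) \<times> 'c \<Rightarrow> 'k" where
  "assoc M N P = reindex ((idx M \<times> idx N) \<times> idx P) (\<lambda>((i, j), k). (i, (j, k)))"

definition assoc_inv ::
  "('k::field, 'h::ring_1, 'a) hmod \<Rightarrow> ('k, 'h, 'b) hmod \<Rightarrow> ('k, 'h, 'c) hmod
    \<Rightarrow> ('a \<times> 'b) \<times> 'c \<Rightarrow> 'a \<times> ('b \<times> 'c) \<Rightarrow> 'k" where
  "assoc_inv M N P = reindex (idx M \<times> (idx N \<times> idx P)) (\<lambda>(i, (j, k)). ((i, j), k))"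

definition lunit :: "('k::field, 'h::ring_1, 'a) hmod \<Rightarrow> 'a \<Rightarrow> unit \<times> 'a \<Rightarrow> 'k" where
  "lunit M = reindex (UNIV \<times> idx M) snd"

definition lunit_inv :: "('k::field, 'h::ring_1, 'a) hmod \<Rightarrow> unit \<times> 'a \<Rightarrow> 'a \<Rightarrow> 'k" where
  "lunit_inv M = reindex (idx M) (\<lambda>i. ((), i))"

definition runit_inv :: "('k::field, 'h::ring_1, 'a) hmod \<Rightarrow> 'a \<times> unit \<Rightarrow> 'a \<Rightarrow> 'k" where
  "runit_inv M = reindex (idx M) (\<lambda>i. (i, ()))"

definition ev_tilde ::
  "('k::field, 'h::ring_1) ribbon_data \<Rightarrow> ('k, 'h, 'a) hmod \<Rightarrow> unit \<Rightarrow> 'a \<times> 'a \<Rightarrow> 'k" where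
  "ev_tilde H X = ev X \<odot> braid H X (dual_mod H X) \<odot> (theta_mor H X \<otimes> id_mor (dual_mod H X))"

text \<open>An endomorphism of the unit object is identified with its single matrix entry.\<close>

definition qtr ::
  "('k::field, 'h::ring_1) ribbon_data \<Rightarrow> ('k, 'h, 'a) hmod \<Rightarrow> ('a \<Rightarrow> 'a \<Rightarrow> 'k) \<Rightarrow> 'k" where
  "qtr H X f = (ev_tilde H X \<odot> (f \<otimes> id_mor (dual_mod H X)) \<odot> coev X) () ()"

definition negligible ::
  "('k::field, 'h::ring_1) ribbon_data \<Rightarrow> ('k, 'h, 'a) hmod \<Rightarrow> ('k, 'h, 'b) hmod
    \<Rightarrow> ('b \<Rightarrow> 'a \<Rightarrow> 'k) \<Rightarrow> bool" where
  "negligible H X Y f \<longleftrightarrow> (\<forall>g \<in> hom Y X. qtr H X (g \<odot> f) = 0)"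


section \<open>The coend \<open>A\<close> and its structure morphisms\<close>

text \<open>
  \<open>A = H\<^sup>*\<close> with the basis dual to \<open>bas H\<close>: the form \<open>f\<close> has coordinates \<open>f b\<close>,
  \<open>b \<in> bas H\<close>, and the coordinate at \<open>c\<close> of \<open>h \<triangleright> b\<^sup>*\<close> is \<open>b\<^sup>*(S(h\<^sub>(\<^sub>1\<^sub>)) c h\<^sub>(\<^sub>2\<^sub>))\<close>.
\<close>

definition A_mod :: "('k::field, 'h::ring_1) ribbon_data \<Rightarrow> ('k, 'h, 'h) hmod" where
  "A_mod H =
     \<lparr>idx = bas H,
      act = (\<lambda>h c b. if c \<in> bas H
                     then ext2 H (cop H h) (\<lambda>h1 h2. crd H (antip H h1 * c * h2) b) else 0)\<rparr>"

definition i_mor ::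
  "('k::field, 'h::ring_1) ribbon_data \<Rightarrow> ('k, 'h, 'a) hmod \<Rightarrow> 'h \<Rightarrow> 'a \<times> 'a \<Rightarrow> 'k" where
  "i_mor H M = (\<lambda>c (i, j). if c \<in> bas H then act M c i j else 0)"

text \<open>
  The structure morphisms of \<open>A\<close> are determined by the equations below, required for all
  objects of the category.  Up to isomorphism all finite-dimensional modules are
  \<open>nat\<close>-indexed, so \<open>X\<close> and \<open>Y\<close> range over the modules with a finite index set of naturals.
\<close>

definition Delta_A :: "('k::field, 'h::ring_1) ribbon_data \<Rightarrow> 'h \<times> 'h \<Rightarrow> 'h \<Rightarrow> 'k" where
  "Delta_A H = (THE D. D \<in> hom (A_mod H) (tens_mod H (A_mod H) (A_mod H)) \<and>
     (\<forall>X :: ('k, 'h, nat) hmod. is_hmod H X \<longrightarrow>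
        (let X' = dual_mod H X in
         D \<odot> i_mor H X =
           (i_mor H X \<otimes> i_mor H X)
           \<odot> assoc_inv X' X (tens_mod H X' X)
           \<odot> (id_mor X' \<otimes> assoc X X' X)
           \<odot> (id_mor X' \<otimes> coev X \<otimes> id_mor X)
           \<odot> (id_mor X' \<otimes> lunit_inv X))))"

text \<open>
  \<open>gamma X Y : X\<^sup>* \<otimes> Y\<^sup>* \<rightarrow> (Y \<otimes> X)\<^sup>*\<close> sends \<open>l \<otimes> l'\<close> to \<open>y \<otimes> x \<mapsto> l'(y) l(x)\<close>.
\<close>

definition gamma ::
  "('k::field, 'h::ring_1, 'a) hmod \<Rightarrow> ('k, 'h, 'b) hmod \<Rightarrow> 'b \<times> 'a \<Rightarrow> 'a \<times> 'b \<Rightarrow> 'k" where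
  "gamma X Y = reindex (idx X \<times> idx Y) (\<lambda>(i, j). (j, i))"

definition m_A :: "('k::field, 'h::ring_1) ribbon_data \<Rightarrow> 'h \<Rightarrow> 'h \<times> 'h \<Rightarrow> 'k" where
  "m_A H = (THE m. m \<in> hom (tens_mod H (A_mod H) (A_mod H)) (A_mod H) \<and>
     (\<forall>(X :: ('k, 'h, nat) hmod) (Y :: ('k, 'h, nat) hmod). is_hmod H X \<longrightarrow> is_hmod H Y \<longrightarrow>
        (let X' = dual_mod H X; Y' = dual_mod H Y in
         m \<odot> (i_mor H X \<otimes> i_mor H Y) =
           i_mor H (tens_mod H Y X)
           \<odot> (gamma X Y \<otimes> id_mor (tens_mod H Y X))
           \<odot> assoc_inv X' Y' (tens_mod H Y X)
           \<odot> (id_mor X' \<otimes> assoc Y' Y X)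
           \<odot> (id_mor X' \<otimes> braid H X (tens_mod H Y' Y))
           \<odot> assoc X' X (tens_mod H Y' Y))))"

definition beta ::
  "('k::field, 'h::ring_1) ribbon_data \<Rightarrow> ('k, 'h, 'a) hmod \<Rightarrow> 'a \<Rightarrow> 'a \<Rightarrow> 'k" where
  "beta H X =
     (let X' = dual_mod H X; X'' = dual_mod H X' in
      lunit X''
      \<odot> (ev_tilde H X \<otimes> id_mor X'')
      \<odot> assoc_inv X X' X''
      \<odot> (id_mor X \<otimes> coev X')
      \<odot> runit_inv X)"

definition S_A :: "('k::field, 'h::ring_1) ribbon_data \<Rightarrow> 'h \<Rightarrow> 'h \<Rightarrow> 'k" where
  "S_A H = (THE s. s \<in> hom (A_mod H) (A_mod H) \<and>
     (\<forall>X :: ('k, 'h, nat) hmod. is_hmod H X \<longrightarrow>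
        (let X' = dual_mod H X in
         s \<odot> i_mor H X =
           i_mor H X' \<odot> (beta H X \<otimes> theta_mor H X') \<odot> braid H X' X)))"

definition Theta_plus :: "('k::field, 'h::ring_1) ribbon_data \<Rightarrow> unit \<Rightarrow> 'h \<Rightarrow> 'k" where
  "Theta_plus H = (THE t. t \<in> hom (A_mod H) (unit_mod H) \<and>
     (\<forall>X :: ('k, 'h, nat) hmod. is_hmod H X \<longrightarrow>
        t \<odot> i_mor H X = ev X \<odot> (id_mor (dual_mod H X) \<otimes> theta_mor H X)))"

definition Theta_minus :: "('k::field, 'h::ring_1) ribbon_data \<Rightarrow> unit \<Rightarrow> 'h \<Rightarrow> 'k" where
  "Theta_minus H = (THE t. t \<in> hom (A_mod H) (unit_mod H) \<and>
     (\<forall>X :: ('k, 'h, nat) hmod. is_hmod H X \<longrightarrow>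
        t \<odot> i_mor H X = ev X \<odot> (id_mor (dual_mod H X) \<otimes> theta_inv_mor H X)))"

definition Gamma_l :: "('k::field, 'h::ring_1) ribbon_data \<Rightarrow> 'h \<times> 'h \<Rightarrow> 'h \<times> 'h \<Rightarrow> 'k" where
  "Gamma_l H =
     (id_mor (A_mod H) \<otimes> m_A H)
     \<odot> assoc (A_mod H) (A_mod H) (A_mod H)
     \<odot> (Delta_A H \<otimes> id_mor (A_mod H))"


section \<open>The sets \<open>\<I>(rep\<^sub>H)\<close> and \<open>\<I>(H)\<close>\<close>

definition I_rep :: "('k::field, 'h::ring_1) ribbon_data \<Rightarrow> ('h \<Rightarrow> unit \<Rightarrow> 'k) set" where
  "I_rep H = {\<alpha> \<in> hom (unit_mod H) (A_mod H).
     negligible H (unit_mod H) (A_mod H) (S_A H \<odot> \<alpha> - \<alpha>) \<and>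
     (let \<alpha>\<alpha> = (\<alpha> \<otimes> \<alpha>) \<odot> lunit_inv (unit_mod H) in
      negligible H (unit_mod H) (tens_mod H (A_mod H) (A_mod H)) (Gamma_l H \<odot> \<alpha>\<alpha> - \<alpha>\<alpha>))}"

definition I_rep_norm :: "('k::field, 'h::ring_1) ribbon_data \<Rightarrow> ('h \<Rightarrow> unit \<Rightarrow> 'k) set" where
  "I_rep_norm H = {\<alpha> \<in> I_rep H.
     (Theta_plus H \<odot> \<alpha>) () () \<noteq> 0 \<and> (Theta_minus H \<odot> \<alpha>) () () \<noteq> 0}"

text \<open>\<open>phi H lam z\<close> is the map \<open>1 \<mapsto> \<lambda>\<cdot>z\<close>, where \<open>\<langle>\<lambda>\<cdot>z, x\<rangle> = \<lambda>(z x)\<close>.\<close>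

definition phi ::
  "('k::field, 'h::ring_1) ribbon_data \<Rightarrow> ('h \<Rightarrow> 'k) \<Rightarrow> 'h \<Rightarrow> 'h \<Rightarrow> unit \<Rightarrow> 'k" where
  "phi H lam z = (\<lambda>b _. if b \<in> bas H then lam (z * b) else 0)"

definition I_set :: "('k::field, 'h::ring_1) ribbon_data \<Rightarrow> ('h \<Rightarrow> 'k) \<Rightarrow> 'h set" where
  "I_set H lam = {z \<in> L_set H. phi H lam z \<in> I_rep H}"

definition I_set_norm :: "('k::field, 'h::ring_1) ribbon_data \<Rightarrow> ('h \<Rightarrow> 'k) \<Rightarrow> 'h set" where
  "I_set_norm H lam = {z \<in> L_set H. phi H lam z \<in> I_rep_norm H}"

end

theory Submission
  imports Defs
begin

text \<open>
  A morphism from the unit to \<open>Y\<close> is negligible iff every morphism \<open>Y \<rightarrow> k\<close> kills it.  Morphisms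
  \<open>A \<rightarrow> k\<close> are central elements of \<open>H\<close> and morphisms \<open>A \<otimes> A \<rightarrow> k\<close> are elements of \<open>V\<^sub>2(H)\<close>, so
  both conditions on \<open>\<alpha> = \<lambda>\<cdot>z\<close> become identities between values of \<open>\<lambda>\<close>.

  For \<open>z \<in> L(H)\<close> the form \<open>\<alpha>\<close> satisfies \<open>\<alpha>(x y) = \<alpha>(S\<^sup>2(y) x)\<close>, by the Nakayama automorphism of
  \<open>\<lambda>\<close>.  Hence \<open>(S\<^sub>A \<alpha>)(x) = \<alpha>(S(x) G\<^sup>2)\<close>, which is \<open>\<lambda>(T(z) x)\<close> because
  \<open>\<lambda>(S(x)) = \<lambda>(G\<^sup>2 h\<^sub>\<nu> x)\<close>.

  The slide \<open>\<Gamma>\<^sub>l(\<alpha> \<otimes> \<alpha>)\<close> takes \<open>x \<otimes> y\<close> to \<open>\<alpha>(y\<^sub>(\<^sub>1\<^sub>)) \<alpha>(x y\<^sub>(\<^sub>2\<^sub>))\<close>, whereas condition (b) has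
  \<open>\<alpha>(x\<^sub>(\<^sub>1\<^sub>)) \<alpha>(x\<^sub>(\<^sub>2\<^sub>) y)\<close>.  The bijection \<open>x \<otimes> y \<mapsto> S\<^sup>-\<^sup>2(y) \<otimes> x\<close> of \<open>V\<^sub>2(H)\<close> exchanges the two up to
  an action of \<open>G\<^sup>2\<close> on one leg, which has no effect since left and right quantum traces agree.
\<close>

section \<open>Matrices\<close>

text \<open>Two obstacles shape the proof. First, the structure morphisms of A are definite
  descriptions over all \<open>nat\<close>-indexed modules. Each is replaced by the transpose of an
  explicit map of H, which must be H-linear, satisfy the defining equation and be unique. The
  R-matrix in the product of A drops out of the slide, because alpha is invariant and (id \<otimes>
  eps)(R) = 1. Second, the theory of integrals is built from the axioms: injectivity of S,
  nondegeneracy of lam, a left integral Lam with lam(Lam) = 1, and the Nakayama formula. The factor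
  G^2 h_nu in lam(S(x)) is the element E with x1 lam(x2) = lam(x) E, and Drinfeld's relation E = G^2
  h_nu ties the integral to the ribbon structure. The relation pays twice: it displays G^2 as a
  product of grouplikes, so G^2 acts on tensors leg by leg. This makes the fourth power of x
  \<otimes> y -> S^-2(y) \<otimes> x the diagonal action of G^2, trivial on V2(H), which is why that
  map is a bijection there.\<close>

lemma mcomp_sum:
  assumes "finite J" "\<And>j. j \<notin> J \<Longrightarrow> g k j * f j i = 0"
  shows "(g \<odot> f) k i = (\<Sum>j\<in>J. g k j * f j i)"
  unfolding mcomp_def by (rule Sum_any.expand_superset) (use assms in auto)

lemma mcomp_single:
  assumes "\<And>j. j \<noteq> j0 \<Longrightarrow> g k j * f j i = 0"
  shows "(g \<odot> f) k i = g k j0 * f j0 i"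
  by (subst mcomp_sum[of "{j0}"]) (use assms in auto)

lemma mcomp_zero:
  assumes "\<And>j. g k j * f j i = 0" shows "(g \<odot> f) k i = 0"
  by (subst mcomp_sum[of "{}"]) (use assms in auto)

lemma mcomp_unit: "(g \<odot> f) k i = g k () * f () i"
  by (rule mcomp_single) simp

text \<open>The supports of the two sums correspond under \<open>Pair a\<close>, so the identity
  survives even where \<open>Sum_any\<close> defaults to 0 on an infinite support.\<close>

lemma id_tens_comp:
  "((id_mor M \<otimes> g) \<odot> f) (a, b) i = (if a \<in> idx M then (g \<odot> (\<lambda>b' i. f (a, b') i)) b i else 0)"
proof (cases "a \<in> idx M")
  case True
  let ?S = "{b'. g b b' * f (a, b') i \<noteq> 0}"
  have eq: "(id_mor M \<otimes> g) (a, b) (a', b') = (if a' = a then g b b' else 0)" for a' b'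
    using True by (auto simp: mtens_def id_mor_def reindex_def)
  have "{p. (id_mor M \<otimes> g) (a, b) p * f p i \<noteq> 0} = Pair a ` ?S"
    by (auto simp: eq split: if_splits)
  then have "((id_mor M \<otimes> g) \<odot> f) (a, b) i = (\<Sum>p\<in>Pair a ` ?S. (id_mor M \<otimes> g) (a, b) p * f p i)"
    by (simp add: mcomp_def Sum_any.expand_set)
  also have "\<dots> = (\<Sum>b'\<in>?S. g b b' * f (a, b') i)"
    by (subst sum.reindex) (auto simp: eq inj_on_def)
  finally show ?thesis using True by (simp add: mcomp_def Sum_any.expand_set)
next
  case False
  then show ?thesis
    by (auto intro!: mcomp_zero simp: mtens_def id_mor_def reindex_def)
qed

lemma assoc_comp: "(assoc M N P \<odot> f) (a, (b, c)) i =
    (if a \<in> idx M \<and> b \<in> idx N \<and> c \<in> idx P then f ((a, b), c) i else 0)"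
  by (subst mcomp_single[of "((a, b), c)"]) (auto simp: assoc_def reindex_def)

lemma assoc_inv_comp: "(assoc_inv M N P \<odot> f) ((a, b), c) i =
    (if a \<in> idx M \<and> b \<in> idx N \<and> c \<in> idx P then f (a, (b, c)) i else 0)"
  by (subst mcomp_single[of "(a, (b, c))"]) (auto simp: assoc_inv_def reindex_def)

lemma mtens_apply: "(f \<otimes> g) (k, l) (i, j) = f k i * g l j"
  by (simp add: mtens_def)

text \<open>Contraction pattern of the product of the coend: \<open>j\<close> runs over the module X
  and splits off, while \<open>k\<close> and \<open>l\<close> run over Y and stay coupled through
  \<open>A\<close>.\<close>

lemma sum3_factor:
  fixes A :: "'a \<Rightarrow> 'b \<Rightarrow> 'k::field"
  shows "(\<Sum>k\<in>K. \<Sum>l\<in>L. \<Sum>j\<in>J. (A k l * X j) * ((C k * D l) * E j)) =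
    (\<Sum>j\<in>J. X j * E j) * (\<Sum>k\<in>K. C k * (\<Sum>l\<in>L. A k l * D l))"
proof -
  have "(\<Sum>j\<in>J. (A k l * X j) * ((C k * D l) * E j)) = (\<Sum>j\<in>J. X j * E j) * (C k * (A k l * D l))" for k l
    unfolding sum_distrib_right by (intro sum.cong refl) (simp add: ac_simps)
  then show ?thesis by (simp add: sum_distrib_left[symmetric])
qed

lemma gamma_id_comp:
  assumes "i \<in> idx X" "k \<in> idx Y" "p \<in> idx P"
  shows "((gamma X Y \<otimes> id_mor P) \<odot> f) ((k, i), p) q = f ((i, k), p) q"
  by (subst mcomp_single[of "((i, k), p)"])
    (use assms in \<open>auto simp: mtens_apply gamma_def id_mor_def reindex_def split: if_splits\<close>)

section \<open>Ribbon Hopf algebras\<close>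

locale ribbon =
  fixes H :: "('k::field, 'h::ring_1) ribbon_data"
  assumes ribbon: "ribbon_hopf_algebra H"
begin

abbreviation sc :: "'k \<Rightarrow> 'h \<Rightarrow> 'h" where "sc \<equiv> scal H"
abbreviation B :: "'h set" where "B \<equiv> bas H"
abbreviation cu :: "'h \<Rightarrow> 'k" where "cu \<equiv> counit H"
abbreviation S :: "'h \<Rightarrow> 'h" where "S \<equiv> antip H"
abbreviation tw :: 'h where "tw \<equiv> twist H"

text \<open>
  \<open>Sw x F\<close> is the Sweedler expression \<open>F(x\<^sub>(\<^sub>1\<^sub>), x\<^sub>(\<^sub>2\<^sub>))\<close> and \<open>RR F\<close> is \<open>\<Sum>i. F(a\<^sub>i, b\<^sub>i)\<close>.  As tensors
  are only available through coordinates, identities between them are stated and proved by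
  testing against multilinear forms.
\<close>

abbreviation Sw :: "'h \<Rightarrow> ('h \<Rightarrow> 'h \<Rightarrow> 'k) \<Rightarrow> 'k" where "Sw x F \<equiv> ext2 H (cop H x) F"
abbreviation RR :: "('h \<Rightarrow> 'h \<Rightarrow> 'k) \<Rightarrow> 'k" where "RR F \<equiv> ext2 H (Rmat H) F"

text \<open>Linearity spelled out pointwise, so that it can be proved by introduction rules that
  follow the shape of a term; \<open>lin_form_iff\<close> and \<open>linH_iff\<close>
  translate.\<close>

definition lf :: "('h \<Rightarrow> 'k) \<Rightarrow> bool" where
  "lf f \<longleftrightarrow> (\<forall>x y. f (x + y) = f x + f y) \<and> (\<forall>c x. f (sc c x) = c * f x)"

definition lh :: "('h \<Rightarrow> 'h) \<Rightarrow> bool" where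
  "lh g \<longleftrightarrow> (\<forall>x y. g (x + y) = g x + g y) \<and> (\<forall>c x. g (sc c x) = sc c (g x))"

definition bil :: "('h \<Rightarrow> 'h \<Rightarrow> 'k) \<Rightarrow> bool" where
  "bil F \<longleftrightarrow> (\<forall>y. lf (\<lambda>x. F x y)) \<and> (\<forall>x. lf (\<lambda>y. F x y))"

definition tril :: "('h \<Rightarrow> 'h \<Rightarrow> 'h \<Rightarrow> 'k) \<Rightarrow> bool" where
  "tril F \<longleftrightarrow> (\<forall>y z. lf (\<lambda>x. F x y z)) \<and> (\<forall>x z. lf (\<lambda>y. F x y z)) \<and> (\<forall>x y. lf (\<lambda>z. F x y z))"

lemma hopf: "hopf_algebra H" and rmat: "is_Rmatrix H" and twi: "is_twist H"
  using ribbon by (auto simp: ribbon_hopf_algebra_def)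

lemma fin_dim: "finite_dimensional_vector_space sc B"
  using hopf by (auto simp: hopf_algebra_def fd_algebra_def)

sublocale V: finite_dimensional_vector_space sc B
  by (rule fin_dim)

lemma sc_mult_left: "sc c x * y = sc c (x * y)" and sc_mult_right: "x * sc c y = sc c (x * y)"
  using hopf by (auto simp: hopf_algebra_def fd_algebra_def)

lemma lin_form_iff: "lin_form H f \<longleftrightarrow> lf f"
proof -
  have "vector_space ((*) :: 'k \<Rightarrow> 'k \<Rightarrow> 'k)"
    by unfold_locales (auto simp: algebra_simps)
  then show ?thesis
    unfolding Vector_Spaces.linear_def module_hom_def module_hom_axioms_def lf_def
    using V.vector_space_axioms by (auto simp: vector_space_def module_def)
qed

lemma linH_iff: "Vector_Spaces.linear sc sc g \<longleftrightarrow> lh g"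
  unfolding Vector_Spaces.linear_def module_hom_def module_hom_axioms_def lh_def
  using V.vector_space_axioms by (auto simp: vector_space_def module_def)

lemma lfD: "lf f \<Longrightarrow> f (x + y) = f x + f y" "lf f \<Longrightarrow> f (sc c x) = c * f x"
  by (auto simp: lf_def)

lemma lhD: "lh g \<Longrightarrow> g (x + y) = g x + g y" "lh g \<Longrightarrow> g (sc c x) = sc c (g x)"
  by (auto simp: lh_def)

lemma lf_zero: "lf f \<Longrightarrow> f 0 = 0"
  using lfD(1)[of f 0 0] by (metis add.right_neutral add_left_cancel)

lemma lf_sum: "lf f \<Longrightarrow> f (sum g A) = (\<Sum>i\<in>A. f (g i))"
  by (induction A rule: infinite_finite_induct) (auto simp: lf_zero lfD)

lemma lh_zero: "lh g \<Longrightarrow> g 0 = 0"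
  using lhD(1)[of g 0 0] by (metis add.right_neutral add_left_cancel)

lemma lh_diff: "lh g \<Longrightarrow> g (x - y) = g x - g y"
  using lhD(1)[of g "x - y" y] by simp

lemma lf_diff: "lf f \<Longrightarrow> f (x - y) = f x - f y"
  using lfD(1)[of f "x - y" y] by simp

lemma bilI: "(\<And>y. lf (\<lambda>x. F x y)) \<Longrightarrow> (\<And>x. lf (\<lambda>y. F x y)) \<Longrightarrow> bil F"
  by (auto simp: bil_def)

lemma trilI: "(\<And>y z. lf (\<lambda>x. F x y z)) \<Longrightarrow> (\<And>x z. lf (\<lambda>y. F x y z)) \<Longrightarrow> (\<And>x y. lf (\<lambda>z. F x y z)) \<Longrightarrow> tril F"
  by (auto simp: tril_def)

lemma lf_comp: "lf f \<Longrightarrow> lh g \<Longrightarrow> lf (\<lambda>x. f (g x))"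
  by (auto simp: lf_def lh_def)

lemma bil1: "bil F \<Longrightarrow> lh g \<Longrightarrow> lf (\<lambda>x. F (g x) y)" and bil2: "bil F \<Longrightarrow> lh g \<Longrightarrow> lf (\<lambda>y. F x (g y))"
  by (auto simp: bil_def lf_def lh_def)

lemma tril1: "tril F \<Longrightarrow> lh g \<Longrightarrow> lf (\<lambda>x. F (g x) y z)"
  and tril2: "tril F \<Longrightarrow> lh g \<Longrightarrow> lf (\<lambda>y. F x (g y) z)"
  and tril3: "tril F \<Longrightarrow> lh g \<Longrightarrow> lf (\<lambda>z. F x y (g z))"
  by (auto simp: tril_def lf_def lh_def)

lemma lf_multl: "lf f \<Longrightarrow> lf (\<lambda>x. f x * c)" and lf_multr: "lf f \<Longrightarrow> lf (\<lambda>x. c * f x)"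
  by (auto simp: lf_def algebra_simps)

lemma lf_ext2: "(\<And>a b. lf (\<lambda>x. F x a b)) \<Longrightarrow> lf (\<lambda>x. ext2 H t (F x))"
  by (auto simp: lf_def ext2_def sum.distrib sum_distrib_left algebra_simps case_prod_beta)

lemma lh_id: "lh (\<lambda>x. x)" by (auto simp: lh_def)
lemma lh_multl: "lh f \<Longrightarrow> lh (\<lambda>x. f x * c)" and lh_multr: "lh f \<Longrightarrow> lh (\<lambda>x. c * f x)"
  by (auto simp: lh_def algebra_simps sc_mult_left sc_mult_right)
lemma lh_S: "lh g \<Longrightarrow> lh (\<lambda>x. S (g x))"
proof -
  have "lh S" using hopf unfolding hopf_algebra_def linH_iff by auto
  then show "lh g \<Longrightarrow> lh (\<lambda>x. S (g x))" by (auto simp: lh_def)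
qed
lemma lf_cop: "lf (\<lambda>x. cop H x p)"
  using hopf unfolding hopf_algebra_def lin_form_iff by blast
lemma lf_Sw: "lh g \<Longrightarrow> lf (\<lambda>x. Sw (g x) F)"
proof -
  have "lf (\<lambda>x. Sw x F)"
    by (auto simp: lf_def ext2_def sum.distrib sum_distrib_left algebra_simps case_prod_beta
        lfD[OF lf_cop])
  then show "lh g \<Longrightarrow> lf (\<lambda>x. Sw (g x) F)" by (rule lf_comp)
qed
lemma lf_cu: "lh g \<Longrightarrow> lf (\<lambda>x. cu (g x))"
proof -
  have "lf cu" using hopf unfolding hopf_algebra_def alg_character_def lin_form_iff by auto
  then show "lh g \<Longrightarrow> lf (\<lambda>x. cu (g x))" by (rule lf_comp)
qed
lemma lf_crd: "lh g \<Longrightarrow> lf (\<lambda>x. crd H (g x) b)"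
proof -
  have "lf (\<lambda>x. crd H x b)"
    using V.linear_representation[OF V.independent_Basis V.span_Basis, of b]
    unfolding crd_def[abs_def] lin_form_iff .
  then show "lh g \<Longrightarrow> lf (\<lambda>x. crd H (g x) b)" by (rule lf_comp)
qed

text \<open>Syntax-directed set: most rules allow a linear map inside, so \<open>intro\<close>
  proves linearity of terms built from products, \<open>S\<close>, \<open>cu\<close>, coordinates
  and Sweedler sums. Local collections \<open>l\<close> add the forms at hand.\<close>

lemmas lin = bilI trilI lf_multl lf_multr lh_id lh_multl lh_multr lh_S lf_Sw lf_ext2 lf_cu lf_crd

section \<open>Coordinates and multilinear extension\<close>

lemma finite_B: "finite B" by (rule V.finite_Basis)

lemma crd_expand: "(\<Sum>b\<in>B. sc (crd H x b) b) = x"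
  unfolding crd_def
  by (rule V.sum_representation_eq[OF V.independent_Basis _ V.finite_Basis]) (auto simp: V.span_Basis)

lemma crd_out: "b \<notin> B \<Longrightarrow> crd H x b = 0"
  unfolding crd_def using V.representation_ne_zero by blast

lemma crd_basis: "b \<in> B \<Longrightarrow> crd H b = (\<lambda>c. if c = b then 1 else 0)"
  unfolding crd_def by (rule V.representation_basis[OF V.independent_Basis])

lemma lf_expand: "lf f \<Longrightarrow> (\<Sum>b\<in>B. crd H x b * f b) = f x"
  by (subst (2) crd_expand[of x, symmetric]) (simp add: lf_sum lfD)

lemma lf_expand': "lf f \<Longrightarrow> (\<Sum>b\<in>B. f b * crd H x b) = f x"
  using lf_expand[of f x] by (simp add: mult.commute)

text \<open>Coordinates are linear forms, so linear forms separate points. This reduces identities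
  in H to scalar ones.\<close>

lemma heqI: "(\<And>f. lf f \<Longrightarrow> f x = f y) \<Longrightarrow> x = y"
  by (metis (no_types, lifting) crd_expand lf_crd[OF lh_id] sum.cong)

lemma crd_comb: assumes "b \<in> B" shows "crd H (\<Sum>c\<in>B. sc (g c) c) b = g b"
proof -
  have "crd H (\<Sum>c\<in>B. sc (g c) c) b = (\<Sum>c\<in>B. g c * (if b = c then 1 else 0))"
    by (simp add: lf_sum[OF lf_crd[OF lh_id]] lfD[OF lf_crd[OF lh_id]] crd_basis)
  then show ?thesis using assms by (simp add: finite_B if_distrib cong: if_cong)
qed

lemma ext2_pure2: "bil F \<Longrightarrow> ext2 H (pure2 H x y) F = F x y"
proof -
  assume F: "bil F"
  have "ext2 H (pure2 H x y) F = (\<Sum>b\<in>B. crd H x b * (\<Sum>c\<in>B. crd H y c * F b c))"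
    by (simp add: ext2_def pure2_def sum.cartesian_product[symmetric] sum_distrib_left mult.assoc)
  also have "\<dots> = (\<Sum>b\<in>B. crd H x b * F b y)"
    using F by (simp add: lf_expand bil_def)
  also have "\<dots> = F x y"
    using F by (simp add: lf_expand bil_def)
  finally show ?thesis .
qed

lemma ext3_pure3: "tril F \<Longrightarrow> ext3 H (pure3 H x y z) F = F x y z"
proof -
  assume F: "tril F"
  have "ext3 H (pure3 H x y z) F =
      (\<Sum>a\<in>B. crd H x a * (\<Sum>b\<in>B. crd H y b * (\<Sum>c\<in>B. crd H z c * F a b c)))"
    by (simp add: ext3_def pure3_def sum.cartesian_product[symmetric] sum_distrib_left mult.assoc)
  also have "\<dots> = F x y z"
    using F by (simp add: lf_expand tril_def)
  finally show ?thesis .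
qed

lemma ext2H_lf: "lf f \<Longrightarrow> f (ext2H H t G) = ext2 H t (\<lambda>a b. f (G a b))"
  by (simp add: ext2H_def ext2_def lf_sum case_prod_beta lfD)

lemma ext2_swap:
  "ext2 H s (\<lambda>a b. ext2 H t (\<lambda>c d. G a b c d)) = ext2 H t (\<lambda>c d. ext2 H s (\<lambda>a b. G a b c d))"
  unfolding ext2_def case_prod_beta sum_distrib_left
  by (subst sum.swap) (simp add: algebra_simps)

lemma ext2_ext2: "ext2 H (\<lambda>p. ext2 H s (\<lambda>a b. G a b p)) F = ext2 H s (\<lambda>a b. ext2 H (G a b) F)"
  unfolding ext2_def case_prod_beta sum_distrib_left sum_distrib_right
  by (subst sum.swap) (simp add: algebra_simps)

lemma ext2_multr: "ext2 H t (\<lambda>a b. F a b * c) = ext2 H t F * c"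
  and ext2_multl: "ext2 H t (\<lambda>a b. c * F a b) = c * ext2 H t F"
  by (auto simp: ext2_def sum_distrib_left sum_distrib_right case_prod_beta algebra_simps)

lemma ext3_ext2: "ext3 H (\<lambda>p. ext2 H s (\<lambda>a b. G a b p)) F = ext2 H s (\<lambda>a b. ext3 H (G a b) F)"
  unfolding ext2_def ext3_def case_prod_beta sum_distrib_left sum_distrib_right
  by (subst sum.swap) (simp add: algebra_simps)

lemma ext3_ext3: "ext3 H (\<lambda>p. ext3 H s (\<lambda>a b c. G a b c p)) F = ext3 H s (\<lambda>a b c. ext3 H (G a b c) F)"
  unfolding ext3_def case_prod_beta sum_distrib_left sum_distrib_right
  by (subst sum.swap) (simp add: algebra_simps)

lemma ext2_mult2: "bil F \<Longrightarrow>
    ext2 H (mult2 H s t) F = ext2 H s (\<lambda>a b. ext2 H t (\<lambda>c d. F (a * c) (b * d)))"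
  unfolding mult2_def by (simp add: ext2_ext2 ext2_pure2)

lemma ext3_mult3: "tril F \<Longrightarrow>
    ext3 H (mult3 H s t) F = ext3 H s (\<lambda>a b c. ext3 H t (\<lambda>d e f. F (a * d) (b * e) (c * f)))"
  unfolding mult3_def by (simp add: ext3_ext3 ext3_pure3)

lemma ext2_flip2: "ext2 H (flip2 t) F = ext2 H t (\<lambda>a b. F b a)"
  unfolding ext2_def flip2_def
  by (subst sum.cartesian_product[symmetric], subst sum.swap) (simp add: sum.cartesian_product)

lemma ext3_eq: "ext3 H t F = (\<Sum>a\<in>B. \<Sum>b\<in>B. \<Sum>c\<in>B. t (a, b, c) * F a b c)"
  by (simp add: ext3_def sum.cartesian_product)

lemma ext2_eq: "ext2 H t F = (\<Sum>a\<in>B. \<Sum>b\<in>B. t (a, b) * F a b)"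
  by (simp add: ext2_def sum.cartesian_product)

lemma ext3_cop_id: "tril F \<Longrightarrow> ext3 H (cop_id H t) F = ext2 H t (\<lambda>x y. Sw x (\<lambda>a b. F a b y))"
proof -
  assume F: "tril F"
  have "ext3 H (cop_id H t) F = ext2 H t (\<lambda>x y. ext3 H (\<lambda>(a,b,c). cop H x (a, b) * crd H y c) F)"
    unfolding cop_id_def case_prod_beta by (rule ext3_ext2)
  also have "\<dots> = ext2 H t (\<lambda>x y. Sw x (\<lambda>a b. F a b y))"
    using F by (simp add: ext3_eq ext2_eq[of "cop H _"] mult.assoc sum_distrib_left[symmetric] lf_expand tril_def)
  finally show ?thesis .
qed

lemma ext3_id_cop: "tril F \<Longrightarrow> ext3 H (id_cop H t) F = ext2 H t (\<lambda>x y. Sw y (\<lambda>b c. F x b c))"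
proof -
  assume F: "tril F"
  have "ext3 H (id_cop H t) F = ext2 H t (\<lambda>x y. ext3 H (\<lambda>(a,b,c). crd H x a * cop H y (b, c)) F)"
    unfolding id_cop_def case_prod_beta by (rule ext3_ext2)
  also have "\<dots> = ext2 H t (\<lambda>x y. \<Sum>a\<in>B. crd H x a * Sw y (\<lambda>b c. F a b c))"
    by (simp add: ext3_eq ext2_eq[of "cop H _"] mult.assoc sum_distrib_left)
  also have "\<dots> = ext2 H t (\<lambda>x y. Sw y (\<lambda>b c. F x b c))"
  proof -
    have "lf (\<lambda>x. Sw y (F x))" for y
      using F by (intro lf_ext2) (auto simp: tril_def)
    then show ?thesis by (simp add: lf_expand)
  qed
  finally show ?thesis .
qed

lemma ext3_R12: "tril F \<Longrightarrow> ext3 H (R12 H) F = RR (\<lambda>a b. F a b 1)"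
  and ext3_R13: "tril F \<Longrightarrow> ext3 H (R13 H) F = RR (\<lambda>a b. F a 1 b)"
  and ext3_R23: "tril F \<Longrightarrow> ext3 H (R23 H) F = RR (\<lambda>a b. F 1 a b)"
  unfolding R12_def R13_def R23_def by (simp_all add: ext3_ext2 ext3_pure3)

lemma tril_shift: assumes F: "tril F" shows "tril (\<lambda>d e f. F (a * d) (b * e) (c * f))"
  by (intro lin F tril1[OF F] tril2[OF F] tril3[OF F])

section \<open>The axioms of H, R and theta in Sweedler form\<close>

lemma coassoc: "tril F \<Longrightarrow>
  Sw x (\<lambda>y c. Sw y (\<lambda>a b. F a b c)) = Sw x (\<lambda>a y. Sw y (\<lambda>b c. F a b c))"
  using hopf ext3_cop_id[of F "cop H x"] ext3_id_cop[of F "cop H x"]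
  by (auto simp: hopf_algebra_def)

lemma Sw_one: "bil F \<Longrightarrow> Sw 1 F = F 1 1"
  using hopf by (auto simp: hopf_algebra_def ext2_pure2)

lemma Sw_mult: "bil F \<Longrightarrow> Sw (x * y) F = Sw x (\<lambda>a b. Sw y (\<lambda>c d. F (a * c) (b * d)))"
  using hopf by (auto simp: hopf_algebra_def ext2_mult2)

lemma cu_one: "cu 1 = 1" and cu_mult: "cu (x * y) = cu x * cu y"
  using hopf by (auto simp: hopf_algebra_def alg_character_def)

lemma counit_l: "lf f \<Longrightarrow> Sw x (\<lambda>a b. cu a * f b) = f x"
  using hopf ext2H_lf[of f "cop H x" "\<lambda>a b. sc (cu a) b"]
  by (auto simp: hopf_algebra_def lfD)

lemma counit_r: "lf f \<Longrightarrow> Sw x (\<lambda>a b. f a * cu b) = f x"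
  using hopf ext2H_lf[of f "cop H x" "\<lambda>a b. sc (cu b) a"]
  by (auto simp: hopf_algebra_def lfD mult.commute)

lemma counit_r': "lf f \<Longrightarrow> Sw x (\<lambda>a b. cu b * f a) = f x"
  using counit_r by (simp add: mult.commute)

lemma antip_l: "lf f \<Longrightarrow> Sw x (\<lambda>a b. f (S a * b)) = cu x * f 1"
  using hopf ext2H_lf[of f "cop H x" "\<lambda>a b. S a * b"]
  by (auto simp: hopf_algebra_def lfD)

lemma antip_r: "lf f \<Longrightarrow> Sw x (\<lambda>a b. f (a * S b)) = cu x * f 1"
  using hopf ext2H_lf[of f "cop H x" "\<lambda>a b. a * S b"]
  by (auto simp: hopf_algebra_def lfD)

lemma R_comm: "bil F \<Longrightarrow>
  RR (\<lambda>a b. Sw x (\<lambda>c d. F (a * c) (b * d))) = RR (\<lambda>a b. Sw x (\<lambda>c d. F (d * a) (c * b)))"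
proof -
  assume F: "bil F"
  have "ext2 H (mult2 H (Rmat H) (cop H x)) F = ext2 H (mult2 H (flip2 (cop H x)) (Rmat H)) F"
    using rmat by (simp add: is_Rmatrix_def)
  then show ?thesis
    using F by (simp add: ext2_mult2 ext2_flip2 ext2_swap[of "cop H x"])
qed

lemma R_id_cop: "tril F \<Longrightarrow>
  RR (\<lambda>a b. Sw b (\<lambda>c d. F a c d)) = RR (\<lambda>a b. RR (\<lambda>a' b'. F (a * a') b' b))"
proof -
  assume F: "tril F"
  have "ext3 H (id_cop H (Rmat H)) F = ext3 H (mult3 H (R13 H) (R12 H)) F"
    using rmat by (simp add: is_Rmatrix_def)
  moreover have "tril (\<lambda>a b c. RR (\<lambda>a' b'. F (a * a') (b * b') (c * 1)))"
    by (intro lin F tril1[OF F] tril2[OF F] tril3[OF F])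
  ultimately show ?thesis
    using F by (simp add: ext3_id_cop ext3_mult3 ext3_R12 ext3_R13 tril_shift)
qed

lemma R_cop_id: "tril F \<Longrightarrow>
  RR (\<lambda>a b. Sw a (\<lambda>c d. F c d b)) = RR (\<lambda>a b. RR (\<lambda>a' b'. F a a' (b * b')))"
proof -
  assume F: "tril F"
  have "ext3 H (cop_id H (Rmat H)) F = ext3 H (mult3 H (R13 H) (R23 H)) F"
    using rmat by (simp add: is_Rmatrix_def)
  moreover have "tril (\<lambda>a b c. RR (\<lambda>a' b'. F (a * 1) (b * a') (c * b')))"
    by (intro lin F tril1[OF F] tril2[OF F] tril3[OF F])
  ultimately show ?thesis
    using F by (simp add: ext3_cop_id ext3_mult3 ext3_R13 ext3_R23 tril_shift)
qed

lemma R_inv: "\<exists>Q. (\<forall>F. bil F \<longrightarrow> RR (\<lambda>a b. ext2 H Q (\<lambda>c d. F (a * c) (b * d))) = F 1 1) \<and>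
    (\<forall>F. bil F \<longrightarrow> ext2 H Q (\<lambda>a b. RR (\<lambda>c d. F (a * c) (b * d))) = F 1 1)"
proof -
  obtain Q where "mult2 H (Rmat H) Q = pure2 H 1 1" "mult2 H Q (Rmat H) = pure2 H 1 1"
    using rmat by (auto simp: is_Rmatrix_def)
  then show ?thesis
    by (intro exI[of _ Q] conjI allI impI) (simp_all add: ext2_mult2[symmetric] ext2_pure2)
qed

lemma Sw_tw: "bil F \<Longrightarrow> Sw tw F = RR (\<lambda>a b. RR (\<lambda>a' b'. F (tw * (b * a')) (tw * (a * b'))))"
proof -
  assume F: "bil F"
  have "bil (\<lambda>a b. RR (\<lambda>a' b'. F (tw * (b * a')) (tw * (a * b'))))"
    by (intro lin F bil1[OF F] bil2[OF F])
  moreover have "bil (\<lambda>a b. ext2 H (mult2 H (flip2 (Rmat H)) (Rmat H)) (\<lambda>c d. F (a * c) (b * d)))"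
    "bil (\<lambda>c d. F (tw * c) (tw * d))"
    by (intro lin F bil1[OF F] bil2[OF F])+
  ultimately show ?thesis
    using twi F by (simp add: is_twist_def ext2_mult2 ext2_pure2 ext2_flip2)
qed

subsection \<open>The antipode, the R-matrix and the Drinfeld element\<close>

text \<open>In the \<open>cancel\<close> names, the letter after S tells on which side of the
  cancelling product S stands, and the digit which leg becomes 1.\<close>

lemma cancel_Sl1: assumes F: "bil F"
  shows "Sw x (\<lambda>a y. Sw y (\<lambda>b c. F (S a * b) c)) = F 1 x"
proof -
  have "Sw x (\<lambda>a y. Sw y (\<lambda>b c. F (S a * b) c)) = Sw x (\<lambda>y c. Sw y (\<lambda>a b. F (S a * b) c))"
    by (rule coassoc[symmetric]) (intro lin bil1[OF F] bil2[OF F])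
  also have "\<dots> = Sw x (\<lambda>y c. cu y * F 1 c)"
    by (subst antip_l[where f="\<lambda>w. F w _"]) (intro lin bil1[OF F] refl)+
  also have "\<dots> = F 1 x"
    by (rule counit_l) (intro lin bil2[OF F])
  finally show ?thesis .
qed

lemma cancel_Sr1: assumes F: "bil F"
  shows "Sw x (\<lambda>a y. Sw y (\<lambda>b c. F (a * S b) c)) = F 1 x"
proof -
  have "Sw x (\<lambda>a y. Sw y (\<lambda>b c. F (a * S b) c)) = Sw x (\<lambda>y c. Sw y (\<lambda>a b. F (a * S b) c))"
    by (rule coassoc[symmetric]) (intro lin bil1[OF F] bil2[OF F])
  also have "\<dots> = Sw x (\<lambda>y c. cu y * F 1 c)"
    by (subst antip_r[where f="\<lambda>w. F w _"]) (intro lin bil1[OF F] refl)+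
  also have "\<dots> = F 1 x"
    by (rule counit_l) (intro lin bil2[OF F])
  finally show ?thesis .
qed

lemma cancel_Sr2: assumes F: "bil F"
  shows "Sw x (\<lambda>a y. Sw y (\<lambda>b c. F a (b * S c))) = F x 1"
proof -
  have "Sw x (\<lambda>a y. Sw y (\<lambda>b c. F a (b * S c))) = Sw x (\<lambda>a y. cu y * F a 1)"
    by (subst antip_r[where f="\<lambda>w. F _ w"]) (intro lin bil2[OF F] refl)+
  also have "\<dots> = F x 1"
    by (rule counit_r') (intro lin bil1[OF F])
  finally show ?thesis .
qed

lemma S_one: "S 1 = 1"
proof (rule heqI)
  fix f assume f: "lf f"
  have "Sw 1 (\<lambda>a b. f (S a * b)) = f (S 1 * 1)"
    by (rule Sw_one) (intro lin lf_comp[OF f])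
  then show "f (S 1) = f 1" using antip_l[OF f, of 1] by (simp add: cu_one)
qed

text \<open>Uniqueness of convolution inverses, made concrete: S(x1 y1) x2 y2 S(y3) S(x3) is
  collapsed once from the right and once from the left.\<close>

lemma S_mult: "S (x * y) = S y * S x"
proof (rule heqI)
  fix f assume f: "lf f"
  note l = lin lf_comp[OF f]
  let ?G = "\<lambda>x1 x2 x3 y1 y2 y3. f (S (x1 * y1) * (x2 * (y2 * S y3) * S x3))"
  have "Sw x (\<lambda>x1 x'. Sw x' (\<lambda>x2 x3. Sw y (\<lambda>y1 y'. Sw y' (\<lambda>y2 y3. ?G x1 x2 x3 y1 y2 y3)))) =
     Sw x (\<lambda>x1 x'. Sw x' (\<lambda>x2 x3. f (S (x1 * y) * (x2 * 1 * S x3))))"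
    by (subst cancel_Sr2[where F="\<lambda>y1 w. f (S (_ * y1) * (_ * w * S _))"]) (intro l refl)+
  also have "\<dots> = f (S (x * y) * 1)"
    by (simp, subst cancel_Sr2[where F="\<lambda>x1 w. f (S (x1 * _) * w)"]) (intro l | simp)+
  finally have 1: "Sw x (\<lambda>x1 x'. Sw x' (\<lambda>x2 x3. Sw y (\<lambda>y1 y'. Sw y' (\<lambda>y2 y3. ?G x1 x2 x3 y1 y2 y3)))) =
     f (S (x * y))" by simp
  have "Sw x (\<lambda>x1 x'. Sw x' (\<lambda>x2 x3. Sw y (\<lambda>y1 y'. Sw y' (\<lambda>y2 y3. ?G x1 x2 x3 y1 y2 y3)))) =
     Sw x (\<lambda>x' x3. Sw x' (\<lambda>x1 x2. Sw y (\<lambda>y1 y'. Sw y' (\<lambda>y2 y3. ?G x1 x2 x3 y1 y2 y3))))"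
    by (rule coassoc[symmetric]) (intro l)
  also have "\<dots> = Sw x (\<lambda>x' x3. Sw x' (\<lambda>x1 x2. Sw y (\<lambda>y' y3. Sw y' (\<lambda>y1 y2. ?G x1 x2 x3 y1 y2 y3))))"
    by (subst coassoc[symmetric]) (intro l refl)+
  also have "\<dots> = Sw x (\<lambda>x' x3. Sw y (\<lambda>y' y3. Sw x' (\<lambda>x1 x2. Sw y' (\<lambda>y1 y2. ?G x1 x2 x3 y1 y2 y3))))"
    by (subst ext2_swap) (rule refl)
  also have "\<dots> = Sw x (\<lambda>x' x3. Sw y (\<lambda>y' y3. Sw (x' * y') (\<lambda>p q. f (S p * q * (S y3 * S x3)))))"
    by (subst Sw_mult, (intro l)) (simp add: mult.assoc)
  also have "\<dots> = Sw x (\<lambda>x' x3. Sw y (\<lambda>y' y3. cu (x' * y') * f (1 * (S y3 * S x3))))"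
    by (subst antip_l[where f="\<lambda>w. f (w * _)"]) (intro l refl)+
  also have "\<dots> = Sw x (\<lambda>x' x3. Sw y (\<lambda>y' y3. cu y' * (cu x' * f (S y3 * S x3))))"
    by (simp add: cu_mult algebra_simps)
  also have "\<dots> = Sw x (\<lambda>x' x3. cu x' * f (S y * S x3))"
    by (subst counit_l) (intro l refl)+
  also have "\<dots> = f (S y * S x)"
    by (subst counit_l) (intro l refl)+
  finally show "f (S (x * y)) = f (S y * S x)" using 1 by simp
qed

lemma cu_S: "cu (S x) = cu x"
proof -
  have "Sw x (\<lambda>a b. cu (S a * b)) = cu x * cu 1"
    by (rule antip_l) (intro lin)
  moreover have "Sw x (\<lambda>a b. cu (S a) * cu b) = cu (S x)"
    by (rule counit_r) (intro lin)
  ultimately show ?thesis by (simp add: cu_mult cu_one)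
qed

lemma Sw_S_aux: assumes F: "bil F"
  shows "Sw x (\<lambda>y z. Sw z (\<lambda>c d. Sw y (\<lambda>a b. F (a * S d) (b * S c)))) = cu x * F 1 1"
proof -
  note l = lin bil1[OF F] bil2[OF F]
  have "Sw x (\<lambda>y z. Sw z (\<lambda>c d. Sw y (\<lambda>a b. F (a * S d) (b * S c)))) =
     Sw x (\<lambda>y z. Sw y (\<lambda>a b. Sw z (\<lambda>c d. F (a * S d) (b * S c))))"
    by (subst ext2_swap) (rule refl)
  also have "\<dots> = Sw x (\<lambda>a y. Sw y (\<lambda>b z. Sw z (\<lambda>c d. F (a * S d) (b * S c))))"
    by (rule coassoc) (intro l)
  also have "\<dots> = Sw x (\<lambda>a y. F (a * S y) 1)"
    by (subst cancel_Sr1[where F="\<lambda>w d. F (_ * S d) w"]) (intro l refl)+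
  also have "\<dots> = cu x * F 1 1"
    by (rule antip_r) (intro l)
  finally show ?thesis .
qed

text \<open>The same two-sided collapse, now of Delta(S(x1)) Delta(x2) (S(x4) \<otimes> S(x3)); the
  right-hand collapse is \<open>Sw_S_aux\<close>.\<close>

lemma Sw_S: assumes F: "bil F"
  shows "Sw (S x) F = Sw x (\<lambda>a b. F (S b) (S a))"
proof -
  note l = lin bil1[OF F] bil2[OF F]
  let ?K = "\<lambda>x1 x2 x3 x4. Sw (S x1) (\<lambda>p q. Sw x2 (\<lambda>r s. F (p * (r * S x4)) (q * (s * S x3))))"
  have "Sw x (\<lambda>x1 x'. Sw x' (\<lambda>x2 x''. Sw x'' (\<lambda>x3 x4. ?K x1 x2 x3 x4))) =
      Sw x (\<lambda>x1 x'. Sw (S x1) (\<lambda>p q. Sw x' (\<lambda>x2 x''. Sw x'' (\<lambda>x3 x4.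
        Sw x2 (\<lambda>r s. F (p * (r * S x4)) (q * (s * S x3)))))))"
    by (simp only: ext2_swap[of "cop H (S _)"])
  also have "\<dots> = Sw x (\<lambda>x1 x'. Sw (S x1) (\<lambda>p q. cu x' * F (p * 1) (q * 1)))"
    by (subst Sw_S_aux[where F="\<lambda>v w. F (_ * v) (_ * w)"]) (intro l refl)+
  also have "\<dots> = Sw x (\<lambda>x1 x'. cu x' * Sw (S x1) F)"
    by (simp add: ext2_multl)
  also have "\<dots> = Sw (S x) F"
    by (rule counit_r') (intro l)
  finally have 1: "Sw x (\<lambda>x1 x'. Sw x' (\<lambda>x2 x''. Sw x'' (\<lambda>x3 x4. ?K x1 x2 x3 x4))) = Sw (S x) F" .
  have "Sw x (\<lambda>x1 x'. Sw x' (\<lambda>x2 x''. Sw x'' (\<lambda>x3 x4. ?K x1 x2 x3 x4))) =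
    Sw x (\<lambda>y x''. Sw y (\<lambda>x1 x2. Sw x'' (\<lambda>x3 x4. ?K x1 x2 x3 x4)))"
    by (rule coassoc[symmetric]) (intro l)
  also have "\<dots> = Sw x (\<lambda>y x''. Sw x'' (\<lambda>x3 x4. Sw y (\<lambda>x1 x2. ?K x1 x2 x3 x4)))"
    by (subst ext2_swap) (rule refl)
  also have "\<dots> = Sw x (\<lambda>y x''. Sw x'' (\<lambda>x3 x4. Sw y (\<lambda>x1 x2. Sw (S x1 * x2) (\<lambda>v w. F (v * S x4) (w * S x3)))))"
    by (subst Sw_mult, (intro l)) (simp add: mult.assoc)
  also have "\<dots> = Sw x (\<lambda>y x''. Sw x'' (\<lambda>x3 x4. cu y * Sw 1 (\<lambda>v w. F (v * S x4) (w * S x3))))"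
    by (subst antip_l[where f="\<lambda>z. Sw z _"]) (intro l refl)+
  also have "\<dots> = Sw x (\<lambda>y x''. Sw x'' (\<lambda>x3 x4. cu y * F (1 * S x4) (1 * S x3)))"
    by (subst Sw_one) (intro l refl)+
  also have "\<dots> = Sw x (\<lambda>y x''. cu y * Sw x'' (\<lambda>x3 x4. F (S x4) (S x3)))"
    by (simp add: ext2_multl)
  also have "\<dots> = Sw x (\<lambda>x3 x4. F (S x4) (S x3))"
    by (rule counit_l) (intro l)
  finally show ?thesis using 1 by simp
qed

text \<open>The counit on the first leg of (Delta \<otimes> id)(R) = R13 R23 gives R = (1 \<otimes>
  e) R with e = (eps \<otimes> id)(R), and R cancels. Its inverse \<open>Q\<close> is built into
  \<open>?F\<close> from the start.\<close>

lemma R_cu_l: assumes f: "lf f" shows "RR (\<lambda>a b. cu a * f b) = f 1"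
proof -
  obtain Q where Q: "\<And>F. bil F \<Longrightarrow> RR (\<lambda>a b. ext2 H Q (\<lambda>c d. F (a * c) (b * d))) = F 1 1"
    using R_inv by blast
  note l = lin lf_comp[OF f]
  let ?F = "\<lambda>x y. ext2 H Q (\<lambda>c d. cu (x * c) * f (y * d))"
  have "f 1 = RR (\<lambda>a b. ?F a b)"
    by (subst Q[where F="\<lambda>x y. cu x * f y"]) (intro l | simp add: cu_one)+
  also have "\<dots> = RR (\<lambda>a b. Sw a (\<lambda>c d. cu c * ?F d b))"
    by (subst counit_l) (intro l refl)+
  also have "\<dots> = RR (\<lambda>a b. RR (\<lambda>a' b'. cu a * ?F a' (b * b')))"
    by (rule R_cop_id) (intro l)
  also have "\<dots> = RR (\<lambda>a b. cu a * RR (\<lambda>a' b'. ext2 H Q (\<lambda>c d. cu (a' * c) * f (b * (b' * d)))))"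
    by (simp add: ext2_multl mult.assoc)
  also have "\<dots> = RR (\<lambda>a b. cu a * (cu 1 * f (b * 1)))"
    by (subst Q[where F="\<lambda>x y. cu x * f (_ * y)"]) (intro l refl)+
  finally show ?thesis by (simp add: cu_one)
qed

lemma R_cu_r: assumes f: "lf f" shows "RR (\<lambda>a b. f a * cu b) = f 1"
proof -
  obtain Q where Q: "\<And>F. bil F \<Longrightarrow> RR (\<lambda>a b. ext2 H Q (\<lambda>c d. F (a * c) (b * d))) = F 1 1"
    using R_inv by blast
  note l = lin lf_comp[OF f]
  let ?F = "\<lambda>x y. ext2 H Q (\<lambda>c d. cu (y * d) * f (x * c))"
  have "f 1 = RR (\<lambda>a b. ?F a b)"
    by (subst Q[where F="\<lambda>x y. cu y * f x"]) (intro l | simp add: cu_one)+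
  also have "\<dots> = RR (\<lambda>a b. Sw b (\<lambda>c d. ?F a c * cu d))"
    by (subst counit_r) (intro l refl)+
  also have "\<dots> = RR (\<lambda>a b. RR (\<lambda>a' b'. ?F (a * a') b' * cu b))"
    by (rule R_id_cop) (intro l)
  also have "\<dots> = RR (\<lambda>a b. RR (\<lambda>a' b'. ext2 H Q (\<lambda>c d. cu (b' * d) * f (a * (a' * c)))) * cu b)"
    by (simp add: ext2_multr mult.assoc)
  also have "\<dots> = RR (\<lambda>a b. (cu 1 * f (a * 1)) * cu b)"
    by (subst Q[where F="\<lambda>x y. cu y * f (_ * x)"]) (intro l refl)+
  finally show ?thesis by (simp add: cu_one)
qed

lemma SR_R: assumes F: "bil F"
  shows "RR (\<lambda>a b. RR (\<lambda>a' b'. F (S a * a') (b * b'))) = F 1 1"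
proof -
  note l = lin bil1[OF F] bil2[OF F]
  have "RR (\<lambda>a b. RR (\<lambda>a' b'. F (S a * a') (b * b'))) = RR (\<lambda>a b. Sw a (\<lambda>c d. F (S c * d) b))"
    by (rule R_cop_id[symmetric]) (intro l)
  also have "\<dots> = RR (\<lambda>a b. cu a * F 1 b)"
    by (subst antip_l[where f="\<lambda>w. F w _"]) (intro l refl)+
  also have "\<dots> = F 1 1" by (rule R_cu_l) (intro l)
  finally show ?thesis .
qed

lemma R_idS: assumes F: "bil F"
  shows "RR (\<lambda>a b. RR (\<lambda>a' b'. F (a * a') (S b' * b))) = F 1 1"
proof -
  note l = lin bil1[OF F] bil2[OF F]
  have "RR (\<lambda>a b. RR (\<lambda>a' b'. F (a * a') (S b' * b))) = RR (\<lambda>a b. Sw b (\<lambda>c d. F a (S c * d)))"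
    by (rule R_id_cop[symmetric]) (intro l)
  also have "\<dots> = RR (\<lambda>a b. cu b * F a 1)"
    by (subst antip_l[where f="\<lambda>w. F _ w"]) (intro l refl)+
  also have "\<dots> = RR (\<lambda>a b. F a 1 * cu b)" by (simp add: mult.commute)
  also have "\<dots> = F 1 1" by (rule R_cu_r) (intro l)
  finally show ?thesis .
qed

text \<open>To the right of (S \<otimes> S)(R) the unit is inserted as (S \<otimes> id)(R) R, by
  \<open>SR_R\<close>. The first two of the three factors then cancel by \<open>R_idS\<close> under
  S on the first leg.\<close>

lemma SS_R: assumes F: "bil F"
  shows "RR (\<lambda>a b. F (S a) (S b)) = RR F"
proof -
  note l = lin bil1[OF F] bil2[OF F]
  have "RR (\<lambda>a b. F (S a) (S b)) = RR (\<lambda>a' b'. F (S a' * 1) (S b' * 1))" by simp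
  also have "\<dots> = RR (\<lambda>a' b'. RR (\<lambda>a b. RR (\<lambda>a'' b''. F (S a' * (S a * a'')) (S b' * (b * b'')))))"
    by (subst SR_R[where F="\<lambda>x y. F (S _ * x) (S _ * y)"]) (intro l refl)+
  also have "\<dots> = RR (\<lambda>a' b'. RR (\<lambda>a'' b''. RR (\<lambda>a b. F (S (a * a') * a'') (S b' * b * b''))))"
    by (subst (2) ext2_swap) (simp add: S_mult mult.assoc)
  also have "\<dots> = RR (\<lambda>a'' b''. RR (\<lambda>a' b'. RR (\<lambda>a b. F (S (a * a') * a'') (S b' * b * b''))))"
    by (rule ext2_swap)
  also have "\<dots> = RR (\<lambda>a'' b''. RR (\<lambda>a b. RR (\<lambda>a' b'. F (S (a * a') * a'') (S b' * b * b''))))"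
    by (subst (2) ext2_swap) (rule refl)
  also have "\<dots> = RR (\<lambda>a'' b''. F (S 1 * a'') (1 * b''))"
    by (subst R_idS[where F="\<lambda>x y. F (S x * _) (y * _)"]) (intro l refl)+
  finally show ?thesis by (simp add: S_one)
qed

section \<open>The Drinfeld element u and the pivotal element G\<close>

definition u :: 'h where "u = ext2H H (Rmat H) (\<lambda>a b. S b * a)"

lemma lf_u: "lf f \<Longrightarrow> f u = RR (\<lambda>a b. f (S b * a))"
  unfolding u_def by (rule ext2H_lf)

text \<open>Both sides come from S^2(x3) S(b x2) a x1. Cancelling x2 against x3 leaves u x; the
  exchange rule for R turns it into S^2(x3) S(b) S(x1) x2 a, which leaves S^2(x) u.\<close>

lemma u_conj: "u * x = S (S x) * u"
proof (rule heqI)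
  fix f assume f: "lf f"
  note l = lin lf_comp[OF f]
  have "RR (\<lambda>a b. Sw x (\<lambda>x' x3. Sw x' (\<lambda>x1 x2. f (S (S x3) * (S (b * x2) * (a * x1)))))) =
     RR (\<lambda>a b. Sw x (\<lambda>x1 x'. Sw x' (\<lambda>x2 x3. f (S (x2 * S x3) * (S b * (a * x1))))))"
    by (subst coassoc) (intro l | simp add: S_mult mult.assoc)+
  also have "\<dots> = RR (\<lambda>a b. f (S 1 * (S b * (a * x))))"
    by (subst cancel_Sr2[where F="\<lambda>y w. f (S w * (S _ * (_ * y)))"]) (intro l refl)+
  also have "\<dots> = f (u * x)"
    by (subst lf_u[where f="\<lambda>w. f (w * x)"]) (intro l | simp add: S_one mult.assoc)+
  finally have 1: "RR (\<lambda>a b. Sw x (\<lambda>x' x3. Sw x' (\<lambda>x1 x2. f (S (S x3) * (S (b * x2) * (a * x1)))))) = f (u * x)" .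
  have "RR (\<lambda>a b. Sw x (\<lambda>x' x3. Sw x' (\<lambda>x1 x2. f (S (S x3) * (S (b * x2) * (a * x1)))))) =
    Sw x (\<lambda>x' x3. RR (\<lambda>a b. Sw x' (\<lambda>x1 x2. f (S (S x3) * (S (b * x2) * (a * x1))))))"
    by (rule ext2_swap)
  also have "\<dots> = Sw x (\<lambda>x' x3. RR (\<lambda>a b. Sw x' (\<lambda>c d. f (S (S x3) * (S (c * b) * (d * a))))))"
    by (subst R_comm[where F="\<lambda>p q. f (S (S _) * (S q * p))"]) (intro l refl)+
  also have "\<dots> = RR (\<lambda>a b. Sw x (\<lambda>x' x3. Sw x' (\<lambda>c d. f (S (S x3) * (S (c * b) * (d * a))))))"
    by (rule ext2_swap)
  also have "\<dots> = RR (\<lambda>a b. Sw x (\<lambda>c y. Sw y (\<lambda>d x3. f (S (S x3) * (S b * ((S c * d) * a))))))"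
    by (subst coassoc) (intro l | simp add: S_mult mult.assoc)+
  also have "\<dots> = RR (\<lambda>a b. f (S (S x) * (S b * (1 * a))))"
    by (subst cancel_Sl1[where F="\<lambda>w x3. f (S (S x3) * (S _ * (w * _)))"]) (intro l refl)+
  also have "\<dots> = f (S (S x) * u)"
    by (subst lf_u[where f="\<lambda>w. f (S (S x) * w)"]) (intro l | simp)+
  finally show "f (u * x) = f (S (S x) * u)" using 1 by simp
qed

lemma lf_Su: assumes f: "lf f" shows "f (S u) = RR (\<lambda>a b. f (a * S b))"
proof -
  note l = lin lf_comp[OF f]
  have "f (S u) = RR (\<lambda>a b. f (S a * S (S b)))"
    by (subst lf_u) (intro l | simp add: S_mult)+
  also have "\<dots> = RR (\<lambda>a b. f (a * S b))"
    by (rule SS_R) (intro l)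
  finally show ?thesis .
qed

lemma lf_Su': assumes f: "lf f" shows "f (S u) = RR (\<lambda>a b. f (S a * S (S b)))"
  by (subst lf_u) (intro lin lf_comp[OF f] | simp add: S_mult)+

lemma tw_central: "tw * x = x * tw" and S_tw: "S tw = tw"
  using twi by (auto simp: is_twist_def)

lemma cu_tw: "cu tw = 1"
proof -
  obtain y where "tw * y = 1" using twi by (auto simp: is_twist_def)
  then have nz: "cu tw \<noteq> 0" using cu_mult[of tw y] cu_one by auto
  have "Sw tw (\<lambda>a b. cu a * cu b) = RR (\<lambda>a b. RR (\<lambda>a' b'. cu (tw * (b * a')) * cu (tw * (a * b'))))"
    by (rule Sw_tw) (intro lin)
  also have "\<dots> = RR (\<lambda>a b. cu a * (cu b * (cu tw * cu tw * RR (\<lambda>a' b'. cu a' * cu b'))))"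
    by (simp add: cu_mult ext2_multl[symmetric] algebra_simps)
  also have "\<dots> = cu tw * cu tw"
    by (subst R_cu_l, (intro lin))+ (simp add: cu_one)
  also have "Sw tw (\<lambda>a b. cu a * cu b) = cu tw"
    by (rule counit_l) (intro lin)
  finally show ?thesis using nz by simp
qed

text \<open>Apply S(x1) x2 to Delta(theta) = (theta \<otimes> theta) R21 R; the result is eps(theta)
  = 1. The companion \<open>uSu_tw\<close> applies x1 S(x2).\<close>

lemma Suu_tw: "S u * (u * (tw * tw)) = 1"
proof (rule heqI)
  fix f assume f: "lf f"
  note l = lin lf_comp[OF f]
  have "f 1 = Sw tw (\<lambda>a b. f (S a * b))" by (subst antip_l[OF f]) (simp add: cu_tw)
  also have "\<dots> = RR (\<lambda>a b. RR (\<lambda>a' b'. f (S (tw * (b * a')) * (tw * (a * b')))))"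
    by (rule Sw_tw) (intro l)
  also have "\<dots> = RR (\<lambda>a b. RR (\<lambda>a' b'. f (S a' * ((S b * a) * (b' * (tw * tw))))))"
  proof -
    have "S (tw * (b * a')) * (tw * (a * b')) = S a' * ((S b * a) * (b' * (tw * tw)))" for a b a' b'
      unfolding S_mult S_tw by (metis mult.assoc tw_central)
    then show ?thesis by simp
  qed
  also have "\<dots> = RR (\<lambda>a' b'. RR (\<lambda>a b. f (S a' * ((S b * a) * (b' * (tw * tw))))))"
    by (rule ext2_swap)
  also have "\<dots> = RR (\<lambda>a' b'. f (S a' * (u * (b' * (tw * tw)))))"
    by (subst lf_u[where f="\<lambda>w. f (S _ * (w * (_ * (tw * tw))))"]) (intro l refl)+
  also have "\<dots> = RR (\<lambda>a' b'. f ((S a' * S (S b')) * (u * (tw * tw))))"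
    by (simp add: mult.assoc[symmetric]) (simp add: mult.assoc u_conj)
  also have "\<dots> = f (S u * (u * (tw * tw)))"
    by (subst lf_Su'[where f="\<lambda>w. f (w * _)"]) (intro l refl)+
  finally show "f (S u * (u * (tw * tw))) = f 1" by simp
qed

lemma uSu_tw: "u * (S u * (tw * tw)) = 1"
proof (rule heqI)
  fix f assume f: "lf f"
  note l = lin lf_comp[OF f]
  have "f 1 = Sw tw (\<lambda>a b. f (a * S b))" by (subst antip_r[OF f]) (simp add: cu_tw)
  also have "\<dots> = RR (\<lambda>a b. RR (\<lambda>a' b'. f ((tw * (b * a')) * S (tw * (a * b')))))"
    by (rule Sw_tw) (intro l)
  also have "\<dots> = RR (\<lambda>a b. RR (\<lambda>a' b'. f (b * ((a' * S b') * (S a * (tw * tw))))))"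
  proof -
    have "(tw * (b * a')) * S (tw * (a * b')) = b * ((a' * S b') * (S a * (tw * tw)))" for a b a' b'
      unfolding S_mult S_tw by (metis mult.assoc tw_central)
    then show ?thesis by simp
  qed
  also have "\<dots> = RR (\<lambda>a b. f (b * (S u * (S a * (tw * tw)))))"
    by (subst lf_Su[where f="\<lambda>w. f (_ * (w * (S _ * (tw * tw))))"]) (intro l refl)+
  \<comment> \<open>Two applications of \<open>SS_R\<close> raise S(a) to S^3(a), the form that can
    pass S(u): S applied to \<open>u_conj\<close> reads S(u) S^3(a) = S(a) S(u).\<close>
  also have "\<dots> = RR (\<lambda>a b. f (S b * (S u * (S (S a) * (tw * tw)))))"
    by (rule SS_R[symmetric]) (intro l)
  also have "\<dots> = RR (\<lambda>a b. f (S (S b) * (S u * (S (S (S a)) * (tw * tw)))))"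
    by (rule SS_R[symmetric]) (intro l)
  also have "\<dots> = RR (\<lambda>a b. f (S (S b) * (S a * (S u * (tw * tw)))))"
  proof -
    have "S u * (S (S (S a)) * (tw * tw)) = S a * (S u * (tw * tw))" for a
      using S_mult[of "S (S a)" u] S_mult[of u a] u_conj[of a] by (metis mult.assoc)
    then show ?thesis by simp
  qed
  also have "\<dots> = RR (\<lambda>a b. f (S b * (a * (S u * (tw * tw)))))"
    by (rule SS_R) (intro l)
  also have "\<dots> = f (u * (S u * (tw * tw)))"
    by (subst lf_u[where f="\<lambda>w. f (w * _)"]) (intro l | simp add: mult.assoc)+
  finally show "f (u * (S u * (tw * tw))) = f 1" by simp
qed

definition G :: 'h where "G = tw * u"
definition Gi :: 'h where "Gi = S u * tw"

lemma S_G: "S G = Gi" by (simp add: G_def Gi_def S_mult S_tw)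

lemma G_Gi: "G * Gi = 1" and Gi_G: "Gi * G = 1"
proof -
  show "G * Gi = 1" unfolding G_def Gi_def using uSu_tw by (metis mult.assoc tw_central)
  show "Gi * G = 1" unfolding G_def Gi_def using Suu_tw by (metis mult.assoc tw_central)
qed

lemma G_conj: "G * x = S (S x) * G"
  unfolding G_def by (metis mult.assoc tw_central u_conj)

lemma SS_eq: "S (S x) = G * x * Gi"
  by (metis G_conj mult.assoc G_Gi mult_1_right)

lemma SS_G: "S (S G) = G"
  unfolding SS_eq by (simp add: mult.assoc G_Gi)

lemma tw_G_Su: "tw * (G * S u) = 1" 
  using G_Gi unfolding Gi_def by (metis mult.assoc tw_central)

subsection \<open>Invariant tensors\<close>

text \<open>This is Delta^op = R21^-1 Delta R21, with R^-1 = (S \<otimes> id)(R) from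
  \<open>SR_R\<close>.\<close>

lemma flip_comm: assumes F: "bil F"
  shows "Sw x (\<lambda>p q. F q p) =
    RR (\<lambda>a b. RR (\<lambda>a' b'. Sw x (\<lambda>p q. F (b * (p * b')) (S a * (q * a')))))"
proof -
  note l = lin bil1[OF F] bil2[OF F]
  have "RR (\<lambda>a b. RR (\<lambda>a' b'. Sw x (\<lambda>p q. F (b * (p * b')) (S a * (q * a'))))) =
      RR (\<lambda>a b. RR (\<lambda>a' b'. Sw x (\<lambda>p q. F (b * (b' * q)) (S a * (a' * p)))))"
    by (subst R_comm[where F="\<lambda>v w. F (_ * w) (S _ * v)"]) (intro l refl)+
  also have "\<dots> = Sw x (\<lambda>p q. RR (\<lambda>a b. RR (\<lambda>a' b'. F ((b * b') * q) ((S a * a') * p))))"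
    by (simp only: ext2_swap[of "cop H x"] mult.assoc)
  also have "\<dots> = Sw x (\<lambda>p q. F (1 * q) (1 * p))"
    by (subst SR_R[where F="\<lambda>v w. F (w * _) (v * _)"]) (intro l refl)+
  finally show ?thesis by simp
qed

lemma SSR: assumes F: "bil F" shows "RR (\<lambda>a b. F (S (S a)) (S (S b))) = RR F"
proof -
  note l = lin bil1[OF F] bil2[OF F]
  have "RR (\<lambda>a b. F (S (S a)) (S (S b))) = RR (\<lambda>a b. F (S a) (S b))"
    by (rule SS_R) (intro l)
  then show ?thesis by (simp add: SS_R[OF F])
qed

text \<open>The sum of S^2(a) b is the inverse of S(u): multiplied by S(u) on the right it becomes
  S^2(a) S(u) S^2(b), hence a S(u) b = a a' S(b') b, which \<open>R_idS\<close> collapses. Moving b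
  past S(u) uses that b lies in the image of S; surjectivity of S is supplied later by the
  integral.\<close>

lemma S2_R_mult: assumes surj: "surj S" and f: "lf f"
  shows "RR (\<lambda>a b. f (S (S a) * b)) = f (u * (tw * tw))"
proof -
  note l = lin lf_comp[OF f]
  have comm: "y * S u = S u * S (S y)" for y
  proof -
    obtain x where y: "y = S x" using surjD[OF surj] by blast
    show ?thesis unfolding y S_mult[symmetric] u_conj ..
  qed
  have R: "u * (tw * tw) = u * (tw * tw) * (S u * (u * (tw * tw)))"
    by (simp add: Suu_tw)
  have 1: "RR (\<lambda>a b. g (S (S a) * b * S u)) = g 1" if g: "lf g" for g
  proof -
    note l = lin lf_comp[OF g]
    have "RR (\<lambda>a b. g (S (S a) * b * S u)) = RR (\<lambda>a b. g (S (S a) * (S u * S (S b))))"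
    proof -
      have "S (S a) * b * S u = S (S a) * (S u * S (S b))" for a b
        by (simp only: mult.assoc comm[of b])
      then show ?thesis by simp
    qed
    also have "\<dots> = RR (\<lambda>a b. g (a * (S u * b)))"
      by (rule SSR) (intro l)
    also have "\<dots> = RR (\<lambda>a b. RR (\<lambda>a' b'. g ((a * a') * (S b' * b))))"
      by (subst lf_Su[where f="\<lambda>w. g (_ * (w * _))"]) (intro l | simp add: mult.assoc)+
    also have "\<dots> = g (1 * 1)"
      by (rule R_idS) (intro l)
    finally show ?thesis by simp
  qed
  have "RR (\<lambda>a b. f (S (S a) * b)) = RR (\<lambda>a b. f ((S (S a) * b * S u) * (u * (tw * tw))))"
    by (simp add: mult.assoc Suu_tw)
  also have "\<dots> = f (1 * (u * (tw * tw)))"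
    by (rule 1) (intro l)
  finally show ?thesis by simp
qed

lemma Sw_S_aux': assumes F: "bil F"
  shows "Sw x (\<lambda>y z. Sw y (\<lambda>p q. Sw z (\<lambda>a b. F (S q * a) (S p * b)))) = cu x * F 1 1"
proof -
  note l = lin bil1[OF F] bil2[OF F]
  have "Sw x (\<lambda>y z. Sw y (\<lambda>p q. Sw z (\<lambda>a b. F (S q * a) (S p * b)))) =
     Sw x (\<lambda>p y. Sw y (\<lambda>q z. Sw z (\<lambda>a b. F (S q * a) (S p * b))))"
    by (rule coassoc) (intro l)
  also have "\<dots> = Sw x (\<lambda>p y. F 1 (S p * y))"
    by (subst cancel_Sl1[where F="\<lambda>w b. F w (S _ * b)"]) (intro l refl)+
  also have "\<dots> = cu x * F 1 1"
    by (rule antip_l) (intro l)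
  finally show ?thesis .
qed

lemma V2_D: assumes X: "X \<in> V2_set H" and F: "bil F"
  shows "ext2 H X (\<lambda>x y. Sw h (\<lambda>h' h''. Sw h' (\<lambda>a b. Sw h'' (\<lambda>c d. F (S a * x * b) (S c * y * d))))) =
    cu h * ext2 H X F"
proof -
  have "ext2 H (tri2 H X h) F = ext2 H (\<lambda>p. cu h * X p) F" using X by (simp add: V2_set_def)
  also have "\<dots> = cu h * ext2 H X F" by (simp add: ext2_def case_prod_beta sum_distrib_left mult.assoc)
  finally show ?thesis using F by (simp add: tri2_def ext2_ext2 ext2_pure2)
qed

section \<open>Invariant tensors and invariant forms under the adjoint action\<close>

definition adinv :: "('h \<times> 'h \<Rightarrow> 'k) \<Rightarrow> bool" where
  "adinv X \<longleftrightarrow> (\<forall>F h. bil F \<longrightarrow>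
    ext2 H X (\<lambda>x y. Sw h (\<lambda>h' h''. Sw h' (\<lambda>a b. Sw h'' (\<lambda>c d. F (S a * x * b) (S c * y * d))))) =
    cu h * ext2 H X F)"

lemma adinvD: "adinv X \<Longrightarrow> bil F \<Longrightarrow>
  ext2 H X (\<lambda>x y. Sw h (\<lambda>h' h''. Sw h' (\<lambda>a b. Sw h'' (\<lambda>c d. F (S a * x * b) (S c * y * d))))) =
    cu h * ext2 H X F"
  by (simp add: adinv_def)

lemma ext2_crd: assumes "X \<in> tensor2 H"
  shows "ext2 H X (\<lambda>x y. crd H x b * crd H y c) = X (b, c)"
proof (cases "b \<in> B \<and> c \<in> B")
  case True
  have "ext2 H X (\<lambda>x y. crd H x b * crd H y c) =
    (\<Sum>x\<in>B. \<Sum>y\<in>B. if x = b then (if y = c then X (x, y) else 0) else 0)"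
    by (auto simp: ext2_eq crd_basis intro!: sum.cong)
  also have "\<dots> = (\<Sum>x\<in>B. if x = b then (\<Sum>y\<in>B. if y = c then X (x, y) else 0) else 0)"
    by (intro sum.cong) auto
  also have "\<dots> = X (b, c)" using True by (simp add: finite_B)
  finally show ?thesis .
next
  case False
  then have "X (b, c) = 0" using assms by (auto simp: tensor2_def)
  moreover have "crd H x b * crd H y c = 0" for x y using False crd_out by auto
  ultimately show ?thesis by (auto simp: ext2_def intro!: sum.neutral)
qed

lemma V2_iff: assumes "X \<in> tensor2 H" shows "X \<in> V2_set H \<longleftrightarrow> adinv X"
proof
  assume "X \<in> V2_set H" then show "adinv X" unfolding adinv_def using V2_D by blast
next
  assume X: "adinv X"
  have "tri2 H X h p = cu h * X p" for h p
  proof (cases p)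
    case (Pair b c)
    show ?thesis
      unfolding Pair tri2_def pure2_def prod.case
      by (subst adinvD[OF X, where F="\<lambda>x y. crd H x b * crd H y c"]) (intro lin | simp add: ext2_crd[OF assms])+
  qed
  then show "X \<in> V2_set H" using assms by (auto simp: V2_set_def)
qed

text \<open>Evaluate (x \<triangleleft> h1) \<otimes> (y \<triangleleft> h2 S(h3)) twice: h2 S(h3)
  cancels, or invariance removes h1 and h2 and leaves S(h) on the second leg.\<close>

lemma adinv_move: assumes X: "adinv X" and F: "bil F"
  shows "ext2 H X (\<lambda>x y. Sw h (\<lambda>a b. F (S a * x * b) y)) =
    ext2 H X (\<lambda>x y. Sw (S h) (\<lambda>a b. F x (S a * y * b)))"
proof -
  note l = lin bil1[OF F] bil2[OF F]
  let ?P = "\<lambda>x y a b z h3. Sw z (\<lambda>c d. Sw h3 (\<lambda>p q. F (S a * x * b) (S (S q) * (S c * y * d) * S p)))"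
  let ?M = "ext2 H X (\<lambda>x y. Sw h (\<lambda>w h3. Sw w (\<lambda>h' z. Sw h' (\<lambda>a b. ?P x y a b z h3))))"
  have "?M = Sw h (\<lambda>w h3. ext2 H X (\<lambda>x y. Sw w (\<lambda>h' z. Sw h' (\<lambda>a b. ?P x y a b z h3))))"
    by (rule ext2_swap)
  also have "\<dots> = Sw h (\<lambda>w h3. cu w * ext2 H X (\<lambda>x y. Sw h3 (\<lambda>p q. F x (S (S q) * y * S p))))"
    by (subst adinvD[OF X, where F="\<lambda>x y. Sw _ (\<lambda>p q. F x (S (S q) * y * S p))"]) (intro l refl)+
  also have "\<dots> = ext2 H X (\<lambda>x y. Sw h (\<lambda>p q. F x (S (S q) * y * S p)))"
    by (rule counit_l) (intro l)
  also have "\<dots> = ext2 H X (\<lambda>x y. Sw (S h) (\<lambda>a b. F x (S a * y * b)))"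
    by (subst Sw_S) (intro l refl)+
  finally have 1: "?M = \<dots>" .
  have "?M = ext2 H X (\<lambda>x y. Sw h (\<lambda>h' k. Sw k (\<lambda>z h3. Sw h' (\<lambda>a b. ?P x y a b z h3))))"
    by (subst coassoc) (intro l refl)+
  also have "\<dots> = ext2 H X (\<lambda>x y. Sw h (\<lambda>h' k. Sw h' (\<lambda>a b. Sw k (\<lambda>z h3. ?P x y a b z h3))))"
    by (subst (3) ext2_swap) (rule refl)
  also have "\<dots> = ext2 H X (\<lambda>x y. Sw h (\<lambda>h' k. Sw h' (\<lambda>a b. Sw k (\<lambda>z h3. Sw h3 (\<lambda>p q. Sw z (\<lambda>c d.
      F (S a * x * b) (S (c * S q) * y * (d * S p))))))))"
    by (subst (6) ext2_swap) (simp add: S_mult mult.assoc)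
  also have "\<dots> = ext2 H X (\<lambda>x y. Sw h (\<lambda>h' k. Sw h' (\<lambda>a b. cu k * F (S a * x * b) (S 1 * y * 1))))"
    by (subst Sw_S_aux[where F="\<lambda>v w. F (S _ * _ * _) (S v * _ * w)"]) (intro l refl)+
  also have "\<dots> = ext2 H X (\<lambda>x y. Sw h (\<lambda>h' k. cu k * Sw h' (\<lambda>a b. F (S a * x * b) y)))"
    by (simp add: ext2_multl S_one)
  also have "\<dots> = ext2 H X (\<lambda>x y. Sw h (\<lambda>a b. F (S a * x * b) y))"
    by (subst counit_r') (intro l refl)+
  finally show ?thesis using 1 by simp
qed

definition inv_form :: "('h \<Rightarrow> 'h \<Rightarrow> 'k) \<Rightarrow> bool" where
  "inv_form P \<longleftrightarrow> bil P \<and> (\<forall>x y h.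
    Sw h (\<lambda>h' h''. Sw h' (\<lambda>a b. Sw h'' (\<lambda>c d. P (S a * x * b) (S c * y * d)))) = cu h * P x y)"

text \<open>Mirror image of \<open>adinv_move\<close>, from P(x \<triangleleft> S(h1) h2, y
  \<triangleleft> h3).\<close>

lemma inv_form_move: assumes P: "inv_form P"
  shows "Sw h (\<lambda>c d. P x (S c * y * d)) = Sw (S h) (\<lambda>a b. P (S a * x * b) y)"
proof -
  have bil: "bil P" using P by (simp add: inv_form_def)
  note l = lin bil1[OF bil] bil2[OF bil]
  let ?K = "\<lambda>p q a b c d. P (S a * (S (S q) * x * S p) * b) (S c * y * d)"
  let ?M = "Sw h (\<lambda>h1 k. Sw h1 (\<lambda>p q. Sw k (\<lambda>h' h''. Sw h' (\<lambda>a b. Sw h'' (\<lambda>c d. ?K p q a b c d)))))"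
  have "?M = Sw h (\<lambda>h1 k. Sw h1 (\<lambda>p q. cu k * P (S (S q) * x * S p) y))"
    using P by (simp add: inv_form_def)
  also have "\<dots> = Sw h (\<lambda>h1 k. cu k * Sw h1 (\<lambda>p q. P (S (S q) * x * S p) y))"
    by (simp add: ext2_multl)
  also have "\<dots> = Sw h (\<lambda>p q. P (S (S q) * x * S p) y)"
    by (rule counit_r') (intro l)
  also have "\<dots> = Sw (S h) (\<lambda>a b. P (S a * x * b) y)"
    by (subst Sw_S) (intro l refl)+
  finally have 1: "?M = \<dots>" .
  have "?M = Sw h (\<lambda>h1 k. Sw k (\<lambda>h' h''. Sw h1 (\<lambda>p q. Sw h' (\<lambda>a b. Sw h'' (\<lambda>c d. ?K p q a b c d)))))"
    by (subst (2) ext2_swap) (rule refl)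
  also have "\<dots> = Sw h (\<lambda>m h''. Sw m (\<lambda>h1 h'. Sw h1 (\<lambda>p q. Sw h' (\<lambda>a b. Sw h'' (\<lambda>c d. ?K p q a b c d)))))"
    by (rule coassoc[symmetric]) (intro l)
  also have "\<dots> = Sw h (\<lambda>m h''. Sw m (\<lambda>h1 h'. Sw h1 (\<lambda>p q. Sw h' (\<lambda>a b. Sw h'' (\<lambda>c d.
      P (S (S q * a) * x * (S p * b)) (S c * y * d))))))"
    by (simp add: S_mult mult.assoc)
  also have "\<dots> = Sw h (\<lambda>m h''. cu m * Sw h'' (\<lambda>c d. P (S 1 * x * 1) (S c * y * d)))"
    by (subst Sw_S_aux'[where F="\<lambda>v w. Sw _ (\<lambda>c d. P (S v * _ * w) (S c * _ * d))"]) (intro l refl)+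
  also have "\<dots> = Sw h (\<lambda>c d. P (S 1 * x * 1) (S c * y * d))"
    by (rule counit_l) (intro l)
  finally show ?thesis using 1 by (simp add: S_one)
qed

text \<open>With X read as a coevaluation and P as an evaluation, this is a loop on which w acts: a
  trace of w, twisted by S^2.\<close>

definition tau :: "('h \<times> 'h \<Rightarrow> 'k) \<Rightarrow> ('h \<Rightarrow> 'h \<Rightarrow> 'k) \<Rightarrow> 'h \<Rightarrow> 'k" where
  "tau X P w = ext2 H X (\<lambda>x y. Sw w (\<lambda>a b. P x (S a * y * b)))"

text \<open>The factor h travels once around the loop: through P it reaches the first leg as S(h),
  through X it returns to the second leg as S^2(h), now acting before w.\<close>

lemma tau_cyclic: assumes X: "adinv X" and P: "inv_form P"
  shows "tau X P (w * h) = tau X P (S (S h) * w)"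
proof -
  have bil: "bil P" using P by (simp add: inv_form_def)
  note l = lin bil1[OF bil] bil2[OF bil]
  have "tau X P (w * h) = ext2 H X (\<lambda>x y. Sw w (\<lambda>a b. Sw h (\<lambda>c d. P x (S c * (S a * y * b) * d))))"
    unfolding tau_def by (subst Sw_mult) (intro l | simp add: S_mult mult.assoc)+
  also have "\<dots> = ext2 H X (\<lambda>x y. Sw w (\<lambda>a b. Sw (S h) (\<lambda>c d. P (S c * x * d) (S a * y * b))))"
    by (simp only: inv_form_move[OF P])
  also have "\<dots> = ext2 H X (\<lambda>x y. Sw (S h) (\<lambda>c d. Sw w (\<lambda>a b. P (S c * x * d) (S a * y * b))))"
    by (subst (2) ext2_swap) (rule refl)
  also have "\<dots> = ext2 H X (\<lambda>x y. Sw (S (S h)) (\<lambda>c d. Sw w (\<lambda>a b. P x (S a * (S c * y * d) * b))))"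
    by (rule adinv_move[OF X]) (intro l)
  also have "\<dots> = tau X P (S (S h) * w)"
    unfolding tau_def by (subst Sw_mult) (intro l | simp add: S_mult mult.assoc)+
  finally show ?thesis .
qed

text \<open>
  By \<open>tau_cyclic\<close>, \<open>w \<mapsto> tau X P (G * w)\<close> is a trace, so it takes the same value at \<open>\<theta> u = G\<close>
  and \<open>\<theta> S(u) = G\<^sup>-\<^sup>1\<close>: left and right quantum traces agree.
\<close>

lemma tau_GG: assumes X: "adinv X" and P: "inv_form P"
  shows "tau X P (G * G) = ext2 H X P"
proof -
  have bil: "bil P" using P by (simp add: inv_form_def)
  note l = lin bil1[OF bil] bil2[OF bil]
  have lt: "lh g \<Longrightarrow> lf (\<lambda>w. tau X P (g w))" for g
    unfolding tau_def by (intro l)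
  have "tau X P (G * G) = tau X P (tw * G * u)"
    by (metis G_def mult.assoc tw_central)
  also have "\<dots> = RR (\<lambda>a b. tau X P (tw * G * (S b * a)))"
    by (rule lf_u) (intro lin lt)
  also have "\<dots> = RR (\<lambda>a b. tau X P (tw * G * (a * S b)))"
  proof -
    have "tau X P (tw * G * (S b * a)) = tau X P (tw * G * (a * S b))" for a b
    proof -
      have "tau X P (tw * G * (S b * a)) = tau X P (S (S a) * (tw * G * S b))"
        using tau_cyclic[OF X P, of "tw * G * S b" a] by (simp add: mult.assoc)
      also have "S (S a) * (tw * G * S b) = tw * G * (a * S b)"
        by (metis mult.assoc tw_central G_conj)
      finally show ?thesis .
    qed
    then show ?thesis by simp
  qed
  also have "\<dots> = tau X P (tw * G * S u)"
    by (rule lf_Su[symmetric]) (intro lin lt)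
  also have "\<dots> = tau X P 1" using tw_G_Su by (simp add: mult.assoc)
  also have "\<dots> = ext2 H X P"
    unfolding tau_def by (subst Sw_one) (intro l | simp add: S_one)+
  finally show ?thesis .
qed

text \<open>S^-2 is written as conjugation by \<open>G\<close>, which \<open>SS_eq\<close> permits;
  no inverse of S is at hand here.\<close>

definition rot :: "('h \<times> 'h \<Rightarrow> 'k) \<Rightarrow> 'h \<times> 'h \<Rightarrow> 'k" where
  "rot X = (\<lambda>p. ext2 H X (\<lambda>x y. pure2 H (Gi * y * G) x p))"

lemma ext2_rot: "bil F \<Longrightarrow> ext2 H (rot X) F = ext2 H X (\<lambda>x y. F (Gi * y * G) x)"
  unfolding rot_def by (simp add: ext2_ext2 ext2_pure2)

lemma rot_tensor2: "rot X \<in> tensor2 H"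
  by (auto simp: tensor2_def rot_def pure2_def crd_out ext2_def)

text \<open>Here \<open>Gi * S c * G\<close> plays the role of S^-1(c), so this is the cancellation
  S^-1(x2) x1 = eps(x).\<close>

lemma Si_cancel: assumes f: "lf f" shows "Sw x (\<lambda>b c. f (Gi * S c * G * b)) = cu x * f 1"
proof -
  note l = lin lf_comp[OF f]
  have "Gi * S c * G * b = Gi * (S (S b * c)) * G" for b c
    using G_conj[of b] by (simp add: S_mult mult.assoc)
  then have "Sw x (\<lambda>b c. f (Gi * S c * G * b)) = Sw x (\<lambda>b c. f (Gi * (S (S b * c)) * G))" by simp
  also have "\<dots> = cu x * f (Gi * S 1 * G)"
    by (rule antip_l) (intro l)
  finally show ?thesis by (simp add: S_one Gi_G)
qed

text \<open>\<open>adinv_move\<close> carries the action on x over to y. The other leg becomes S(h1)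
  h4 S^-2(y) S^-1(h3) h2, where h3 cancels h2 and afterwards h1 cancels what was h4.\<close>

lemma rot_adinv: assumes X: "adinv X" shows "adinv (rot X)"
  unfolding adinv_def
proof (intro allI impI)
  fix F h assume F: "bil F"
  note l = lin bil1[OF F] bil2[OF F]
  have "ext2 H (rot X) (\<lambda>x y. Sw h (\<lambda>h' h''. Sw h' (\<lambda>a b. Sw h'' (\<lambda>c d. F (S a * x * b) (S c * y * d))))) =
    ext2 H X (\<lambda>x y. Sw h (\<lambda>h' h''. Sw h' (\<lambda>a b. Sw h'' (\<lambda>c d. F (S a * (Gi * y * G) * b) (S c * x * d)))))"
    by (rule ext2_rot) (intro l)
  also have "\<dots> = Sw h (\<lambda>h' h''. Sw h' (\<lambda>a b. ext2 H X (\<lambda>x y. Sw h'' (\<lambda>c d. F (S a * (Gi * y * G) * b) (S c * x * d)))))"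
    by (simp only: ext2_swap[of X])
  also have "\<dots> = Sw h (\<lambda>h' h''. Sw h' (\<lambda>a b. ext2 H X (\<lambda>x y. Sw (S h'') (\<lambda>c d. F (S a * (Gi * (S c * y * d) * G) * b) x))))"
    by (subst adinv_move[OF X, where F="\<lambda>x y. F (S _ * (Gi * y * G) * _) x"]) (intro l refl)+
  also have "\<dots> = Sw h (\<lambda>h' h''. Sw h' (\<lambda>a b. ext2 H X (\<lambda>x y. Sw h'' (\<lambda>c d. F (S a * (Gi * (S (S d) * y * S c) * G) * b) x))))"
    by (subst Sw_S) (intro l refl)+
  also have "\<dots> = Sw h (\<lambda>h' h''. Sw h' (\<lambda>a b. ext2 H X (\<lambda>x y. Sw h'' (\<lambda>c d. F (S a * (d * (Gi * y * G) * (Gi * S c * G * b))) x))))"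
  proof -
    have 1: "Gi * S (S d) = d * Gi" for d
      by (metis SS_eq Gi_G mult.assoc mult_1_left)
    have "S a * (Gi * (S (S d) * y * S c) * G) * b = S a * (d * (Gi * y * G) * (Gi * S c * G * b))" for a b c d y
    proof -
      have "S a * (Gi * (S (S d) * y * S c) * G) * b = S a * ((Gi * S (S d)) * y * S c * G * b)"
        by (simp add: mult.assoc)
      also have "\<dots> = S a * (d * (Gi * y * ((G * Gi) * S c * G * b)))"
        unfolding 1 by (simp add: mult.assoc G_Gi)
      finally show ?thesis by (simp add: mult.assoc)
    qed
    then show ?thesis by simp
  qed
  also have "\<dots> = ext2 H X (\<lambda>x y. Sw h (\<lambda>h' h''. Sw h' (\<lambda>a b. Sw h'' (\<lambda>c d. F (S a * (d * (Gi * y * G) * (Gi * S c * G * b))) x))))"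
    by (simp only: ext2_swap[of X])
  also have "\<dots> = ext2 H X (\<lambda>x y. Sw h (\<lambda>a k. Sw k (\<lambda>b h''. Sw h'' (\<lambda>c d. F (S a * (d * (Gi * y * G) * (Gi * S c * G * b))) x))))"
    by (subst coassoc) (intro l refl)+
  also have "\<dots> = ext2 H X (\<lambda>x y. Sw h (\<lambda>a k. Sw k (\<lambda>m d. Sw m (\<lambda>b c. F (S a * (d * (Gi * y * G) * (Gi * S c * G * b))) x))))"
    by (subst coassoc[where F="\<lambda>b c d. F (S _ * (d * (Gi * _ * G) * (Gi * S c * G * b))) _"]) (intro l refl)+
  also have "\<dots> = ext2 H X (\<lambda>x y. Sw h (\<lambda>a k. Sw k (\<lambda>m d. cu m * F (S a * (d * (Gi * y * G) * 1)) x)))"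
    by (subst Si_cancel[where f="\<lambda>w. F (S _ * (_ * (Gi * _ * G) * w)) _"]) (intro l refl)+
  also have "\<dots> = ext2 H X (\<lambda>x y. Sw h (\<lambda>a k. F (S a * k * (Gi * y * G)) x))"
    by (subst counit_l) (intro l | simp add: mult.assoc)+
  also have "\<dots> = ext2 H X (\<lambda>x y. cu h * F (1 * (Gi * y * G)) x)"
    by (subst antip_l[where f="\<lambda>w. F (w * _) _"]) (intro l refl)+
  also have "\<dots> = cu h * ext2 H (rot X) F"
    by (simp add: ext2_multl ext2_rot[OF F])
  finally show "ext2 H (rot X) (\<lambda>x y. Sw h (\<lambda>h' h''. Sw h' (\<lambda>a b. Sw h'' (\<lambda>c d. F (S a * x * b) (S c * y * d))))) =
    cu h * ext2 H (rot X) F" .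
qed

subsection \<open>Modules and quantum traces\<close>

lemma hmod_fin: "is_hmod H M \<Longrightarrow> finite (idx M)"
  and hmod_out: "is_hmod H M \<Longrightarrow> i \<notin> idx M \<or> j \<notin> idx M \<Longrightarrow> act M h i j = 0"
  by (auto simp: is_hmod_def)

lemma hmod_nz: "is_hmod H M \<Longrightarrow> act M h i j \<noteq> 0 \<Longrightarrow> i \<in> idx M \<and> j \<in> idx M"
  using hmod_out[of M i j h] by blast

lemma hmod_lf0: "is_hmod H M \<Longrightarrow> lf (\<lambda>h. act M h i j)"
  using lin_form_iff by (simp add: is_hmod_def)

lemma hmod_lf: "is_hmod H M \<Longrightarrow> lh g \<Longrightarrow> lf (\<lambda>h. act M (g h) i j)"
  by (rule lf_comp[OF hmod_lf0])

lemma hmod_mult: assumes "is_hmod H M"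
  shows "(\<Sum>k\<in>idx M. act M x i k * act M y k j) = act M (x * y) i j"
proof -
  have "act M (x * y) i j = (act M x \<odot> act M y) i j" using assms by (simp add: is_hmod_def)
  also have "\<dots> = (\<Sum>k\<in>idx M. act M x i k * act M y k j)"
    by (rule mcomp_sum) (auto simp: hmod_fin[OF assms] hmod_out[OF assms])
  finally show ?thesis by simp
qed

lemma i_mor_out: "is_hmod H M \<Longrightarrow> i \<notin> idx M \<or> j \<notin> idx M \<Longrightarrow> i_mor H M c (i, j) = 0"
  by (simp add: i_mor_def hmod_out)

lemma comp_i_mor: assumes s: "\<And>b. b \<notin> B \<Longrightarrow> s k b = 0"
  shows "(s \<odot> i_mor H M) k (i, j) = (\<Sum>b\<in>B. s k b * act M b i j)"
  by (subst mcomp_sum[OF finite_B]) (auto simp: s i_mor_def)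

lemma comp_i_mor2: assumes s: "\<And>p. p \<notin> B \<times> B \<Longrightarrow> s k p = 0"
  shows "(s \<odot> (i_mor H M \<otimes> i_mor H N)) k ((i, j), (i', j')) =
    (\<Sum>b\<in>B. \<Sum>c\<in>B. s k (b, c) * (act M b i j * act N c i' j'))"
proof -
  have "(s \<odot> (i_mor H M \<otimes> i_mor H N)) k ((i, j), (i', j')) =
     (\<Sum>p\<in>B \<times> B. s k p * (i_mor H M \<otimes> i_mor H N) p ((i, j), (i', j')))"
    by (rule mcomp_sum) (use finite_B s in auto)
  also have "\<dots> = (\<Sum>b\<in>B. \<Sum>c\<in>B. s k (b, c) * (act M b i j * act N c i' j'))"
    by (simp add: sum.cartesian_product' mtens_def i_mor_def)
  finally show ?thesis .
qed

text \<open>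
  The defining equations of the structure morphisms range over \<open>nat\<close>-indexed modules only.  The
  regular module with an enumerated basis already determines a morphism out of the coend.
\<close>

definition enum :: "nat \<Rightarrow> 'h" where "enum = (SOME d. bij_betw d {0..<card B} B)"

lemma enum: "bij_betw enum {0..<card B} B"
  unfolding enum_def using ex_bij_betw_nat_finite[OF finite_B] by (rule someI_ex)

lemma enum_in: "i < card B \<Longrightarrow> enum i \<in> B"
  using enum by (auto simp: bij_betw_def)

lemma sum_enum: "(\<Sum>i\<in>{0..<card B}. f (enum i)) = (\<Sum>b\<in>B. f b)"
  by (rule sum.reindex_bij_betw[OF enum])

definition reg :: "('k, 'h, nat) hmod" where
  "reg = \<lparr>idx = {0..<card B},
     act = (\<lambda>h i j. if i < card B \<and> j < card B then crd H (h * enum j) (enum i) else 0)\<rparr>"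

lemma reg_hmod: "is_hmod H reg"
  unfolding is_hmod_def
proof (intro conjI allI impI)
  show "finite (idx reg)" by (simp add: reg_def)
  show "act reg h i j = 0" if "i \<notin> idx reg \<or> j \<notin> idx reg" for h i j
    using that by (auto simp: reg_def)
  show "lin_form H (\<lambda>h. act reg h i j)" for i j
  proof (cases "i < card B \<and> j < card B")
    case True
    have "lf (\<lambda>h. crd H (h * enum j) (enum i))" by (intro lin)
    with True show ?thesis by (simp add: reg_def lin_form_iff)
  next
    case False
    then show ?thesis by (auto simp: reg_def lin_form_iff lf_def)
  qed
  show "act reg 1 = reindex (idx reg) id"
  proof (intro ext)
    fix i j
    have "enum i = enum j \<longleftrightarrow> i = j" if "i < card B" "j < card B"
      using enum that by (auto simp: bij_betw_def inj_on_def)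
    then show "act reg 1 i j = reindex (idx reg) id i j"
      by (auto simp: reg_def reindex_def crd_basis enum_in)
  qed
  show "act reg (x * y) = act reg x \<odot> act reg y" for x y
  proof (intro ext)
    fix i j
    show "act reg (x * y) i j = (act reg x \<odot> act reg y) i j"
    proof (cases "i < card B \<and> j < card B")
      case True
      have "(act reg x \<odot> act reg y) i j = (\<Sum>k\<in>{0..<card B}. act reg x i k * act reg y k j)"
        by (rule mcomp_sum) (auto simp: reg_def)
      also have "\<dots> = (\<Sum>k\<in>{0..<card B}. crd H (x * enum k) (enum i) * crd H (y * enum j) (enum k))"
        using True by (intro sum.cong) (auto simp: reg_def)
      also have "\<dots> = (\<Sum>b\<in>B. crd H (x * b) (enum i) * crd H (y * enum j) b)"
        by (rule sum_enum)
      also have "\<dots> = crd H (x * (y * enum j)) (enum i)"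
        by (rule lf_expand') (intro lin)
      finally show ?thesis using True by (simp add: reg_def mult.assoc)
    next
      case False
      then have "(act reg x \<odot> act reg y) i j = 0"
        by (intro mcomp_zero) (auto simp: reg_def)
      with False show ?thesis by (auto simp: reg_def)
    qed
  qed
qed

text \<open>In the regular module i(b* \<otimes> 1) = b*, since b*(x 1) = b*(x). The index
  \<open>i\<close> stands for b*, and the sum over \<open>j\<close> expands the vector 1.\<close>

lemma reg_recover: assumes b: "b \<in> B"
  shows "\<exists>i. \<forall>s. (\<Sum>j\<in>{0..<card B}. crd H 1 (enum j) * (\<Sum>c\<in>B. s c * act reg c i j)) = s b"
proof -
  have "b \<in> enum ` {0..<card B}" using enum b by (simp add: bij_betw_def)
  then obtain i where i: "i < card B" "enum i = b" by auto
  have "(\<Sum>j\<in>{0..<card B}. crd H 1 (enum j) * (\<Sum>c\<in>B. s c * act reg c i j)) = s b" for s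
  proof -
    have "(\<Sum>j\<in>{0..<card B}. crd H 1 (enum j) * (\<Sum>c\<in>B. s c * act reg c i j)) =
      (\<Sum>j\<in>{0..<card B}. crd H 1 (enum j) * (\<Sum>c\<in>B. s c * crd H (c * enum j) b))"
      using i by (intro sum.cong) (auto simp: reg_def)
    also have "\<dots> = (\<Sum>d\<in>B. crd H 1 d * (\<Sum>c\<in>B. s c * crd H (c * d) b))"
      by (rule sum_enum)
    also have "\<dots> = (\<Sum>c\<in>B. s c * (\<Sum>d\<in>B. crd H 1 d * crd H (c * d) b))"
      unfolding sum_distrib_left by (subst sum.swap) (simp add: algebra_simps)
    also have "\<dots> = (\<Sum>c\<in>B. s c * crd H c b)"
      by (subst lf_expand) (intro lin | simp)+
    also have "\<dots> = (\<Sum>c\<in>B. if c = b then s c else 0)"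
      by (intro sum.cong) (auto simp: crd_basis)
    also have "\<dots> = s b" using b by (simp add: finite_B)
    finally show ?thesis .
  qed
  then show ?thesis by blast
qed

lemma i_reg_epi:
  assumes eq: "s \<odot> i_mor H reg = s' \<odot> i_mor H reg"
    and s: "\<And>k b. b \<notin> B \<Longrightarrow> s k b = 0" and s': "\<And>k b. b \<notin> B \<Longrightarrow> s' k b = 0"
  shows "s = s'"
proof (intro ext)
  fix k b
  show "s k b = s' k b"
  proof (cases "b \<in> B")
    case True
    then obtain i where
      r: "\<And>s. (\<Sum>j\<in>{0..<card B}. crd H 1 (enum j) * (\<Sum>c\<in>B. s c * act reg c i j)) = s b"
      using reg_recover by blast
    have "(\<Sum>c\<in>B. s k c * act reg c i j) = (\<Sum>c\<in>B. s' k c * act reg c i j)" for j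
      using fun_cong[OF fun_cong[OF eq, of k], of "(i, j)"]
      by (simp add: comp_i_mor[of s] comp_i_mor[of s'] s s')
    then show ?thesis using r[of "s k"] r[of "s' k"] by simp
  qed (simp add: s s')
qed

lemma i_reg_epi2:
  fixes s s' :: "'x \<Rightarrow> 'h \<times> 'h \<Rightarrow> 'k"
  assumes eq: "s \<odot> (i_mor H reg \<otimes> i_mor H reg) = s' \<odot> (i_mor H reg \<otimes> i_mor H reg)"
    and s: "\<And>k p. p \<notin> B \<times> B \<Longrightarrow> s k p = 0" and s': "\<And>k p. p \<notin> B \<times> B \<Longrightarrow> s' k p = 0"
  shows "s = s'"
proof (intro ext)
  fix k and p :: "'h \<times> 'h"
  obtain b b' where p: "p = (b, b')" by (cases p)
  show "s k p = s' k p"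
  proof (cases "b \<in> B \<and> b' \<in> B")
    case True
    obtain i where
      r: "\<And>s. (\<Sum>j\<in>{0..<card B}. crd H 1 (enum j) * (\<Sum>c\<in>B. s c * act reg c i j)) = s b"
      using True reg_recover by blast
    obtain i' where
      r': "\<And>s. (\<Sum>j\<in>{0..<card B}. crd H 1 (enum j) * (\<Sum>c\<in>B. s c * act reg c i' j)) = s b'"
      using True reg_recover by blast
    let ?f = "\<lambda>s j j'. \<Sum>c\<in>B. \<Sum>c'\<in>B. s k (c, c') * (act reg c i j * act reg c' i' j')"
    have 1: "?f s j j' = ?f s' j j'" for j j'
      using fun_cong[OF fun_cong[OF eq, of k], of "((i, j), (i', j'))"]
      by (simp add: comp_i_mor2[of s] comp_i_mor2[of s'] s s')
    have 2: "(\<Sum>j\<in>{0..<card B}. crd H 1 (enum j) * (\<Sum>j'\<in>{0..<card B}. crd H 1 (enum j') * ?f t j j')) = t k (b, b')" for t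
    proof -
      have "(\<Sum>j'\<in>{0..<card B}. crd H 1 (enum j') * ?f t j j') =
        (\<Sum>c\<in>B. t k (c, b') * act reg c i j)" for j
      proof -
        have "?f t j j' = (\<Sum>c'\<in>B. (\<Sum>c\<in>B. t k (c, c') * act reg c i j) * act reg c' i' j')" for j'
          unfolding sum_distrib_right by (subst sum.swap) (simp add: mult.assoc)
        then show ?thesis using r'[of "\<lambda>c'. \<Sum>c\<in>B. t k (c, c') * act reg c i j"] by simp
      qed
      then show ?thesis using r[of "\<lambda>c. t k (c, b')"] by simp
    qed
    show ?thesis using 2[of s] 2[of s'] unfolding 1 p by simp
  next
    case False
    then show ?thesis unfolding p using s s' by auto
  qed
qed

section \<open>Matrix entries of duals, tensor products and A\<close>

lemma dual_sel: "idx (dual_mod H M) = idx M" "act (dual_mod H M) h i j = act M (S h) j i"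
  by (simp_all add: dual_mod_def)

lemma tens_sel: "idx (tens_mod H M N) = idx M \<times> idx N"
  "act (tens_mod H M N) h (k, l) (i, j) = Sw h (\<lambda>a b. act M a k i * act N b l j)"
  by (simp_all add: tens_mod_def mtens_def)

lemma A_sel: "idx (A_mod H) = B"
  "act (A_mod H) h c b = (if c \<in> B then Sw h (\<lambda>h1 h2. crd H (S h1 * c * h2) b) else 0)"
  by (simp_all add: A_mod_def)

lemma A_out: "c \<notin> B \<or> b \<notin> B \<Longrightarrow> act (A_mod H) h c b = 0"
  by (auto simp: A_sel crd_out ext2_def)

lemma sum_A: assumes f: "lf f" and c: "c \<in> B"
  shows "(\<Sum>b\<in>B. act (A_mod H) h c b * f b) = Sw h (\<lambda>a d. f (S a * c * d))"
proof -
  have "(\<Sum>b\<in>B. act (A_mod H) h c b * f b) = (\<Sum>b\<in>B. Sw h (\<lambda>h1 h2. crd H (S h1 * c * h2) b * f b))"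
    using c by (simp add: A_sel ext2_multr)
  also have "\<dots> = Sw h (\<lambda>h1 h2. \<Sum>b\<in>B. crd H (S h1 * c * h2) b * f b)"
    unfolding ext2_def by (subst sum.swap) (simp add: sum_distrib_left case_prod_beta)
  finally show ?thesis by (simp add: lf_expand[OF f])
qed

lemma sum_A_l: "(\<Sum>c\<in>B. crd H w c * act (A_mod H) h c b) = Sw h (\<lambda>a d. crd H (S a * w * d) b)"
proof -
  have "(\<Sum>c\<in>B. crd H w c * act (A_mod H) h c b) = (\<Sum>c\<in>B. crd H w c * Sw h (\<lambda>h1 h2. crd H (S h1 * c * h2) b))"
    by (simp add: A_sel)
  also have "\<dots> = Sw h (\<lambda>a d. crd H (S a * w * d) b)"
    by (rule lf_expand) (intro lin)
  finally show ?thesis .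
qed

lemma ext2_sum: "ext2 H t (\<lambda>a b. \<Sum>i\<in>I. F i a b) = (\<Sum>i\<in>I. ext2 H t (F i))"
  unfolding ext2_def by (subst sum.swap) (simp add: sum_distrib_left case_prod_beta)

lemma bil_expand: assumes F: "bil F"
  shows "(\<Sum>p\<in>B. \<Sum>q\<in>B. (crd H x p * crd H y q) * F p q) = F x y"
proof -
  have "(\<Sum>p\<in>B. \<Sum>q\<in>B. (crd H x p * crd H y q) * F p q) = (\<Sum>p\<in>B. crd H x p * (\<Sum>q\<in>B. crd H y q * F p q))"
    by (simp add: sum_distrib_left mult.assoc)
  also have "\<dots> = (\<Sum>p\<in>B. crd H x p * F p y)"
    by (subst lf_expand) (intro lin bil2[OF F] refl)+
  also have "\<dots> = F x y"
    by (rule lf_expand) (intro lin bil1[OF F])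
  finally show ?thesis .
qed

text \<open>Braiding and twist contribute S(b) a theta, which sums to u theta = G.\<close>

lemma ev_tilde_eq: assumes M: "is_hmod H M"
  shows "ev_tilde H M () (i, k) = act M G k i"
proof -
  let ?I = "idx M"
  have fin: "finite (?I \<times> ?I)" using hmod_fin[OF M] by simp
  have br: "braid H M (dual_mod H M) (q, p) (i', k') = RR (\<lambda>a b. act M (S b) k' q * act M a p i')" for q p i' k'
    by (simp add: braid_def dual_sel)
  have 1: "(braid H M (dual_mod H M) \<odot> (theta_mor H M \<otimes> id_mor (dual_mod H M))) (q, p) (i, k) =
     RR (\<lambda>a b. act M (S b) k q * act M (a * tw) p i)" for q p
  proof -
    have "(braid H M (dual_mod H M) \<odot> (theta_mor H M \<otimes> id_mor (dual_mod H M))) (q, p) (i, k) =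
      (\<Sum>j\<in>?I \<times> ?I. braid H M (dual_mod H M) (q, p) j * (theta_mor H M \<otimes> id_mor (dual_mod H M)) j (i, k))"
      by (rule mcomp_sum[OF fin]) (auto simp: mtens_def theta_mor_def id_mor_def reindex_def dual_sel
        dest!: hmod_nz[OF M] split: if_splits)
    also have "\<dots> = (\<Sum>i'\<in>?I. \<Sum>k'\<in>?I. if k' = k then RR (\<lambda>a b. act M (S b) k' q * act M a p i') * act M tw i' i else 0)"
      by (auto simp: sum.cartesian_product' mtens_def br theta_mor_def id_mor_def reindex_def dual_sel
          intro!: sum.cong)
    also have "\<dots> = (\<Sum>i'\<in>?I. RR (\<lambda>a b. act M (S b) k q * act M a p i') * act M tw i' i)"
      using hmod_fin[OF M] by (cases "k \<in> ?I") (auto simp: hmod_out[OF M] ext2_def intro!: sum.cong)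
    also have "\<dots> = (\<Sum>i'\<in>?I. RR (\<lambda>a b. act M (S b) k q * (act M a p i' * act M tw i' i)))"
      by (simp add: ext2_multr[symmetric] mult.assoc)
    also have "\<dots> = RR (\<lambda>a b. act M (S b) k q * (\<Sum>i'\<in>?I. act M a p i' * act M tw i' i))"
      by (simp add: ext2_sum[symmetric] sum_distrib_left)
    finally show ?thesis by (simp add: hmod_mult[OF M])
  qed
  have "ev_tilde H M () (i, k) = (\<Sum>j\<in>?I \<times> ?I. ev M () j *
      (braid H M (dual_mod H M) \<odot> (theta_mor H M \<otimes> id_mor (dual_mod H M))) j (i, k))"
    unfolding ev_tilde_def by (rule mcomp_sum[OF fin]) (auto simp: ev_def split: if_splits)
  also have "\<dots> = (\<Sum>q\<in>?I. \<Sum>p\<in>?I. if p = q then RR (\<lambda>a b. act M (S b) k q * act M (a * tw) p i) else 0)"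
    by (auto simp: sum.cartesian_product' ev_def 1 intro!: sum.cong)
  also have "\<dots> = (\<Sum>q\<in>?I. RR (\<lambda>a b. act M (S b) k q * act M (a * tw) q i))"
    using hmod_fin[OF M] by simp
  also have "\<dots> = RR (\<lambda>a b. act M (S b * a * tw) k i)"
    by (simp add: ext2_sum[symmetric] hmod_mult[OF M] mult.assoc)
  also have "\<dots> = act M (u * tw) k i"
    by (rule lf_u[where f="\<lambda>w. act M (w * tw) k i", symmetric]) (intro lin hmod_lf[OF M])
  finally show ?thesis by (simp add: G_def tw_central)
qed

lemma unit_hmod: "is_hmod H (unit_mod H)"
  unfolding is_hmod_def unit_mod_def lin_form_iff
  by (auto simp: reindex_def cu_one cu_mult lf_cu[OF lh_id] fun_eq_iff mcomp_unit)

lemma unit_sel: "idx (unit_mod H) = UNIV" "act (unit_mod H) h i j = cu h"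
  by (simp_all add: unit_mod_def)

lemma qtr_unit: "qtr H (unit_mod H) f = cu G * f () ()"
proof -
  have "((f \<otimes> id_mor (dual_mod H (unit_mod H))) \<odot> coev (unit_mod H)) ((), ()) () = f () ()"
    by (subst mcomp_single[of "((), ())"]) (auto simp: mtens_def id_mor_def reindex_def coev_def dual_sel unit_sel)
  then show ?thesis
    unfolding qtr_def
    by (subst mcomp_single[of "((), ())"]) (auto simp: ev_tilde_eq[OF unit_hmod] unit_sel)
qed

lemma cu_G_nz: "cu G \<noteq> 0"
  using cu_mult[of G Gi] by (auto simp: G_Gi cu_one)

text \<open>On the unit object \<open>qtr\<close> multiplies the single matrix entry by the nonzero
  scalar \<open>cu G\<close>.\<close>

lemma negligible_unit: "negligible H (unit_mod H) Y f \<longleftrightarrow> (\<forall>g \<in> hom Y (unit_mod H). (g \<odot> f) () () = 0)"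
  by (simp add: negligible_def qtr_unit cu_G_nz)

subsection \<open>Structure morphisms of the coend\<close>

text \<open>The map f -> f o g of the dual space, as a matrix in the dual basis.\<close>

definition transp :: "('h \<Rightarrow> 'h) \<Rightarrow> 'h \<Rightarrow> 'h \<Rightarrow> 'k" where
  "transp g c b = (if c \<in> B then crd H (g c) b else 0)"

lemma trm_out: "b \<notin> B \<Longrightarrow> transp g c b = 0"
  by (simp add: transp_def crd_out)

lemma trm_i_mor: assumes M: "is_hmod H M"
  shows "(transp g \<odot> i_mor H M) c (i, j) = (if c \<in> B then act M (g c) i j else 0)"
  by (subst comp_i_mor) (auto simp: crd_out transp_def lf_expand[OF hmod_lf0[OF M]])

lemma trm_hom:
  assumes l: "\<And>b. lf (\<lambda>c. crd H (g c) b)"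
    and e: "\<And>f c h. lf f \<Longrightarrow> Sw h (\<lambda>a d. f (S a * g c * d)) = Sw h (\<lambda>a d. f (g (S a * c * d)))"
  shows "transp g \<in> hom (A_mod H) (A_mod H)"
proof -
  have "(transp g \<odot> act (A_mod H) h) c b = (act (A_mod H) h \<odot> transp g) c b" for h c b
  proof (cases "c \<in> B")
    case True
    have "(transp g \<odot> act (A_mod H) h) c b = (\<Sum>c'\<in>B. transp g c c' * act (A_mod H) h c' b)"
      by (rule mcomp_sum[OF finite_B]) (simp add: trm_out)
    also have "\<dots> = Sw h (\<lambda>a d. crd H (S a * g c * d) b)"
      using True by (simp add: transp_def sum_A_l)
    also have "\<dots> = Sw h (\<lambda>a d. crd H (g (S a * c * d)) b)"
      by (rule e) (intro lin)
    also have "\<dots> = (\<Sum>b'\<in>B. act (A_mod H) h c b' * crd H (g b') b)"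
      by (rule sum_A[OF l True, symmetric])
    also have "\<dots> = (\<Sum>b'\<in>B. act (A_mod H) h c b' * transp g b' b)"
      by (simp add: transp_def)
    also have "\<dots> = (act (A_mod H) h \<odot> transp g) c b"
      by (rule mcomp_sum[OF finite_B, symmetric]) (simp add: transp_def)
    finally show ?thesis .
  next
    case False
    then have "(transp g \<odot> act (A_mod H) h) c b = 0" "(act (A_mod H) h \<odot> transp g) c b = 0"
      by (auto intro!: mcomp_zero simp: transp_def A_out)
    then show ?thesis by simp
  qed
  then show ?thesis by (auto simp: hom_def A_sel crd_out transp_def fun_eq_iff)
qed

text \<open>Chosen so that S_A f = f o \<open>antip_el\<close>. The braiding contributes S(a) and b,
  the twist theta, the dual module S(c), and \<open>beta\<close> the factor G.\<close>

definition antip_el :: "'h \<Rightarrow> 'h" where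
  "antip_el c = ext2H H (Rmat H) (\<lambda>a b. S a * tw * S c * G * b)"

lemma lf_antip_el: "lf f \<Longrightarrow> f (antip_el c) = RR (\<lambda>a b. f (S a * tw * S c * G * b))"
  unfolding antip_el_def by (rule ext2H_lf)

text \<open>Straightening the zigzag leaves the entries of \<open>ev_tilde\<close>, hence
  multiplication by the pivotal element.\<close>

lemma beta_eq: assumes X: "is_hmod H X" shows "beta H X m q = act X G m q"
proof -
  let ?X' = "dual_mod H X" let ?X'' = "dual_mod H ?X'"
  let ?I = "idx X"
  let ?W = "(id_mor X \<otimes> coev ?X') \<odot> runit_inv X"
  have W: "?W (a, (k, m)) q = (if a = q \<and> q \<in> ?I \<and> k = m \<and> m \<in> ?I then 1 else 0)" for a k m
    by (simp add: id_tens_comp mcomp_unit) (auto simp: coev_def runit_inv_def reindex_def dual_sel)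
  define U where "U = assoc_inv X ?X' ?X'' \<odot> ?W"
  have 2: "U ((a, k), m) q = (if a = q \<and> q \<in> ?I \<and> k = m \<and> m \<in> ?I then 1 else 0)" for a k m
    unfolding U_def by (auto simp: assoc_inv_comp W dual_sel)
  have 3: "((ev_tilde H X \<otimes> id_mor ?X'') \<odot> U) ((), m) q = act X G m q"
  proof -
    have "((ev_tilde H X \<otimes> id_mor ?X'') \<odot> U) ((), m) q =
      (ev_tilde H X \<otimes> id_mor ?X'') ((), m) ((q, m), m) * U ((q, m), m) q"
      by (rule mcomp_single) (auto simp: 2 split_paired_all mtens_apply id_mor_def reindex_def split: if_splits)
    then show ?thesis
      unfolding 2 by (auto simp: mtens_apply id_mor_def reindex_def dual_sel ev_tilde_eq[OF X] hmod_out[OF X])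
  qed
  show ?thesis
    unfolding beta_def Let_def U_def[symmetric]
    by (subst mcomp_single[of "((), m)"])
      (auto simp: lunit_def reindex_def 3 dual_sel hmod_out[OF X])
qed

lemma S_A_rhs: assumes X: "is_hmod H X"
  shows "(i_mor H (dual_mod H X) \<odot> (beta H X \<otimes> theta_mor H (dual_mod H X)) \<odot> braid H (dual_mod H X) X) c (i, j) =
    (if c \<in> B then act X (antip_el c) i j else 0)"
proof (cases "c \<in> B")
  case True
  let ?X' = "dual_mod H X" let ?I = "idx X"
  have fin: "finite (?I \<times> ?I)" using hmod_fin[OF X] by simp
  have br: "braid H ?X' X (q, p) (i, j) = RR (\<lambda>a b. act X b q j * act X (S a) i p)" for q p
    by (simp add: braid_def dual_sel)
  have 1: "((beta H X \<otimes> theta_mor H ?X') \<odot> braid H ?X' X) (m, n) (i, j) =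
     RR (\<lambda>a b. act X (G * b) m j * act X (S a * tw) i n)" for m n
  proof -
    have "((beta H X \<otimes> theta_mor H ?X') \<odot> braid H ?X' X) (m, n) (i, j) =
      (\<Sum>r\<in>?I \<times> ?I. (beta H X \<otimes> theta_mor H ?X') (m, n) r * braid H ?X' X r (i, j))"
      by (rule mcomp_sum[OF fin])
        (auto simp: mtens_apply beta_eq[OF X] theta_mor_def dual_sel dest!: hmod_nz[OF X])
    also have "\<dots> = (\<Sum>q\<in>?I. \<Sum>p\<in>?I. (act X G m q * act X tw p n) * RR (\<lambda>a b. act X b q j * act X (S a) i p))"
      by (simp add: sum.cartesian_product' mtens_apply beta_eq[OF X] theta_mor_def dual_sel S_tw br)
    also have "\<dots> = RR (\<lambda>a b. \<Sum>q\<in>?I. \<Sum>p\<in>?I. (act X G m q * act X tw p n) * (act X b q j * act X (S a) i p))"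
      by (simp only: ext2_multl[symmetric] ext2_sum[symmetric])
    also have "\<dots> = RR (\<lambda>a b. (\<Sum>q\<in>?I. act X G m q * act X b q j) * (\<Sum>p\<in>?I. act X (S a) i p * act X tw p n))"
      by (simp only: sum_product) (simp add: ac_simps)
    finally show ?thesis by (simp add: hmod_mult[OF X])
  qed
  have "(i_mor H ?X' \<odot> (beta H X \<otimes> theta_mor H ?X') \<odot> braid H ?X' X) c (i, j) =
    (\<Sum>r\<in>?I \<times> ?I. i_mor H ?X' c r * ((beta H X \<otimes> theta_mor H ?X') \<odot> braid H ?X' X) r (i, j))"
    by (rule mcomp_sum[OF fin]) (auto simp: i_mor_def dual_sel dest!: hmod_nz[OF X] split: if_splits)
  also have "\<dots> = (\<Sum>m\<in>?I. \<Sum>n\<in>?I. act X (S c) n m * RR (\<lambda>a b. act X (G * b) m j * act X (S a * tw) i n))"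
    using True by (simp add: sum.cartesian_product' i_mor_def dual_sel 1)
  also have "\<dots> = RR (\<lambda>a b. \<Sum>m\<in>?I. \<Sum>n\<in>?I. act X (S c) n m * (act X (G * b) m j * act X (S a * tw) i n))"
    by (simp only: ext2_multl[symmetric] ext2_sum[symmetric])
  also have "\<dots> = RR (\<lambda>a b. \<Sum>n\<in>?I. act X (S a * tw) i n * (\<Sum>m\<in>?I. act X (S c) n m * act X (G * b) m j))"
    by (subst sum.swap) (simp add: sum_distrib_left ac_simps)
  also have "\<dots> = RR (\<lambda>a b. act X (S a * tw * S c * G * b) i j)"
    by (simp add: hmod_mult[OF X] mult.assoc)
  also have "\<dots> = act X (antip_el c) i j"
    by (rule lf_antip_el[symmetric]) (rule hmod_lf0[OF X])
  finally show ?thesis using True by simp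
next
  case False
  then show ?thesis by (auto intro!: mcomp_zero simp: i_mor_def)
qed

lemma S_A_eq: "S_A H = transp antip_el"
proof -
  have hom: "transp antip_el \<in> hom (A_mod H) (A_mod H)"
  proof (rule trm_hom)
    show "lf (\<lambda>c. crd H (antip_el c) b)" for b
      by (subst lf_antip_el) (intro lin)+
    fix f c h assume f: "lf f"
    note l = lin lf_comp[OF f]
    have "Sw h (\<lambda>a d. f (S a * antip_el c * d)) = Sw h (\<lambda>a d. RR (\<lambda>p q. f (S (p * a) * tw * S c * G * (q * d))))"
      by (subst lf_antip_el[where f="\<lambda>w. f (S _ * w * _)"]) (intro l | simp add: S_mult mult.assoc)+
    also have "\<dots> = RR (\<lambda>p q. Sw h (\<lambda>a d. f (S (p * a) * tw * S c * G * (q * d))))"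
      by (rule ext2_swap)
    \<comment> \<open>The exchange rule for R places h1 beside G and h2 beside theta. Passed inwards
      by \<open>G_conj\<close> and \<open>tw_central\<close>, they combine with S(c) to S(S(h1) c
      h2).\<close>
    also have "\<dots> = RR (\<lambda>p q. Sw h (\<lambda>a d. f (S (d * p) * tw * S c * G * (a * q))))"
      by (rule R_comm) (intro l)
    also have "\<dots> = RR (\<lambda>p q. Sw h (\<lambda>a d. f (S p * tw * S (S a * c * d) * G * q)))"
    proof -
      have "S (d * p) * tw * S c * G * (a * q) = S p * tw * S (S a * c * d) * G * q" for p q a d
      proof -
        have "S (d * p) * tw * S c * G * (a * q) = S p * (S d * tw) * S c * (G * a) * q"
          by (simp add: S_mult mult.assoc)
        also have "\<dots> = S p * (tw * S d) * S c * (S (S a) * G) * q"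
          by (simp only: tw_central[of "S d"] G_conj[of a])
        finally show ?thesis by (simp add: S_mult mult.assoc)
      qed
      then show ?thesis by simp
    qed
    also have "\<dots> = Sw h (\<lambda>a d. RR (\<lambda>p q. f (S p * tw * S (S a * c * d) * G * q)))"
      by (rule ext2_swap)
    finally show "Sw h (\<lambda>a d. f (S a * antip_el c * d)) = Sw h (\<lambda>a d. f (antip_el (S a * c * d)))"
      by (simp add: lf_antip_el[OF f])
  qed
  have eq: "transp antip_el \<odot> i_mor H X =
      i_mor H (dual_mod H X) \<odot> (beta H X \<otimes> theta_mor H (dual_mod H X)) \<odot> braid H (dual_mod H X) X"
    if X: "is_hmod H X" for X :: "('k, 'h, nat) hmod"
    by (intro ext) (simp add: split_paired_all trm_i_mor[OF X] S_A_rhs[OF X])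
  show ?thesis
    unfolding S_A_def Let_def
  proof (rule the_equality, intro conjI allI impI hom eq, assumption)
    fix s assume s: "s \<in> hom (A_mod H) (A_mod H) \<and> (\<forall>X :: ('k, 'h, nat) hmod. is_hmod H X \<longrightarrow>
      s \<odot> i_mor H X = i_mor H (dual_mod H X) \<odot> (beta H X \<otimes> theta_mor H (dual_mod H X)) \<odot> braid H (dual_mod H X) X)"
    show "s = transp antip_el"
    proof (rule i_reg_epi)
      show "s \<odot> i_mor H reg = transp antip_el \<odot> i_mor H reg"
        using s reg_hmod eq[OF reg_hmod] by simp
      show "s k b = 0" if "b \<notin> B" for k b using s that by (auto simp: hom_def A_sel)
    qed (rule trm_out)
  qed
qed

section \<open>The twist forms, the coproduct and the product of A\<close>

definition theta_row :: "'h \<Rightarrow> unit \<Rightarrow> 'h \<Rightarrow> 'k" where "theta_row w = (\<lambda>_ b. crd H w b)"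

text \<open>Stated for any central element so that one computation serves both theta and its
  inverse.\<close>

lemma theta_THE: assumes w: "\<And>x. w * x = x * w"
  shows "(THE t. t \<in> hom (A_mod H) (unit_mod H) \<and>
     (\<forall>X :: ('k, 'h, nat) hmod. is_hmod H X \<longrightarrow>
        t \<odot> i_mor H X = ev X \<odot> (id_mor (dual_mod H X) \<otimes> act X w))) = theta_row w"
proof -
  have "(theta_row w \<odot> act (A_mod H) h) k b = (act (unit_mod H) h \<odot> theta_row w) k b" for h k b
  proof -
    have "(theta_row w \<odot> act (A_mod H) h) k b = (\<Sum>c\<in>B. crd H w c * act (A_mod H) h c b)"
      by (subst mcomp_sum[OF finite_B]) (auto simp: theta_row_def crd_out)
    also have "\<dots> = Sw h (\<lambda>a d. crd H (w * (S a * d)) b)"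
      unfolding sum_A_l by (simp add: w[of "S _", symmetric] mult.assoc)
    also have "\<dots> = cu h * crd H (w * 1) b"
      by (rule antip_l) (intro lin)
    finally show ?thesis by (simp add: mcomp_unit unit_sel theta_row_def)
  qed
  then have hom: "theta_row w \<in> hom (A_mod H) (unit_mod H)"
    by (auto simp: hom_def A_sel unit_sel fun_eq_iff theta_row_def crd_out)
  have eq: "theta_row w \<odot> i_mor H X = ev X \<odot> (id_mor (dual_mod H X) \<otimes> act X w)"
    if X: "is_hmod H X" for X :: "('k, 'h, nat) hmod"
  proof (intro ext, simp only: split_paired_all)
    fix k :: unit and i j :: nat
    have "(theta_row w \<odot> i_mor H X) () (i, j) = act X w i j"
      by (subst comp_i_mor) (auto simp: theta_row_def crd_out lf_expand[OF hmod_lf0[OF X]])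
    also have "\<dots> = (ev X \<odot> (id_mor (dual_mod H X) \<otimes> act X w)) () (i, j)"
      by (subst mcomp_single[of "(i, i)"])
        (auto simp: ev_def mtens_apply id_mor_def reindex_def dual_sel hmod_out[OF X] split: if_splits)
    finally show "(theta_row w \<odot> i_mor H X) k (i, j) =
      (ev X \<odot> (id_mor (dual_mod H X) \<otimes> act X w)) k (i, j)" by simp
  qed
  show ?thesis
  proof (rule the_equality, intro conjI allI impI hom eq, assumption)
    fix s assume s: "s \<in> hom (A_mod H) (unit_mod H) \<and> (\<forall>X :: ('k, 'h, nat) hmod. is_hmod H X \<longrightarrow>
      s \<odot> i_mor H X = ev X \<odot> (id_mor (dual_mod H X) \<otimes> act X w))"
    show "s = theta_row w"
    proof (rule i_reg_epi)
      show "s \<odot> i_mor H reg = theta_row w \<odot> i_mor H reg"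
        using s reg_hmod eq[OF reg_hmod] by simp
      show "s k b = 0" if "b \<notin> B" for k b using s that by (auto simp: hom_def A_sel)
    qed (simp add: theta_row_def crd_out)
  qed
qed

lemma twist_inv: "tw * twist_inv H = 1" "twist_inv H * x = x * twist_inv H"
proof -
  obtain y where y: "tw * y = 1" "y * tw = 1" using twi by (auto simp: is_twist_def)
  have eq: "twist_inv H = y"
    unfolding twist_inv_def by (rule the_equality) (use y in \<open>auto, metis mult.assoc mult_1_left mult_1_right\<close>)
  show "tw * twist_inv H = 1" by (simp add: eq y)
  have "y * x = x * y" by (metis y mult.assoc mult_1_left mult_1_right tw_central)
  then show "twist_inv H * x = x * twist_inv H" by (simp add: eq y)
qed

lemma Theta_eq: "Theta_plus H = theta_row tw" "Theta_minus H = theta_row (twist_inv H)"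
  unfolding Theta_plus_def Theta_minus_def theta_mor_def theta_inv_mor_def
  by (rule theta_THE, rule tw_central) (rule theta_THE, rule twist_inv)

text \<open>Transpose of the multiplication of H: (Delta_A f)(c \<otimes> d) = f(c d).\<close>

definition Delta_mat :: "'h \<times> 'h \<Rightarrow> 'h \<Rightarrow> 'k" where
  "Delta_mat = (\<lambda>(c, d) b. if c \<in> B \<and> d \<in> B then crd H (c * d) b else 0)"

lemma dA_out: "b \<notin> B \<Longrightarrow> Delta_mat p b = 0"
  by (auto simp: Delta_mat_def crd_out split: prod.split)

lemma A2_act: "p \<in> B \<Longrightarrow> q \<in> B \<Longrightarrow> act (tens_mod H (A_mod H) (A_mod H)) h (p, q) (b, c) =
  Sw h (\<lambda>h' h''. Sw h' (\<lambda>a1 a2. Sw h'' (\<lambda>a3 a4. crd H (S a1 * p * a2) b * crd H (S a3 * q * a4) c)))"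
  by (simp add: tens_sel A_sel, simp only: ext2_multr[symmetric], simp only: ext2_multl[symmetric])

lemma A2_out: "p \<notin> B \<times> B \<or> q \<notin> B \<times> B \<Longrightarrow> act (tens_mod H (A_mod H) (A_mod H)) h p q = 0"
  by (cases p; cases q) (auto simp: tens_sel A_out ext2_def)

lemma sum_A2: assumes F: "bil F" and "p \<in> B" "q \<in> B"
  shows "(\<Sum>b\<in>B. \<Sum>c\<in>B. act (tens_mod H (A_mod H) (A_mod H)) h (p, q) (b, c) * F b c) =
    Sw h (\<lambda>h' h''. Sw h' (\<lambda>a1 a2. Sw h'' (\<lambda>a3 a4. F (S a1 * p * a2) (S a3 * q * a4))))"
  using assms(2,3)
  by (simp add: A2_act ext2_multr[symmetric] ext2_sum[symmetric] bil_expand[OF F])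

lemma Delta_rhs: assumes X: "is_hmod H X"
  shows "((i_mor H X \<otimes> i_mor H X)
           \<odot> assoc_inv (dual_mod H X) X (tens_mod H (dual_mod H X) X)
           \<odot> (id_mor (dual_mod H X) \<otimes> assoc X (dual_mod H X) X)
           \<odot> (id_mor (dual_mod H X) \<otimes> coev X \<otimes> id_mor X)
           \<odot> (id_mor (dual_mod H X) \<otimes> lunit_inv X)) (c, d) (i, j) =
     (if c \<in> B \<and> d \<in> B then act X (c * d) i j else 0)"
proof -
  let ?X' = "dual_mod H X" let ?I = "idx X"
  let ?F0 = "id_mor ?X' \<otimes> lunit_inv X :: _ \<Rightarrow> _ \<Rightarrow> 'k"
  have fin: "finite ((?I \<times> ?I) \<times> (?I \<times> ?I))" using hmod_fin[OF X] by simp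
  have 1: "((coev X \<otimes> id_mor X) \<odot> (\<lambda>b' q. ?F0 (a, b') q)) ((k, l), j') (i, j) =
     (if a = i \<and> i \<in> ?I \<and> k = l \<and> k \<in> ?I \<and> j' = j \<and> j \<in> ?I then 1 else 0)" for a k l j'
    by (subst mcomp_single[of "((), j')"])
      (auto simp: mtens_apply coev_def id_mor_def reindex_def lunit_inv_def dual_sel split: if_splits)
  have 2: "(assoc_inv ?X' X (tens_mod H ?X' X) \<odot> (id_mor ?X' \<otimes> assoc X ?X' X)
           \<odot> (id_mor ?X' \<otimes> coev X \<otimes> id_mor X) \<odot> ?F0) ((a, k), (l, j')) (i, j) =
     (if a = i \<and> i \<in> ?I \<and> k = l \<and> k \<in> ?I \<and> j' = j \<and> j \<in> ?I then 1 else 0)" for a k l j'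
    by (auto simp: assoc_inv_comp id_tens_comp assoc_comp 1 dual_sel tens_sel)
  let ?W = "assoc_inv ?X' X (tens_mod H ?X' X) \<odot> (id_mor ?X' \<otimes> assoc X ?X' X)
           \<odot> (id_mor ?X' \<otimes> coev X \<otimes> id_mor X) \<odot> ?F0"
  have "((i_mor H X \<otimes> i_mor H X) \<odot> ?W) (c, d) (i, j) =
    (\<Sum>r\<in>(?I \<times> ?I) \<times> (?I \<times> ?I). (i_mor H X \<otimes> i_mor H X) (c, d) r * ?W r (i, j))"
    by (rule mcomp_sum[OF fin]) (auto simp: 2 split: if_splits)
  also have "\<dots> = (\<Sum>a\<in>?I. \<Sum>k\<in>?I. \<Sum>l\<in>?I. \<Sum>j'\<in>?I. 
     if j' = j then if l = k then if a = i then i_mor H X c (a, k) * i_mor H X d (l, j') else 0 else 0 else 0)"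
    unfolding sum.cartesian_product' 2
    by (intro sum.cong refl) (auto simp: mtens_apply)
  also have "\<dots> = (\<Sum>a\<in>?I. \<Sum>k\<in>?I. if a = i then i_mor H X c (a, k) * i_mor H X d (k, j) else 0)"
  proof (cases "j \<in> ?I")
    case True
    then show ?thesis using hmod_fin[OF X] by (auto intro!: sum.cong)
  next
    case False
    then show ?thesis using hmod_fin[OF X]
      by (subst (1 2) sum.neutral) (auto simp: i_mor_out[OF X] intro!: sum.neutral)
  qed
  also have "\<dots> = (\<Sum>k\<in>?I. i_mor H X c (i, k) * i_mor H X d (k, j))"
    using hmod_fin[OF X] by (subst sum.swap, cases "i \<in> ?I") (auto simp: i_mor_out[OF X])
  also have "\<dots> = (if c \<in> B \<and> d \<in> B then act X (c * d) i j else 0)"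
    by (auto simp: i_mor_def hmod_mult[OF X])
  finally show ?thesis .
qed

lemma Delta_A_eq: "Delta_A H = Delta_mat"
proof -
  have fin2: "finite (B \<times> B)" using finite_B by simp
  have "(Delta_mat \<odot> act (A_mod H) h) (c, d) b = (act (tens_mod H (A_mod H) (A_mod H)) h \<odot> Delta_mat) (c, d) b" for h c d b
  proof (cases "c \<in> B \<and> d \<in> B")
    case True
    have "(Delta_mat \<odot> act (A_mod H) h) (c, d) b = (\<Sum>b'\<in>B. Delta_mat (c, d) b' * act (A_mod H) h b' b)"
      by (rule mcomp_sum[OF finite_B]) (simp add: dA_out)
    also have "\<dots> = Sw h (\<lambda>a k. crd H (S a * (c * d) * k) b)"
      using True by (simp add: Delta_mat_def sum_A_l)
    \<comment> \<open>Inserting the trivial factor h2 S(h3) between c and d splits the adjoint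
      action on c d into actions on c and on d.\<close>
    also have "\<dots> = Sw h (\<lambda>a1 m. Sw m (\<lambda>a2 k. Sw k (\<lambda>a3 a4. crd H (S a1 * c * (a2 * S a3) * d * a4) b)))"
      by (subst cancel_Sr1[where F="\<lambda>w a4. crd H (S _ * c * w * d * a4) b"]) (intro lin | simp add: mult.assoc)+
    also have "\<dots> = Sw h (\<lambda>h' h''. Sw h' (\<lambda>a1 a2. Sw h'' (\<lambda>a3 a4. crd H (S a1 * c * (a2 * S a3) * d * a4) b)))"
      by (rule coassoc[symmetric]) (intro lin)
    also have "\<dots> = (\<Sum>p\<in>B. \<Sum>q\<in>B. act (tens_mod H (A_mod H) (A_mod H)) h (c, d) (p, q) * crd H (p * q) b)"
      using True by (subst sum_A2) (intro lin | simp add: mult.assoc)+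
    also have "\<dots> = (\<Sum>r\<in>B \<times> B. act (tens_mod H (A_mod H) (A_mod H)) h (c, d) r * Delta_mat r b)"
      by (simp add: sum.cartesian_product' Delta_mat_def)
    also have "\<dots> = (act (tens_mod H (A_mod H) (A_mod H)) h \<odot> Delta_mat) (c, d) b"
      by (rule mcomp_sum[OF fin2, symmetric]) (simp add: A2_out)
    finally show ?thesis .
  next
    case False
    then have "(Delta_mat \<odot> act (A_mod H) h) (c, d) b = 0" "(act (tens_mod H (A_mod H) (A_mod H)) h \<odot> Delta_mat) (c, d) b = 0"
      by (auto intro!: mcomp_zero simp: Delta_mat_def A2_out)
    then show ?thesis by simp
  qed
  then have hom: "Delta_mat \<in> hom (A_mod H) (tens_mod H (A_mod H) (A_mod H))"
    by (auto simp: hom_def A_sel(1) tens_sel(1) fun_eq_iff Delta_mat_def crd_out)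
  have eq: "Delta_mat \<odot> i_mor H X = (i_mor H X \<otimes> i_mor H X)
           \<odot> assoc_inv (dual_mod H X) X (tens_mod H (dual_mod H X) X)
           \<odot> (id_mor (dual_mod H X) \<otimes> assoc X (dual_mod H X) X)
           \<odot> (id_mor (dual_mod H X) \<otimes> coev X \<otimes> id_mor X)
           \<odot> (id_mor (dual_mod H X) \<otimes> lunit_inv X)"
    if X: "is_hmod H X" for X :: "('k, 'h, nat) hmod"
  proof (intro ext, simp only: split_paired_all Delta_rhs[OF X])
    fix c d :: 'h and i j :: nat
    show "(Delta_mat \<odot> i_mor H X) (c, d) (i, j) = (if c \<in> B \<and> d \<in> B then act X (c * d) i j else 0)"
      by (subst comp_i_mor) (auto simp: crd_out Delta_mat_def lf_expand[OF hmod_lf0[OF X]])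
  qed
  show ?thesis
    unfolding Delta_A_def Let_def
  proof (rule the_equality, intro conjI allI impI hom eq, assumption)
    fix s assume s: "s \<in> hom (A_mod H) (tens_mod H (A_mod H) (A_mod H)) \<and>
      (\<forall>X :: ('k, 'h, nat) hmod. is_hmod H X \<longrightarrow> s \<odot> i_mor H X = (i_mor H X \<otimes> i_mor H X)
           \<odot> assoc_inv (dual_mod H X) X (tens_mod H (dual_mod H X) X)
           \<odot> (id_mor (dual_mod H X) \<otimes> assoc X (dual_mod H X) X)
           \<odot> (id_mor (dual_mod H X) \<otimes> coev X \<otimes> id_mor X)
           \<odot> (id_mor (dual_mod H X) \<otimes> lunit_inv X))"
    show "s = Delta_mat"
    proof (rule i_reg_epi)
      show "s \<odot> i_mor H reg = Delta_mat \<odot> i_mor H reg"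
        using s reg_hmod eq[OF reg_hmod] by simp
      show "s k b = 0" if "b \<notin> B" for k b using s that by (cases k) (auto simp: hom_def A_sel)
    qed (rule dA_out)
  qed
qed

text \<open>Transpose of the product: m_A(f \<otimes> g)(c) = f(c2 a) g(S(b1) c1 b2). The braiding
  of X past Y* \<otimes> Y lets a act on X and b on Y* \<otimes> Y, hence the adjoint action of
  b.\<close>

definition mult_ext :: "'h \<Rightarrow> ('h \<Rightarrow> 'h \<Rightarrow> 'k) \<Rightarrow> 'k" where
  "mult_ext c F = Sw c (\<lambda>c1 c2. RR (\<lambda>a b. Sw b (\<lambda>b1 b2. F (c2 * a) (S b1 * c1 * b2))))"

lemma lf_mu: "lh g \<Longrightarrow> lf (\<lambda>c. mult_ext (g c) F)"
  unfolding mult_ext_def by (intro lin)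

lemma mu_sum: "mult_ext c (\<lambda>x y. \<Sum>i\<in>I. F i x y) = (\<Sum>i\<in>I. mult_ext c (F i))"
  by (simp add: mult_ext_def ext2_sum)

lemma mu_multr: "mult_ext c (\<lambda>x y. F x y * k) = mult_ext c F * k"
  by (simp add: mult_ext_def ext2_multr)

definition mult_mat :: "'h \<Rightarrow> 'h \<times> 'h \<Rightarrow> 'k" where
  "mult_mat c = (\<lambda>(p, q). if c \<in> B then mult_ext c (\<lambda>x y. crd H x p * crd H y q) else 0)"

lemma mA_out: "p \<notin> B \<times> B \<Longrightarrow> mult_mat c p = 0"
  by (cases p) (auto simp: mult_mat_def mult_ext_def crd_out ext2_def)

lemma sum_mA: assumes F: "bil F" and c: "c \<in> B"
  shows "(\<Sum>p\<in>B. \<Sum>q\<in>B. mult_mat c (p, q) * F p q) = mult_ext c F"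
  using c by (simp add: mult_mat_def mu_multr[symmetric] mu_sum[symmetric] bil_expand[OF F])

text \<open>The one substantial step is \<open>R_comm\<close>, exchanging the components of h that
  stand beside a and b. The rest expands and reorders Sweedler sums.\<close>

lemma mu_equivariant: assumes F: "bil F"
  shows "mult_ext c (\<lambda>x y. Sw h (\<lambda>h' h''. Sw h' (\<lambda>k1 k2. Sw h'' (\<lambda>k3 k4. F (S k1 * x * k2) (S k3 * y * k4))))) =
    Sw h (\<lambda>a d. mult_ext (S a * c * d) F)"
proof -
  note l = lin bil1[OF F] bil2[OF F]
  \<comment> \<open>Common normal form of both sides; its arguments are to be the four coproduct
    components of h in their order.\<close>
  define Y where "Y = (\<lambda>k1 e e' k3. Sw c (\<lambda>c1 c2. RR (\<lambda>a b. Sw b (\<lambda>b1 b2.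
    F (S k1 * c2 * k3 * a) (S b1 * (S e * c1 * e') * b2)))))"
  have Yl: "lf (\<lambda>x. Y (g x) e e' k3)" "lf (\<lambda>x. Y k1 (g x) e' k3)" "lf (\<lambda>x. Y k1 e (g x) k3)" "lf (\<lambda>x. Y k1 e e' (g x))"
    if g: "lh g" for g k1 e e' k3
    unfolding Y_def by (intro l g)+
  have swA: "ext2 H t (\<lambda>a b. Sw h (\<lambda>k1 m. Sw m (\<lambda>k2 k3. Q a b k1 k2 k3))) =
      Sw h (\<lambda>k1 m. Sw m (\<lambda>k2 k3. ext2 H t (\<lambda>a b. Q a b k1 k2 k3)))" for t Q
    by (subst ext2_swap, subst (2) ext2_swap) (rule refl)
  have swB: "ext2 H t (\<lambda>a b. Sw m (\<lambda>k2 k3. Sw k2 (\<lambda>e e'. Q a b k3 e e'))) =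
      Sw m (\<lambda>k2 k3. Sw k2 (\<lambda>e e'. ext2 H t (\<lambda>a b. Q a b k3 e e')))" for t m Q
    by (subst ext2_swap, subst (2) ext2_swap) (rule refl)
  have "mult_ext c (\<lambda>x y. Sw h (\<lambda>h' h''. Sw h' (\<lambda>k1 k2. Sw h'' (\<lambda>k3 k4. F (S k1 * x * k2) (S k3 * y * k4))))) =
    mult_ext c (\<lambda>x y. Sw h (\<lambda>k1 m. Sw m (\<lambda>k2 h''. Sw h'' (\<lambda>k3 k4. F (S k1 * x * k2) (S k3 * y * k4)))))"
    by (subst coassoc[where F="\<lambda>k1 k2 h''. Sw h'' (\<lambda>k3 k4. F (S k1 * _ * k2) (S k3 * _ * k4))"])
      (intro l refl)+
  also have "\<dots> = Sw c (\<lambda>c1 c2. RR (\<lambda>a b. Sw h (\<lambda>k1 m. Sw m (\<lambda>k2 h''. Sw b (\<lambda>b1 b2. Sw h'' (\<lambda>k3 k4.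
      F (S k1 * c2 * (a * k2)) (S (b1 * k3) * c1 * (b2 * k4))))))))"
    unfolding mult_ext_def by (simp only: swA S_mult mult.assoc)
  also have "\<dots> = Sw c (\<lambda>c1 c2. RR (\<lambda>a b. Sw h (\<lambda>k1 m. Sw m (\<lambda>k2 h''. Sw (b * h'') (\<lambda>v w.
      F (S k1 * c2 * (a * k2)) (S v * c1 * w))))))"
    by (subst Sw_mult) (intro l refl)+
  also have "\<dots> = Sw c (\<lambda>c1 c2. Sw h (\<lambda>k1 m. RR (\<lambda>a b. Sw m (\<lambda>k2 h''. Sw (b * h'') (\<lambda>v w.
      F (S k1 * c2 * (a * k2)) (S v * c1 * w))))))"
    by (subst (2) ext2_swap) (rule refl)
  also have "\<dots> = Sw c (\<lambda>c1 c2. Sw h (\<lambda>k1 m. RR (\<lambda>a b. Sw m (\<lambda>k2 k3. Sw (k2 * b) (\<lambda>v w.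
      F (S k1 * c2 * (k3 * a)) (S v * c1 * w))))))"
    by (subst R_comm[where F="\<lambda>x y. Sw y (\<lambda>v w. F (S _ * _ * x) (S v * _ * w))"]) (intro l refl)+
  also have "\<dots> = Sw c (\<lambda>c1 c2. Sw h (\<lambda>k1 m. RR (\<lambda>a b. Sw m (\<lambda>k2 k3. Sw k2 (\<lambda>e e'. Sw b (\<lambda>b1 b2.
      F (S k1 * c2 * k3 * a) (S b1 * (S e * c1 * e') * b2)))))))"
    by (subst Sw_mult) (intro l | simp add: S_mult mult.assoc)+
  also have "\<dots> = Sw h (\<lambda>k1 m. Sw m (\<lambda>k2 k3. Sw k2 (\<lambda>e e'. Y k1 e e' k3)))"
    unfolding Y_def by (subst ext2_swap) (simp only: swB[of "Rmat H"] swB[of "cop H c"])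
  finally have 1: "mult_ext c (\<lambda>x y. Sw h (\<lambda>h' h''. Sw h' (\<lambda>k1 k2. Sw h'' (\<lambda>k3 k4. F (S k1 * x * k2) (S k3 * y * k4))))) =
    Sw h (\<lambda>k1 m. Sw m (\<lambda>k2 k3. Sw k2 (\<lambda>e e'. Y k1 e e' k3)))" .
  have 2: "mult_ext (S g * c * d) F = Sw g (\<lambda>g1 g2. Sw d (\<lambda>d1 d2. Y g1 g2 d1 d2))" for g d
  proof -
    have "mult_ext (S g * c * d) F = Sw g (\<lambda>g1 g2. Sw c (\<lambda>c1 c2. Sw d (\<lambda>d1 d2. RR (\<lambda>a b. Sw b (\<lambda>b1 b2.
      F (S g1 * c2 * d2 * a) (S b1 * (S g2 * c1 * d1) * b2))))))"
      unfolding mult_ext_def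
      by (subst Sw_mult, intro l, subst Sw_mult, intro l, subst Sw_S, intro l) (rule refl)
    also have "\<dots> = Sw g (\<lambda>g1 g2. Sw d (\<lambda>d1 d2. Y g1 g2 d1 d2))"
      unfolding Y_def by (subst (2) ext2_swap) (rule refl)
    finally show ?thesis .
  qed
  have "Sw h (\<lambda>a d. mult_ext (S a * c * d) F) = Sw h (\<lambda>g d. Sw g (\<lambda>g1 g2. Sw d (\<lambda>d1 d2. Y g1 g2 d1 d2)))"
    by (simp only: 2)
  also have "\<dots> = Sw h (\<lambda>g1 m. Sw m (\<lambda>g2 d. Sw d (\<lambda>d1 d2. Y g1 g2 d1 d2)))"
    by (rule coassoc) (intro l Yl)
  also have "\<dots> = Sw h (\<lambda>g1 m. Sw m (\<lambda>k2 k3. Sw k2 (\<lambda>e e'. Y g1 e e' k3)))"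
    by (subst coassoc[where F="\<lambda>a b c. Y _ a b c"]) (intro l Yl refl)+
  finally show ?thesis using 1 by simp
qed

lemma i_tens_out: assumes M: "is_hmod H M" and N: "is_hmod H N"
    and r: "r \<notin> (idx M \<times> idx N) \<times> (idx M \<times> idx N)"
  shows "i_mor H (tens_mod H M N) c r = 0"
proof -
  obtain a b a' b' where "r = ((a, b), (a', b'))" by (metis surj_pair)
  with r show ?thesis
    by (auto simp: i_mor_def tens_sel hmod_out[OF M] hmod_out[OF N] ext2_def)
qed

lemma m_rhs: assumes X: "is_hmod H X" and Y: "is_hmod H Y"
  shows "(i_mor H (tens_mod H Y X)
           \<odot> (gamma X Y \<otimes> id_mor (tens_mod H Y X))
           \<odot> assoc_inv (dual_mod H X) (dual_mod H Y) (tens_mod H Y X)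
           \<odot> (id_mor (dual_mod H X) \<otimes> assoc (dual_mod H Y) Y X)
           \<odot> (id_mor (dual_mod H X) \<otimes> braid H X (tens_mod H (dual_mod H Y) Y))
           \<odot> assoc (dual_mod H X) X (tens_mod H (dual_mod H Y) Y)) c ((i, j), (k, l)) =
    (if c \<in> B then mult_ext c (\<lambda>x y. act X x i j * act Y y k l) else 0)"
proof -
  let ?X' = "dual_mod H X" let ?Y' = "dual_mod H Y" let ?I = "idx X" let ?J = "idx Y"
  let ?YY = "tens_mod H ?Y' Y" let ?YX = "tens_mod H Y X"
  let ?q = "((i, j), (k, l))"
  have fin: "finite ?I" "finite ?J" "finite ((?J \<times> ?I) \<times> (?J \<times> ?I))"
    using hmod_fin[OF X] hmod_fin[OF Y] by auto
  \<comment> \<open>Off these index ranges both sides must vanish: the left through the support of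
    the structural matrices, the right through the default value 0 of module entries.\<close>
  define ok where "ok \<longleftrightarrow> i \<in> ?I \<and> j \<in> ?I \<and> k \<in> ?J \<and> l \<in> ?J"
  define W where "W = (assoc_inv ?X' ?Y' ?YX \<odot> (id_mor ?X' \<otimes> assoc ?Y' Y X)
     \<odot> (id_mor ?X' \<otimes> braid H X ?YY) \<odot> assoc ?X' X ?YY)"
  have 1: "(braid H X ?YY \<odot> (\<lambda>b' q. assoc ?X' X ?YY (a, b') q)) ((k', l'), j') ?q =
    (if a = i \<and> ok then braid H X ?YY ((k', l'), j') (j, (k, l)) else 0)" for a k' l' j'
    by (subst mcomp_single[of "(j, (k, l))"])
      (auto simp: assoc_def reindex_def dual_sel tens_sel ok_def split: if_splits)
  have 2: "W ((a, k'), (l', j')) ?q =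
     (if a \<in> ?I \<and> k' \<in> ?J \<and> l' \<in> ?J \<and> j' \<in> ?I \<and> a = i \<and> ok then braid H X ?YY ((k', l'), j') (j, (k, l)) else 0)"
    for a k' l' j'
    unfolding W_def by (auto simp: assoc_inv_comp id_tens_comp assoc_comp 1 dual_sel tens_sel)
  have br: "braid H X ?YY ((k', l'), j') (j, (k, l)) =
     RR (\<lambda>a b. Sw b (\<lambda>b1 b2. act Y (S b1) k k' * act Y b2 l' l) * act X a j' j)" for k' l' j'
    by (simp add: braid_def tens_sel dual_sel)
  have "(i_mor H ?YX \<odot> (gamma X Y \<otimes> id_mor ?YX) \<odot> W) c ?q =
    (\<Sum>r\<in>(?J \<times> ?I) \<times> (?J \<times> ?I). i_mor H ?YX c r * ((gamma X Y \<otimes> id_mor ?YX) \<odot> W) r ?q)"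
    by (rule mcomp_sum[OF fin(3)]) (simp add: i_tens_out[OF Y X])
  also have "\<dots> = (\<Sum>k'\<in>?J. \<Sum>a\<in>?I. \<Sum>l'\<in>?J. \<Sum>j'\<in>?I. i_mor H ?YX c ((k', a), (l', j')) * W ((a, k'), (l', j')) ?q)"
    unfolding sum.cartesian_product'
    by (intro sum.cong refl arg_cong2[where f="(*)"] gamma_id_comp) (auto simp: tens_sel)
  also have "\<dots> = (\<Sum>k'\<in>?J. \<Sum>a\<in>?I. if a = i then (\<Sum>l'\<in>?J. \<Sum>j'\<in>?I.
     (if c \<in> B \<and> ok then Sw c (\<lambda>c1 c2. act Y c1 k' l' * act X c2 i j') *
       RR (\<lambda>a b. Sw b (\<lambda>b1 b2. act Y (S b1) k k' * act Y b2 l' l) * act X a j' j) else 0)) else 0)"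
    by (intro sum.cong refl) (auto simp: 2 br i_mor_def tens_sel intro!: sum.cong sum.neutral)
  also have "\<dots> = (\<Sum>k'\<in>?J. \<Sum>l'\<in>?J. \<Sum>j'\<in>?I.
     (if c \<in> B \<and> ok then Sw c (\<lambda>c1 c2. act Y c1 k' l' * act X c2 i j') *
       RR (\<lambda>a b. Sw b (\<lambda>b1 b2. act Y (S b1) k k' * act Y b2 l' l) * act X a j' j) else 0))"
    using fin by (cases "i \<in> ?I") (auto simp: ok_def)
  also have "\<dots> = (if c \<in> B then mult_ext c (\<lambda>x y. act X x i j * act Y y k l) else 0)"
  proof (cases "c \<in> B \<and> ok")
    case True
    have "(\<Sum>k'\<in>?J. \<Sum>l'\<in>?J. \<Sum>j'\<in>?I. Sw c (\<lambda>c1 c2. act Y c1 k' l' * act X c2 i j') *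
       RR (\<lambda>a b. Sw b (\<lambda>b1 b2. act Y (S b1) k k' * act Y b2 l' l) * act X a j' j)) =
      (\<Sum>k'\<in>?J. \<Sum>l'\<in>?J. \<Sum>j'\<in>?I. Sw c (\<lambda>c1 c2. RR (\<lambda>a b. Sw b (\<lambda>b1 b2. 
        (act Y c1 k' l' * act X c2 i j') * ((act Y (S b1) k k' * act Y b2 l' l) * act X a j' j)))))"
      by (simp only: ext2_multr[symmetric]) (simp only: ext2_multl[symmetric])
    also have "\<dots> = Sw c (\<lambda>c1 c2. RR (\<lambda>a b. Sw b (\<lambda>b1 b2. \<Sum>k'\<in>?J. \<Sum>l'\<in>?J. \<Sum>j'\<in>?I. 
        (act Y c1 k' l' * act X c2 i j') * ((act Y (S b1) k k' * act Y b2 l' l) * act X a j' j))))"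
      by (simp only: ext2_sum[symmetric])
    also have "\<dots> = mult_ext c (\<lambda>x y. act X x i j * act Y y k l)"
      unfolding mult_ext_def sum3_factor
      by (simp add: hmod_mult[OF X] hmod_mult[OF Y] mult.assoc)
    finally show ?thesis using True by simp
  next
    case False
    then have "mult_ext c (\<lambda>x y. act X x i j * act Y y k l) = 0" if "c \<in> B"
      using that by (auto simp: ok_def mult_ext_def hmod_out[OF X] hmod_out[OF Y] ext2_def)
    then show ?thesis using False by auto
  qed
  finally show ?thesis unfolding W_def .
qed

lemma m_A_eq: "m_A H = mult_mat"
proof -
  let ?A = "A_mod H" let ?AA = "tens_mod H ?A ?A"
  have fin2: "finite (B \<times> B)" using finite_B by simp
  have "(mult_mat \<odot> act ?AA h) c (p, q) = (act ?A h \<odot> mult_mat) c (p, q)" for h c p q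
  proof (cases "c \<in> B")
    case True
    define K where "K = (\<lambda>x y. Sw h (\<lambda>h' h''. Sw h' (\<lambda>k1 k2. Sw h'' (\<lambda>k3 k4.
      crd H (S k1 * x * k2) p * crd H (S k3 * y * k4) q))))"
    have K: "bil K" unfolding K_def by (intro lin)
    have "(mult_mat \<odot> act ?AA h) c (p, q) = (\<Sum>r\<in>B \<times> B. mult_mat c r * act ?AA h r (p, q))"
      by (rule mcomp_sum[OF fin2]) (simp add: mA_out)
    also have "\<dots> = (\<Sum>p'\<in>B. \<Sum>q'\<in>B. mult_mat c (p', q') * K p' q')"
      unfolding sum.cartesian_product' by (intro sum.cong refl) (simp add: A2_act K_def)
    also have "\<dots> = mult_ext c K" by (rule sum_mA[OF K True])
    also have "\<dots> = Sw h (\<lambda>a d. mult_ext (S a * c * d) (\<lambda>x y. crd H x p * crd H y q))"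
      unfolding K_def by (rule mu_equivariant) (intro lin)
    also have "\<dots> = (\<Sum>b\<in>B. act ?A h c b * mult_ext b (\<lambda>x y. crd H x p * crd H y q))"
      by (rule sum_A[OF _ True, symmetric]) (intro lf_mu lin)
    also have "\<dots> = (\<Sum>b\<in>B. act ?A h c b * mult_mat b (p, q))"
      by (simp add: mult_mat_def)
    also have "\<dots> = (act ?A h \<odot> mult_mat) c (p, q)"
      by (rule mcomp_sum[OF finite_B, symmetric]) (simp add: A_out)
    finally show ?thesis .
  next
    case False
    then have "(mult_mat \<odot> act ?AA h) c (p, q) = 0" "(act ?A h \<odot> mult_mat) c (p, q) = 0"
      by (auto intro!: mcomp_zero simp: mult_mat_def A_out)
    then show ?thesis by simp
  qed
  then have hom: "mult_mat \<in> hom ?AA ?A"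
    using mA_out by (auto simp: hom_def A_sel(1) tens_sel(1) fun_eq_iff) (auto simp: mult_mat_def)
  have eq: "mult_mat \<odot> (i_mor H X \<otimes> i_mor H Y) = i_mor H (tens_mod H Y X)
           \<odot> (gamma X Y \<otimes> id_mor (tens_mod H Y X))
           \<odot> assoc_inv (dual_mod H X) (dual_mod H Y) (tens_mod H Y X)
           \<odot> (id_mor (dual_mod H X) \<otimes> assoc (dual_mod H Y) Y X)
           \<odot> (id_mor (dual_mod H X) \<otimes> braid H X (tens_mod H (dual_mod H Y) Y))
           \<odot> assoc (dual_mod H X) X (tens_mod H (dual_mod H Y) Y)"
    if X: "is_hmod H X" and Y: "is_hmod H Y" for X Y :: "('k, 'h, nat) hmod"
  proof (intro ext, simp only: split_paired_all m_rhs[OF X Y])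
    fix c :: 'h and i j k l :: nat
    have "bil (\<lambda>x y. act X x i j * act Y y k l)"
      by (intro lin hmod_lf[OF X] hmod_lf[OF Y])
    then show "(mult_mat \<odot> (i_mor H X \<otimes> i_mor H Y)) c ((i, j), (k, l)) =
      (if c \<in> B then mult_ext c (\<lambda>x y. act X x i j * act Y y k l) else 0)"
      by (subst comp_i_mor2) (auto simp: mA_out sum_mA, auto simp: mult_mat_def)
  qed
  show ?thesis
    unfolding m_A_def Let_def
  proof (rule the_equality, intro conjI allI impI hom eq, assumption, assumption)
    fix s assume s: "s \<in> hom ?AA ?A \<and> (\<forall>(X :: ('k, 'h, nat) hmod) (Y :: ('k, 'h, nat) hmod).
      is_hmod H X \<longrightarrow> is_hmod H Y \<longrightarrow> s \<odot> (i_mor H X \<otimes> i_mor H Y) = i_mor H (tens_mod H Y X)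
           \<odot> (gamma X Y \<otimes> id_mor (tens_mod H Y X))
           \<odot> assoc_inv (dual_mod H X) (dual_mod H Y) (tens_mod H Y X)
           \<odot> (id_mor (dual_mod H X) \<otimes> assoc (dual_mod H Y) Y X)
           \<odot> (id_mor (dual_mod H X) \<otimes> braid H X (tens_mod H (dual_mod H Y) Y))
           \<odot> assoc (dual_mod H X) X (tens_mod H (dual_mod H Y) Y))"
    show "s = mult_mat"
    proof (rule i_reg_epi2)
      show "s \<odot> (i_mor H reg \<otimes> i_mor H reg) = mult_mat \<odot> (i_mor H reg \<otimes> i_mor H reg)"
        using s reg_hmod eq[OF reg_hmod reg_hmod] by simp
      show "s k p = 0" if "p \<notin> B \<times> B" for k p
        using s that by (cases p) (auto simp: hom_def A_sel(1) tens_sel(1))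
    qed (rule mA_out)
  qed
qed

lemma Gamma_l_eq: "Gamma_l H (x, y) (p, q) =
  (if x \<in> B \<and> y \<in> B \<and> q \<in> B then mult_ext y (\<lambda>v w. crd H (x * v) p * crd H w q) else 0)"
proof -
  let ?A = "A_mod H"
  have fin2: "finite (B \<times> B)" using finite_B by simp
  have 1: "(assoc ?A ?A ?A \<odot> (Delta_mat \<otimes> id_mor ?A)) (x, (b, c)) (p, q) =
    (if x \<in> B \<and> b \<in> B \<and> c \<in> B \<and> c = q then crd H (x * b) p else 0)" for b c
    by (auto simp: assoc_comp A_sel(1) mtens_apply Delta_mat_def id_mor_def reindex_def)
  have "Gamma_l H (x, y) (p, q) = (if x \<in> B then
     (mult_mat \<odot> (\<lambda>b' q'. (assoc ?A ?A ?A \<odot> (Delta_mat \<otimes> id_mor ?A)) (x, b') q')) y (p, q) else 0)"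
    unfolding Gamma_l_def Delta_A_eq m_A_eq by (simp add: id_tens_comp A_sel(1))
  also have "\<dots> = (if x \<in> B then (\<Sum>r\<in>B \<times> B. mult_mat y r * (assoc ?A ?A ?A \<odot> (Delta_mat \<otimes> id_mor ?A)) (x, r) (p, q)) else 0)"
    by (subst mcomp_sum[OF fin2]) (auto simp: mA_out)
  also have "\<dots> = (if x \<in> B then (\<Sum>b\<in>B. \<Sum>c\<in>B. mult_mat y (b, c) * (if q \<in> B then crd H (x * b) p * crd H c q else 0)) else 0)"
    unfolding sum.cartesian_product' 1
    by (intro if_cong refl sum.cong) (auto simp: crd_basis)
  also have "\<dots> = (if x \<in> B \<and> y \<in> B \<and> q \<in> B then mult_ext y (\<lambda>v w. crd H (x * v) p * crd H w q) else 0)"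
  proof (cases "y \<in> B \<and> q \<in> B")
    case True
    have "bil (\<lambda>v w. crd H (x * v) p * crd H w q)" by (intro lin)
    from sum_mA[OF this, of y] True show ?thesis by simp
  next
    case False
    then show ?thesis by (auto simp: mult_mat_def)
  qed
  finally show ?thesis .
qed

section \<open>Morphisms from A and from A \<otimes> A to the unit\<close>

lemma central_iff: "(\<forall>h b. Sw h (\<lambda>a d. crd H (S a * w * d) b) = cu h * crd H w b) \<longleftrightarrow> w \<in> Z_center H"
proof
  assume c: "\<forall>h b. Sw h (\<lambda>a d. crd H (S a * w * d) b) = cu h * crd H w b"
  have ad: "Sw h (\<lambda>a d. f (S a * w * d)) = cu h * f w" if f: "lf f" for f h
  proof -
    have "Sw h (\<lambda>a d. f (S a * w * d)) = Sw h (\<lambda>a d. \<Sum>b\<in>B. f b * crd H (S a * w * d) b)"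
      by (simp add: lf_expand'[OF f])
    also have "\<dots> = cu h * (\<Sum>b\<in>B. f b * crd H w b)"
      by (simp add: ext2_sum ext2_multl c sum_distrib_left mult.left_commute)
    finally show ?thesis by (simp add: lf_expand'[OF f])
  qed
  have "w * h = h * w" for h
  proof (rule heqI)
    fix f assume f: "lf f"
    note l = lin lf_comp[OF f]
    \<comment> \<open>Write w h = h1 S(h2) w h3; invariance of w then collapses S(h2) w h3.\<close>
    have "f (1 * w * h) = Sw h (\<lambda>a y. Sw y (\<lambda>b c. f (a * S b * w * c)))"
      by (rule cancel_Sr1[where F="\<lambda>v c. f (v * w * c)", symmetric]) (intro l)
    also have "\<dots> = Sw h (\<lambda>a y. cu y * f (a * w))"
      by (subst ad[where f="\<lambda>v. f (_ * v)", symmetric]) (intro l | simp add: mult.assoc)+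
    also have "\<dots> = f (h * w)" by (rule counit_r') (intro l)
    finally show "f (w * h) = f (h * w)" by simp
  qed
  then show "w \<in> Z_center H" by (simp add: Z_center_def)
next
  assume w: "w \<in> Z_center H"
  show "\<forall>h b. Sw h (\<lambda>a d. crd H (S a * w * d) b) = cu h * crd H w b"
  proof (intro allI)
    fix h b
    have "Sw h (\<lambda>a d. crd H (S a * w * d) b) = Sw h (\<lambda>a d. crd H (w * (S a * d)) b)"
      using w by (simp add: Z_center_def mult.assoc[symmetric])
    also have "\<dots> = cu h * crd H (w * 1) b" by (rule antip_l) (intro lin)
    finally show "Sw h (\<lambda>a d. crd H (S a * w * d) b) = cu h * crd H w b" by simp
  qed
qed

lemma hom_A_unit: "g \<in> hom (A_mod H) (unit_mod H) \<longleftrightarrow> (\<exists>w \<in> Z_center H. g = theta_row w)"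
proof
  assume g: "g \<in> hom (A_mod H) (unit_mod H)"
  define w where "w = (\<Sum>c\<in>B. sc (g () c) c)"
  have w: "crd H w b = g () b" for b
    using g by (cases "b \<in> B") (auto simp: w_def crd_comb crd_out hom_def A_sel)
  have gw: "g = theta_row w" by (auto simp: theta_row_def w fun_eq_iff)
  have "Sw h (\<lambda>a d. crd H (S a * w * d) b) = cu h * crd H w b" for h b
  proof -
    have "(g \<odot> act (A_mod H) h) () b = (\<Sum>c\<in>B. crd H w c * act (A_mod H) h c b)"
      by (subst mcomp_sum[OF finite_B]) (auto simp: w[symmetric] crd_out)
    moreover have "(act (unit_mod H) h \<odot> g) () b = cu h * crd H w b"
      by (simp add: mcomp_unit unit_sel w)
    ultimately show ?thesis using g by (simp add: hom_def sum_A_l)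
  qed
  then have "w \<in> Z_center H" using central_iff by blast
  with gw show "\<exists>w \<in> Z_center H. g = theta_row w" by blast
next
  assume "\<exists>w \<in> Z_center H. g = theta_row w"
  then obtain w where w: "w \<in> Z_center H" and g: "g = theta_row w" by blast
  have "(theta_row w \<odot> act (A_mod H) h) k b = (act (unit_mod H) h \<odot> theta_row w) k b" for h k b
  proof -
    have "(theta_row w \<odot> act (A_mod H) h) k b = (\<Sum>c\<in>B. crd H w c * act (A_mod H) h c b)"
      by (subst mcomp_sum[OF finite_B]) (auto simp: theta_row_def crd_out)
    also have "\<dots> = cu h * crd H w b"
      unfolding sum_A_l using central_iff w by blast
    finally show ?thesis by (simp add: mcomp_unit unit_sel theta_row_def)
  qed
  then show "g \<in> hom (A_mod H) (unit_mod H)"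
    unfolding g by (auto simp: hom_def A_sel unit_sel fun_eq_iff theta_row_def crd_out)
qed

text \<open>The single row of such a matrix is already the coordinate family of a tensor in H
  \<otimes> H, and the action on A \<otimes> A has the same Sweedler expression as
  \<open>tri2\<close>.\<close>

lemma hom_A2_unit: "g \<in> hom (tens_mod H (A_mod H) (A_mod H)) (unit_mod H) \<longleftrightarrow> g () \<in> V2_set H"
proof -
  let ?AA = "tens_mod H (A_mod H) (A_mod H)"
  have fin2: "finite (B \<times> B)" using finite_B by simp
  have t: "(\<forall>j i. j \<notin> idx (unit_mod H) \<or> i \<notin> idx ?AA \<longrightarrow> g j i = 0) \<longleftrightarrow> g () \<in> tensor2 H"
    by (auto simp: unit_sel tens_sel(1) A_sel(1) tensor2_def)
  have "g \<odot> act ?AA h = act (unit_mod H) h \<odot> g \<longleftrightarrow> tri2 H (g ()) h = (\<lambda>p. cu h * g () p)"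
    if gt: "g () \<in> tensor2 H" for h
  proof -
    have "(g \<odot> act ?AA h) () p = tri2 H (g ()) h p" for p
    proof (cases p)
      case (Pair b c)
      have "(g \<odot> act ?AA h) () (b, c) = (\<Sum>r\<in>B \<times> B. g () r * act ?AA h r (b, c))"
        by (rule mcomp_sum[OF fin2]) (use gt in \<open>auto simp: tensor2_def\<close>)
      also have "\<dots> = tri2 H (g ()) h (b, c)"
        unfolding tri2_def ext2_def[of H "g ()"]
        by (intro sum.cong refl) (auto simp: A2_act pure2_def)
      finally show ?thesis using Pair by simp
    qed
    moreover have "(act (unit_mod H) h \<odot> g) () p = cu h * g () p" for p
      by (simp add: mcomp_unit unit_sel)
    ultimately show ?thesis by (auto simp: fun_eq_iff)
  qed
  with t show ?thesis unfolding hom_def V2_set_def by blast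
qed

end

section \<open>Integrals\<close>

locale ribbon_integral = ribbon H
  for H :: "('k::field, 'h::ring_1) ribbon_data" +
  fixes lam :: "'h \<Rightarrow> 'k"
  assumes lam: "right_integral_dual H lam" and lam_nz: "\<exists>x. lam x \<noteq> 0"
begin

text \<open>Kept general in the form \<open>m\<close>, because uniqueness of integrals is applied to
  another form in \<open>x1_lam\<close>.\<close>

definition right_int :: "('h \<Rightarrow> 'k) \<Rightarrow> bool" where
  "right_int m \<longleftrightarrow> lf m \<and> (\<forall>f x. lf f \<longrightarrow> Sw x (\<lambda>a b. m a * f b) = m x * f 1)"

lemma right_int_lam: "right_int lam"
proof -
  have l: "lf lam" using lam unfolding right_integral_dual_def lin_form_iff by blast
  have "Sw x (\<lambda>a b. lam a * f b) = lam x * f 1" if f: "lf f" for f x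
  proof -
    have "f (ext2H H (cop H x) (\<lambda>x1 x2. sc (lam x1) x2)) = f (sc (lam x) 1)"
      using lam by (simp add: right_integral_dual_def)
    then show ?thesis by (simp add: ext2H_lf[OF f] lfD[OF f])
  qed
  with l show ?thesis by (auto simp: right_int_def)
qed

lemma lf_lam0: "lf lam" using right_int_lam by (simp add: right_int_def)
lemma lf_lam: "lh g \<Longrightarrow> lf (\<lambda>x. lam (g x))" by (rule lf_comp[OF lf_lam0])

lemmas linl = lin lf_lam

lemma int_r: "right_int m \<Longrightarrow> lf f \<Longrightarrow> Sw x (\<lambda>a b. m a * f b) = m x * f 1"
  by (simp add: right_int_def)

lemma int_lf: "right_int m \<Longrightarrow> lf m" by (simp add: right_int_def)

text \<open>The integral property at S(h2) x turns h1 m(S(h2) x) into m(S(h3) x1) h1 S(h2) x2, where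
  h1 S(h2) cancels.\<close>

lemma int_shift: assumes m: "right_int m" and f: "lf f"
  shows "Sw x (\<lambda>a b. m (S h * a) * f b) = Sw h (\<lambda>a b. f a * m (S b * x))"
proof -
  note l = lin lf_comp[OF f] lf_comp[OF int_lf[OF m]]
  have "Sw h (\<lambda>a b. f a * m (S b * x)) =
      Sw h (\<lambda>a b. Sw (S b * x) (\<lambda>p q. m p * f (a * q)))"
    by (subst int_r[OF m]) (intro l | simp add: mult.commute)+
  also have "\<dots> = Sw h (\<lambda>a b. Sw (S b) (\<lambda>c d. Sw x (\<lambda>p q. m (c * p) * f (a * (d * q)))))"
    by (subst Sw_mult) (intro l refl)+
  also have "\<dots> = Sw h (\<lambda>a y. Sw y (\<lambda>b c. Sw x (\<lambda>p q. m (S c * p) * f (a * (S b * q)))))"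
    by (subst Sw_S) (intro l refl)+
  also have "\<dots> = Sw h (\<lambda>a y. Sw y (\<lambda>b c. Sw x (\<lambda>p q. m (S c * p) * f ((a * S b) * q))))"
    by (simp add: mult.assoc)
  also have "\<dots> = Sw x (\<lambda>p q. m (S h * p) * f (1 * q))"
    by (subst cancel_Sr1[where F="\<lambda>w c. Sw x (\<lambda>p q. m (S c * p) * f (w * q))"]) (intro l refl)+
  finally show ?thesis by simp
qed

lemma int_shift_r: assumes m: "right_int m" and f: "lf f"
  shows "Sw x (\<lambda>a b. m (a * y) * f b) = Sw y (\<lambda>a b. m (x * a) * f (S b))"
proof -
  note l = lin lf_comp[OF f] lf_comp[OF int_lf[OF m]]
  have "Sw y (\<lambda>a b. m (x * a) * f (S b)) =
      Sw y (\<lambda>a b. Sw (x * a) (\<lambda>p q. m p * f (q * S b)))"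
    by (subst int_r[OF m]) (intro l | simp)+
  also have "\<dots> = Sw y (\<lambda>y' b. Sw x (\<lambda>p q. Sw y' (\<lambda>c d. m (p * c) * f (q * d * S b))))"
    by (subst Sw_mult) (intro l refl)+
  also have "\<dots> = Sw x (\<lambda>p q. Sw y (\<lambda>y' b. Sw y' (\<lambda>c d. m (p * c) * f (q * d * S b))))"
    by (subst ext2_swap) (rule refl)
  also have "\<dots> = Sw x (\<lambda>p q. Sw y (\<lambda>c z. Sw z (\<lambda>d b. m (p * c) * f (q * (d * S b)))))"
    by (subst coassoc) (intro l | simp add: mult.assoc)+
  also have "\<dots> = Sw x (\<lambda>p q. m (p * y) * f (q * 1))"
    by (subst cancel_Sr2[where F="\<lambda>c w. m (_ * c) * f (_ * w)"]) (intro l refl)+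
  finally show ?thesis by simp
qed

text \<open>By \<open>int_shift\<close> the hypothesis yields h1 lam(S(h2) x) = 0 for all x. Now h
  lam(y) = h1 lam(S(S(h2) h3) y) = h1 lam(S(h3) S^2(h2) y), and expanding S^2(h2) y in the basis
  makes each summand vanish. The result gives injectivity of S and nondegeneracy of
  \<open>lam\<close> alike.\<close>

lemma S_ker: assumes h: "\<And>x. lam (S h * x) = 0" shows "h = 0"
proof -
  have Z: "Sw h (\<lambda>a b. f a * lam (S b * x)) = 0" if "lf f" for f x
    using int_shift[OF right_int_lam that, of x h] h by (simp add: ext2_def)
  obtain y where y: "lam y \<noteq> 0" using lam_nz by blast
  have "f h = f 0" if f: "lf f" for f
  proof -
    note l = linl lf_comp[OF f]
    have "f h * lam y = Sw h (\<lambda>a b. f a * cu b) * lam y"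
      by (subst counit_r[OF f]) (rule refl)
    also have "\<dots> = Sw h (\<lambda>a b. f a * (cu b * lam (S 1 * y)))"
      by (simp add: ext2_multr[symmetric] S_one mult.assoc)
    also have "\<dots> = Sw h (\<lambda>a b. f a * Sw b (\<lambda>c d. lam (S (S c * d) * y)))"
      by (subst antip_l[where f="\<lambda>w. lam (S w * y)"]) (intro l refl)+
    also have "\<dots> = Sw h (\<lambda>q d. Sw q (\<lambda>a c. f a * lam (S (S c * d) * y)))"
      by (subst coassoc) (intro l | simp add: ext2_multl)+
    also have "\<dots> = Sw h (\<lambda>q d. Sw q (\<lambda>a c. f a * (\<Sum>e\<in>B. crd H (S (S c) * y) e * lam (S d * e))))"
      by (subst lf_expand) (intro l | simp add: S_mult mult.assoc)+
    also have "\<dots> = (\<Sum>e\<in>B. Sw h (\<lambda>q d. Sw q (\<lambda>a c. f a * crd H (S (S c) * y) e) * lam (S d * e)))"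
      unfolding ext2_def case_prod_beta sum_distrib_left sum_distrib_right
      by (simp add: sum.swap[of _ B] algebra_simps)
    also have "\<dots> = 0"
      by (intro sum.neutral ballI Z l)
    finally show ?thesis using y by (simp add: lf_zero[OF f])
  qed
  then show ?thesis by (rule heqI)
qed

lemma linear_S: "Vector_Spaces.linear sc sc S"
  using hopf unfolding hopf_algebra_def by auto

lemma inj_S: "inj S"
proof (rule injI)
  fix x y assume "S x = S y"
  then have "S (x - y) = 0" using lh_diff[OF lh_S[OF lh_id], of x y] by simp
  then have "x - y = 0" by (intro S_ker) (simp add: lf_zero[OF lf_lam0])
  then show "x = y" by simp
qed

lemma surj_S: "surj S"
  using V.linear_inj_imp_surj[OF linear_S inj_S] .

lemma S_cases: obtains y where "x = S y"
  using surj_S by (metis surjD)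

section \<open>Nondegeneracy of the integral and the dual left integral\<close>

lemma nondeg_l: assumes "\<And>y. lam (x * y) = 0" shows "x = 0"
proof -
  obtain h where x: "x = S h" by (rule S_cases)
  show ?thesis using S_ker[of h] assms lh_zero[OF lh_S[OF lh_id]] unfolding x by auto
qed

lemma comb_linear: assumes "\<And>b. lf (\<lambda>x. g x b)"
  shows "Vector_Spaces.linear sc sc (\<lambda>x. \<Sum>b\<in>B. sc (g x b) b)"
  unfolding linH_iff lh_def using assms
  by (auto simp: lf_def V.scale_left_distrib sum.distrib V.scale_sum_right)

text \<open>In finite dimension injectivity of x -> lam(x . ) makes it surjective, so every
  coordinate form is some lam(x . ). Coordinates of the form are reassembled into a vector to keep
  \<open>?P\<close> an endomorphism of H.\<close>

lemma nondeg_r: assumes "\<And>x. lam (x * y) = 0" shows "y = 0"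
proof -
  let ?P = "\<lambda>x. \<Sum>b\<in>B. sc (lam (x * b)) b"
  have lin: "Vector_Spaces.linear sc sc ?P" by (intro comb_linear linl)
  have "inj ?P"
  proof (rule injI)
    fix v w assume eq: "?P v = ?P w"
    have "lam (v * b) = lam (w * b)" if "b \<in> B" for b
      using crd_comb[OF that, of "\<lambda>b. lam (v * b)"] crd_comb[OF that, of "\<lambda>b. lam (w * b)"] eq by simp
    then have "lam (v * z) = lam (w * z)" for z
      using lf_expand[of "\<lambda>z. lam (v * z)" z] lf_expand[of "\<lambda>z. lam (w * z)" z]
      by (simp add: lf_lam lh_multr lh_id cong: sum.cong)
    then have "lam ((v - w) * z) = 0" for z
      by (simp add: left_diff_distrib lf_diff[OF lf_lam0])
    then show "v = w" using nondeg_l[of "v - w"] by simp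
  qed
  then have surj: "surj ?P" using V.linear_inj_imp_surj[OF lin] by blast
  have "crd H y b = 0" if b: "b \<in> B" for b
  proof -
    obtain x where x: "b = ?P x" using surjD[OF surj, of b] by blast
    have "0 = (\<Sum>c\<in>B. crd H y c * lam (x * c))"
      using lf_expand[of "\<lambda>z. lam (x * z)" y] assms by (simp add: lf_lam lh_multr lh_id)
    also have "\<dots> = (\<Sum>c\<in>B. crd H y c * crd H b c)"
      by (intro sum.cong refl arg_cong2[where f="(*)"]) (simp only: x crd_comb)
    also have "\<dots> = crd H y b"
      using b by (simp add: crd_basis finite_B if_distrib cong: if_cong)
    finally show ?thesis by simp
  qed
  then show ?thesis using crd_expand[of y] by simp
qed

lemma ex_integral: "\<exists>y. \<forall>x. lam (x * y) = cu x"
proof -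
  let ?P = "\<lambda>y. \<Sum>b\<in>B. sc (lam (b * y)) b"
  have lin: "Vector_Spaces.linear sc sc ?P" by (intro comb_linear linl)
  have "inj ?P"
  proof (rule injI)
    fix v w assume eq: "?P v = ?P w"
    have "lam (b * v) = lam (b * w)" if "b \<in> B" for b
      using crd_comb[OF that, of "\<lambda>b. lam (b * v)"] crd_comb[OF that, of "\<lambda>b. lam (b * w)"] eq by simp
    then have "lam (z * v) = lam (z * w)" for z
      using lf_expand[of "\<lambda>z. lam (z * v)" z] lf_expand[of "\<lambda>z. lam (z * w)" z]
      by (simp add: lf_lam lh_multl lh_id cong: sum.cong)
    then have "lam (z * (v - w)) = 0" for z
      by (simp add: right_diff_distrib lf_diff[OF lf_lam0])
    then show "v = w" using nondeg_r[of "v - w"] by simp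
  qed
  then have surj: "surj ?P" using V.linear_inj_imp_surj[OF lin] by blast
  obtain y where y: "(\<Sum>b\<in>B. sc (cu b) b) = ?P y" using surjD[OF surj] by blast
  have b: "lam (b * y) = cu b" if "b \<in> B" for b
    using crd_comb[OF that, of cu] crd_comb[OF that, of "\<lambda>b. lam (b * y)"] y by simp
  have "lam (x * y) = cu x" for x
    using lf_expand[of "\<lambda>z. lam (z * y)" x] lf_expand[of cu x] b
    by (simp add: lf_lam lh_multl lh_id lf_cu cong: sum.cong)
  then show ?thesis by blast
qed

text \<open>The left integral of H that represents the counit through \<open>lam\<close>; in
  particular it is normalized by lam(Lam) = 1.\<close>

definition Lam :: 'h where "Lam = (SOME y. \<forall>x. lam (x * y) = cu x)"

lemma lam_Lam: "lam (x * Lam) = cu x"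
  using someI_ex[OF ex_integral] unfolding Lam_def by blast

lemma lam_Lam1: "lam Lam = 1"
  using lam_Lam[of 1] by (simp add: cu_one)

lemma lam_eqI: "(\<And>x. lam (x * y) = lam (x * z)) \<Longrightarrow> y = z"
  using nondeg_r[of "y - z"] by (simp add: right_diff_distrib lf_diff[OF lf_lam0])

lemma Lam_left: "x * Lam = sc (cu x) Lam"
  by (rule lam_eqI)
    (simp add: mult.assoc[symmetric] lam_Lam cu_mult sc_mult_right lfD[OF lf_lam0])

lemma left_integral_unique: "left_integral H L \<Longrightarrow> L = sc (lam L) Lam"
  by (rule lam_eqI)
    (simp add: left_integral_def sc_mult_right lfD[OF lf_lam0] lam_Lam)

text \<open>Explicit form of the distinguished character; it describes right multiplication on left
  integrals because these are multiples of \<open>Lam\<close>.\<close>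

definition nuf :: "'h \<Rightarrow> 'k" where "nuf x = lam (Lam * x)"

lemma Lam_right: "Lam * x = sc (nuf x) Lam"
  unfolding nuf_def
  by (rule left_integral_unique) (simp add: left_integral_def mult.assoc[symmetric] Lam_left sc_mult_left)

lemma lf_nv: "lh g \<Longrightarrow> lf (\<lambda>x. nuf (g x))" unfolding nuf_def by (intro linl)

lemma nv_one: "nuf 1 = 1" by (simp add: nuf_def lam_Lam1)

lemma nv_mult: "nuf (x * y) = nuf x * nuf y"
proof -
  have "nuf (x * y) = lam (Lam * x * y)" by (simp add: nuf_def mult.assoc)
  also have "\<dots> = nuf x * nuf y"
    unfolding Lam_right[of x] by (simp add: sc_mult_left lfD[OF lf_lam0] nuf_def)
  finally show ?thesis .
qed

lemma nu_eq: "nu H = nuf"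
  unfolding nu_def
proof (rule the_equality)
  show "alg_character H nuf \<and> (\<forall>L x. left_integral H L \<longrightarrow> L * x = sc (nuf x) L)"
  proof (intro conjI allI impI)
    show "alg_character H nuf"
      unfolding alg_character_def lin_form_iff using nv_one nv_mult lf_nv[OF lh_id] by auto
    fix L x assume "left_integral H L"
    from left_integral_unique[OF this] obtain c where L: "L = sc c Lam" by blast
    show "L * x = sc (nuf x) L"
      unfolding L by (simp add: sc_mult_left Lam_right mult.commute)
  qed
  fix f assume f: "alg_character H f \<and> (\<forall>L x. left_integral H L \<longrightarrow> L * x = sc (f x) L)"
  have "left_integral H Lam" by (simp add: left_integral_def Lam_left)
  with f have "Lam * x = sc (f x) Lam" for x by blast
  then show "f = nuf"
    by (intro ext) (simp add: nuf_def lfD[OF lf_lam0] lam_Lam1)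
qed

lemmas linn = linl lf_nv

section \<open>Dual bases, the Nakayama automorphism and uniqueness of the integral\<close>

lemma int_S: assumes m: "right_int m" and f: "lf f"
  shows "Sw Lam (\<lambda>a b. m (S h * a) * f b) = m Lam * f h"
proof -
  note l = linn lf_comp[OF f] lf_comp[OF int_lf[OF m]]
  have "Sw Lam (\<lambda>a b. m (S h * a) * f b) = Sw h (\<lambda>a b. f a * m (S b * Lam))"
    by (rule int_shift[OF m f])
  also have "\<dots> = Sw h (\<lambda>a b. f a * cu b * m Lam)"
    by (simp add: Lam_left lfD[OF int_lf[OF m]] cu_S mult.assoc)
  also have "\<dots> = f h * m Lam" by (simp add: ext2_multr counit_r[OF f])
  finally show ?thesis by simp
qed

text \<open>Lam1 \<otimes> S(Lam2) is the pair of dual bases for the form lam(x y). By nondegeneracy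
  it is enough to test with lam(S(h) . ), where \<open>int_S\<close> applies.\<close>

lemma casimir: assumes g: "lf g"
  shows "Sw Lam (\<lambda>a b. g a * lam (S b * x)) = g x"
proof -
  define w where "w = ext2H H (cop H Lam) (\<lambda>a b. sc (lam (S b * x)) a)"
  have w: "f w = Sw Lam (\<lambda>a b. f a * lam (S b * x))" if "lf f" for f
    unfolding w_def by (simp add: ext2H_lf[OF that] lfD[OF that] mult.commute)
  have "w = x"
  proof (rule lam_eqI)
    fix y
    obtain h where y: "y = S h" by (rule S_cases)
    have "lam (y * w) = Sw Lam (\<lambda>a b. lam (S h * a) * lam (S b * x))"
      by (subst w) (intro linl | simp add: y)+
    also have "\<dots> = lam (S h * x)"
      by (subst int_S[OF right_int_lam]) (intro linl | simp add: lam_Lam1)+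
    finally show "lam (y * w) = lam (y * x)" by (simp add: y)
  qed
  with w[OF g] show ?thesis by simp
qed

lemma lam_Lam_mult: assumes g: "lf g"
  shows "Sw Lam (\<lambda>a b. lam (a * y) * g b) = Sw y (\<lambda>a b. nuf a * g (S b))"
  unfolding nuf_def by (rule int_shift_r[OF right_int_lam g])

text \<open>Expand lam( . y) by \<open>casimir\<close> and evaluate lam(Lam1 y) Lam2 by
  \<open>lam_Lam_mult\<close>. The automorphism obtained is y -> S^2(y \<leftharpoonup> nu).\<close>

lemma nakayama: "lam (x * y) = Sw y (\<lambda>a b. nuf a * lam (S (S b) * x))"
proof -
  have "lam (x * y) = Sw Lam (\<lambda>a b. lam (a * y) * lam (S b * x))"
    by (rule casimir[symmetric]) (intro linl)
  also have "\<dots> = Sw y (\<lambda>a b. nuf a * lam (S (S b) * x))"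
    by (rule lam_Lam_mult) (intro linl)
  finally show ?thesis .
qed

lemma nv_G: "nuf G * nuf Gi = 1"
  by (simp add: nv_mult[symmetric] G_Gi nv_one)

text \<open>S^2 is inner, and a character does not see conjugation.\<close>

lemma nv_SS: "nuf (S (S x)) = nuf x"
  unfolding SS_eq nv_mult using nv_G by (metis mult.assoc mult.commute mult_1_right)

lemma right_int_unique: assumes m: "right_int m"
  shows "m x = m Lam * lam x"
proof -
  obtain h where x: "x = S h" by (rule S_cases)
  note l = linn lf_comp[OF int_lf[OF m]]
  have "m (S h) = m (S h * 1)" by simp
  also have "\<dots> = Sw Lam (\<lambda>a b. m (S h * a) * lam (S b * 1))"
    by (rule casimir[symmetric]) (intro l)
  also have "\<dots> = m Lam * lam (S h * 1)"
    by (rule int_S[OF m]) (intro l)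
  finally show ?thesis by (simp add: x)
qed

text \<open>The distinguished grouplike element of H. The relation x1 lam(x2) = lam(x) E is read off
  at x = Lam, where \<open>lam\<close> is 1; \<open>x1_lam\<close> extends it to all x.\<close>

definition E :: 'h where "E = ext2H H (cop H Lam) (\<lambda>a b. sc (lam b) a)"

lemma lf_E: "lf f \<Longrightarrow> f E = Sw Lam (\<lambda>a b. f a * lam b)"
  unfolding E_def by (simp add: ext2H_lf lfD mult.commute)

text \<open>The form x -> f(x1) lam(x2) is again a right integral, hence a multiple of
  \<open>lam\<close>.\<close>

lemma x1_lam: assumes f: "lf f"
  shows "Sw x (\<lambda>a b. f a * lam b) = f E * lam x"
proof -
  note l = linn lf_comp[OF f]
  let ?m = "\<lambda>x. Sw x (\<lambda>a b. f a * lam b)"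
  have "right_int ?m"
    unfolding right_int_def
  proof (intro conjI allI impI)
    show "lf ?m" by (intro l)
    fix g x assume g: "lf g"
    have "Sw x (\<lambda>y c. Sw y (\<lambda>a b. f a * lam b) * g c) = Sw x (\<lambda>y c. Sw y (\<lambda>a b. f a * (lam b * g c)))"
      by (simp add: ext2_multr[symmetric] mult.assoc)
    also have "\<dots> = Sw x (\<lambda>a y. Sw y (\<lambda>b c. f a * (lam b * g c)))"
      by (rule coassoc) (intro l lf_comp[OF g])
    also have "\<dots> = Sw x (\<lambda>a y. f a * (lam y * g 1))"
      by (simp add: ext2_multl int_r[OF right_int_lam g])
    finally show "Sw x (\<lambda>y c. Sw y (\<lambda>a b. f a * lam b) * g c) = Sw x (\<lambda>a b. f a * lam b) * g 1"
      by (simp add: ext2_multr[symmetric] mult.assoc)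
  qed
  from right_int_unique[OF this, of x] show ?thesis by (simp add: lf_E[OF f])
qed

lemma Sw_E: assumes F: "bil F" shows "Sw E F = F E E"
proof -
  note l = linn bil1[OF F] bil2[OF F]
  have "Sw E F = Sw Lam (\<lambda>y c. Sw y F * lam c)"
    by (rule lf_E) (intro l)
  also have "\<dots> = Sw Lam (\<lambda>y c. Sw y (\<lambda>a b. F a b * lam c))"
    by (simp add: ext2_multr)
  also have "\<dots> = Sw Lam (\<lambda>a y. Sw y (\<lambda>b c. F a b * lam c))"
    by (rule coassoc) (intro l)
  also have "\<dots> = Sw Lam (\<lambda>a y. F a E * lam y)"
    by (subst x1_lam) (intro l refl)+
  also have "\<dots> = F E E * lam Lam"
    by (rule x1_lam) (intro l)
  finally show ?thesis by (simp add: lam_Lam1)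
qed

text \<open>S(Lam) is a right integral in H, so \<open>int_S\<close> at h = Lam computes lam(Lam)^2
  as lam(S(Lam)).\<close>

lemma lam_S_Lam: "lam (S Lam) = 1"
proof -
  have "1 = lam Lam * lam Lam" by (simp add: lam_Lam1)
  also have "\<dots> = Sw Lam (\<lambda>a b. lam (S Lam * a) * lam b)"
    by (rule int_S[OF right_int_lam lf_lam0, symmetric])
  also have "\<dots> = Sw Lam (\<lambda>a b. lam (S Lam) * (cu a * lam b))"
  proof -
    have "S Lam * a = sc (cu a) (S Lam)" for a
    proof -
      obtain h where a: "a = S h" by (rule S_cases)
      show ?thesis by (simp add: a S_mult[symmetric] Lam_left lhD[OF lh_S[OF lh_id]] cu_S)
    qed
    then show ?thesis by (simp add: lfD[OF lf_lam0] mult.left_commute mult.assoc)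
  qed
  also have "\<dots> = lam (S Lam)"
    by (simp add: ext2_multl counit_l[OF lf_lam0] lam_Lam1)
  finally show ?thesis by simp
qed

text \<open>Expanding lam o S by \<open>casimir\<close> produces the flipped coproduct of Lam under
  S on both legs, that is Delta(S(Lam)), where \<open>x1_lam\<close> extracts E.\<close>

lemma lam_S: "lam (S x) = lam (E * x)"
proof -
  have "lam (S x) = Sw Lam (\<lambda>a b. lam (S a) * lam (S b * x))"
    by (rule casimir[symmetric]) (intro linl)
  also have "\<dots> = Sw (S Lam) (\<lambda>a b. lam (a * x) * lam b)"
    by (subst Sw_S) (intro linl | simp add: mult.commute)+
  also have "\<dots> = lam (E * x) * lam (S Lam)"
    by (rule x1_lam) (intro linl)
  finally show ?thesis by (simp add: lam_S_Lam)
qed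

subsection \<open>The distinguished grouplike elements\<close>

definition hnu :: 'h where "hnu = h_nu H"

lemma lf_hn: "lf f \<Longrightarrow> f hnu = RR (\<lambda>a b. f a * nuf b)"
  unfolding hnu_def h_nu_def nu_eq by (simp add: ext2H_lf lfD mult.commute)

lemma lf_ract: "lf f \<Longrightarrow> f (ract H x (nu H)) = Sw x (\<lambda>a b. nuf a * f b)"
  unfolding ract_def nu_eq by (simp add: ext2H_lf lfD)

lemma Sw_hn: assumes F: "bil F" shows "Sw hnu F = F hnu hnu"
proof -
  note l = linn bil1[OF F] bil2[OF F]
  have "Sw hnu F = RR (\<lambda>a b. Sw a F * nuf b)" by (rule lf_hn) (intro l)
  also have "\<dots> = RR (\<lambda>a b. Sw a (\<lambda>c d. F c d * nuf b))" by (simp add: ext2_multr)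
  also have "\<dots> = RR (\<lambda>a b. RR (\<lambda>a' b'. F a a' * nuf (b * b')))" by (rule R_cop_id) (intro l)
  also have "\<dots> = RR (\<lambda>a b. RR (\<lambda>a' b'. F a a' * nuf b') * nuf b)"
    by (simp only: ext2_multr[symmetric] nv_mult) (simp add: ac_simps)
  also have "\<dots> = RR (\<lambda>a b. F a hnu * nuf b)"
    by (subst lf_hn[where f="\<lambda>w. F _ w", symmetric]) (intro l refl)+
  also have "\<dots> = F hnu hnu"
    by (rule lf_hn[symmetric]) (intro l)
  finally show ?thesis .
qed

lemma cu_hn: "cu hnu = 1"
proof -
  have "cu hnu = RR (\<lambda>a b. cu a * nuf b)" by (rule lf_hn) (intro linn)
  also have "\<dots> = nuf 1" by (rule R_cu_l) (intro linn)
  finally show ?thesis by (simp add: nv_one)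
qed

lemma hn_S: "hnu * S hnu = 1"
proof (rule heqI)
  fix f assume f: "lf f"
  note l = linn lf_comp[OF f]
  have "f (hnu * S hnu) = Sw hnu (\<lambda>a b. f (a * S b))" by (rule Sw_hn[symmetric]) (intro l)
  also have "\<dots> = f 1" by (simp add: antip_r[OF f] cu_hn)
  finally show "f (hnu * S hnu) = f 1" .
qed

lemma SS_hn: "S (S hnu) = hnu"
proof (rule heqI)
  fix f assume f: "lf f"
  note l = linn lf_comp[OF f]
  have "f (S (S hnu)) = RR (\<lambda>a b. f (S (S a)) * nuf b)" by (rule lf_hn) (intro l)
  also have "\<dots> = RR (\<lambda>a b. f (S (S a)) * nuf (S (S b)))" by (simp add: nv_SS)
  also have "\<dots> = RR (\<lambda>a b. f a * nuf b)" by (rule SSR) (intro l)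
  also have "\<dots> = f hnu" by (rule lf_hn[OF f, symmetric])
  finally show "f (S (S hnu)) = f hnu" .
qed

lemma G_hn: "G * hnu = hnu * G"
  by (simp add: G_conj SS_hn)

text \<open>
  Drinfeld's relation between the distinguished grouplike elements of \<open>H\<close> and of its dual:
  evaluate \<open>lam\<close> on the first leg of \<open>\<Delta>\<^sup>o\<^sup>p(\<Lambda>) = R\<^sub>2\<^sub>1\<^sup>-\<^sup>1 \<Delta>(\<Lambda>) R\<^sub>2\<^sub>1\<close>.
\<close>

lemma E_eq: "E = G * (G * hnu)"
proof (rule heqI)
  fix f assume f: "lf f"
  note l = linn lf_comp[OF f]
  have "f E = Sw Lam (\<lambda>p q. f p * lam q)" by (rule lf_E[OF f])
  also have "\<dots> = RR (\<lambda>a b. RR (\<lambda>a' b'. Sw Lam (\<lambda>p q. f (S a * (q * a')) * lam (b * (p * b')))))"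
    by (rule flip_comm) (intro l)
  \<comment> \<open>\<open>SS_R\<close> brings the left factor under \<open>lam\<close> into the
    shape S(b) that \<open>int_S\<close> requires.\<close>
  also have "\<dots> = RR (\<lambda>a b. RR (\<lambda>a' b'. Sw Lam (\<lambda>p q. f (S (S a) * (q * a')) * lam (S b * (p * b')))))"
    by (rule SS_R[symmetric]) (intro l)
  \<comment> \<open>The Nakayama formula moves b' to the left and feeds its first component to nu;
    this is where h_nu originates.\<close>
  also have "\<dots> = RR (\<lambda>a b. RR (\<lambda>a' b'. Sw Lam (\<lambda>p q. Sw b' (\<lambda>c d. 
      nuf c * (lam (S (b * S d) * p) * f (S (S a) * (q * a')))))))"
  proof -
    have "f z * lam (S b * (p * b')) = Sw b' (\<lambda>c d. nuf c * (lam (S (b * S d) * p) * f z))" for z b p b'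
    proof -
      have "f z * lam (S b * (p * b')) = Sw b' (\<lambda>c d. nuf c * lam (S (S d) * (S b * p))) * f z"
        using nakayama[of "S b * p" b'] by (simp add: mult.assoc mult.commute)
      then show ?thesis by (simp add: ext2_multr[symmetric] S_mult mult.assoc)
    qed
    then show ?thesis by simp
  qed
  also have "\<dots> = RR (\<lambda>a b. RR (\<lambda>a' b'. Sw b' (\<lambda>c d. 
      nuf c * Sw Lam (\<lambda>p q. lam (S (b * S d) * p) * f (S (S a) * (q * a'))))))"
    by (subst ext2_swap[of "cop H Lam"]) (simp add: ext2_multl)
  also have "\<dots> = RR (\<lambda>a b. RR (\<lambda>a' b'. Sw b' (\<lambda>c d. nuf c * f (S (S a) * ((b * S d) * a')))))"
    by (subst int_S[OF right_int_lam, where f="\<lambda>w. f (S (S _) * (w * _))"])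
      (intro l | simp add: lam_Lam1)+
  also have "\<dots> = RR (\<lambda>a b. RR (\<lambda>a2 b2. RR (\<lambda>a3 b3. nuf b3 * f (S (S a) * ((b * S b2) * (a2 * a3))))))"
    by (subst R_id_cop[where F="\<lambda>a' c d. nuf c * f (S (S _) * ((_ * S d) * a'))"]) (intro l refl)+
  also have "\<dots> = RR (\<lambda>a b. RR (\<lambda>a2 b2. RR (\<lambda>a3 b3. f (S (S a) * ((b * S b2) * (a2 * a3))) * nuf b3)))"
    by (simp add: mult.commute)
  also have "\<dots> = RR (\<lambda>a b. RR (\<lambda>a2 b2. f (S (S a) * b * ((S b2 * a2) * hnu))))"
    by (subst lf_hn[where f="\<lambda>w. f (S (S _) * ((_ * S _) * (_ * w)))", symmetric])
      (intro l | simp add: mult.assoc)+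
  also have "\<dots> = RR (\<lambda>a b. f ((S (S a) * b) * (u * hnu)))"
    by (subst lf_u[where f="\<lambda>w. f (S (S _) * _ * (w * hnu))"]) (intro l refl)+
  also have "\<dots> = f (u * (tw * tw) * (u * hnu))"
    by (rule S2_R_mult[OF surj_S, where f="\<lambda>w. f (w * (u * hnu))"]) (intro l)
  also have "u * (tw * tw) * (u * hnu) = G * (G * hnu)"
    unfolding G_def by (metis mult.assoc tw_central)
  finally show "f E = f (G * (G * hnu))" .
qed

text \<open>\<open>E_eq\<close> and \<open>hn_S\<close> give G^2 = E S(h_nu), a product of
  grouplikes.\<close>

lemma Sw_GG: assumes F: "bil F" shows "Sw (G * G) F = F (G * G) (G * G)"
proof -
  note l = linn bil1[OF F] bil2[OF F]
  have GG: "G * G = E * S hnu"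
    unfolding E_eq using hn_S by (simp add: mult.assoc)
  show ?thesis
    unfolding GG
    apply (subst Sw_mult, intro l)
    apply (subst Sw_E, intro l)
    apply (subst Sw_S, intro l)
    apply (subst Sw_hn, intro l)
    by (rule refl)
qed

section \<open>Forms attached to elements of L(H) and the operator T\<close>

definition alpha :: "'h \<Rightarrow> 'h \<Rightarrow> 'k" where "alpha z x = lam (z * x)"

lemma lf_al: "lh g \<Longrightarrow> lf (\<lambda>x. alpha z (g x))" unfolding alpha_def by (intro linl)

lemmas lina = linn lf_al

lemma L_setD: "z \<in> L_set H \<Longrightarrow> lf f \<Longrightarrow> Sw x (\<lambda>a b. nuf a * f (b * z)) = f (z * x)"
  using lf_ract[of "\<lambda>w. f (w * z)" x] lf_comp[of f "\<lambda>w. w * z"] by (auto simp: L_set_def lin)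

text \<open>The twist by nu in \<open>nakayama\<close> is exactly the one that L(H) absorbs. As nu
  is invariant under S^2, it can be moved onto the coproduct of S^2(y), where \<open>L_setD\<close>
  applies.\<close>

lemma al_cyclic: assumes z: "z \<in> L_set H" shows "alpha z (x * y) = alpha z (S (S y) * x)"
proof -
  have "alpha z (x * y) = lam (z * x * y)" by (simp add: alpha_def mult.assoc)
  also have "\<dots> = Sw y (\<lambda>a b. nuf a * lam (S (S b) * (z * x)))" by (rule nakayama)
  also have "\<dots> = Sw y (\<lambda>a b. nuf (S (S a)) * lam (S (S b) * z * x))" by (simp add: nv_SS mult.assoc)
  also have "\<dots> = Sw (S y) (\<lambda>a b. nuf (S b) * lam (S a * z * x))"
    by (subst Sw_S) (intro lina refl)+
  also have "\<dots> = Sw (S (S y)) (\<lambda>a b. nuf a * lam (b * z * x))"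
    by (subst Sw_S[of _ "S y"]) (intro lina refl)+
  also have "\<dots> = lam (z * S (S y) * x)"
    by (rule L_setD[OF z]) (intro lina)
  finally show ?thesis by (simp add: alpha_def mult.assoc)
qed

lemma al_SS: "z \<in> L_set H \<Longrightarrow> alpha z (S (S x)) = alpha z x"
  using al_cyclic[of z 1 x] by simp

lemma al_inv: assumes z: "z \<in> L_set H"
  shows "Sw h (\<lambda>a b. alpha z (S a * x * b)) = cu h * alpha z x"
proof -
  have "Sw h (\<lambda>a b. alpha z (S a * x * b)) = Sw h (\<lambda>a b. alpha z (S (a * S b) * x))"
    by (subst al_cyclic[OF z]) (simp add: S_mult mult.assoc)
  also have "\<dots> = cu h * alpha z (S 1 * x)"
    by (rule antip_r) (intro lina)
  finally show ?thesis by (simp add: S_one)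
qed

text \<open>With z = S(y), \<open>nakayama\<close> read backwards turns lam((S^2(y) \<leftharpoonup>
  nu) h_nu x) into lam(h_nu x y). Since h_nu = E G^-2, \<open>lam_S\<close> rewrites this as
  lam(S(G^-2 x y)).\<close>

lemma T_op_form: "lam (T_op H z * x) = alpha z (S x * (G * G))"
proof -
  obtain y where y: "z = S y" by (rule S_cases)
  have "lam (T_op H z * x) = lam (ract H (S z) (nu H) * (hnu * x))"
    by (simp add: T_op_def hnu_def mult.assoc)
  also have "\<dots> = Sw (S z) (\<lambda>a b. nuf a * lam (b * (hnu * x)))"
    by (rule lf_ract) (intro lina)
  also have "\<dots> = Sw (S y) (\<lambda>a b. nuf (S b) * lam (S a * (hnu * x)))"
    unfolding y by (subst Sw_S) (intro lina refl)+
  also have "\<dots> = Sw y (\<lambda>a b. nuf (S (S a)) * lam (S (S b) * (hnu * x)))"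
    by (subst Sw_S) (intro lina refl)+
  also have "\<dots> = lam (hnu * x * y)"
    by (simp only: nakayama[of "hnu * x" y] nv_SS)
  also have "hnu * x * y = E * (Gi * Gi * x * y)"
  proof -
    have "E * (Gi * Gi * x * y) = hnu * (G * (G * Gi) * Gi) * x * y"
      unfolding E_eq by (metis G_hn mult.assoc)
    then show ?thesis by (simp add: G_Gi)
  qed
  also have "lam \<dots> = lam (S (Gi * Gi * x * y))" by (simp add: lam_S)
  also have "S (Gi * Gi * x * y) = z * (S x * (G * G))"
    by (simp add: S_mult y S_G[symmetric] SS_G mult.assoc)
  finally show ?thesis by (simp add: alpha_def)
qed

text \<open>Needed because \<open>N_set\<close> consists of elements of L(H), so T(z) - z must first
  be seen to lie there.\<close>

lemma T_op_L: assumes z: "z \<in> L_set H" shows "T_op H z \<in> L_set H"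
proof -
  have "ract H x (nu H) * T_op H z - T_op H z * x = 0" for x
  proof (rule nondeg_l)
    fix y
    \<comment> \<open>With a third power of S, two uses of \<open>Sw_S\<close> lead down to the
      coproduct of S(v), and \<open>nakayama\<close> moves S(v) to the right end.\<close>
    obtain v where w: "x = S (S (S v))" by (metis S_cases)
    have "lam (ract H x (nu H) * T_op H z * y) = Sw (S (S (S v))) (\<lambda>a b. nuf a * lam (b * T_op H z * y))"
      unfolding w by (rule lf_ract) (intro lina)
    also have "\<dots> = Sw (S (S v)) (\<lambda>a b. nuf (S b) * lam (S a * T_op H z * y))"
      by (subst Sw_S) (intro lina refl)+
    also have "\<dots> = Sw (S v) (\<lambda>a b. nuf (S (S a)) * lam (S (S b) * (T_op H z * y)))"
      by (subst Sw_S) (intro lina | simp add: mult.assoc)+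
    also have "\<dots> = lam (T_op H z * y * S v)"
      by (simp only: nakayama[of "T_op H z * y" "S v"] nv_SS)
    also have "\<dots> = alpha z (S (S v) * (S y * (G * G)))"
      by (simp add: T_op_form mult.assoc S_mult)
    also have "\<dots> = alpha z (S y * (G * G) * v)"
      by (rule al_cyclic[OF z, symmetric])
    also have "S y * (G * G) * v = S (x * y) * (G * G)"
      unfolding w S_mult by (metis G_conj mult.assoc)
    also have "alpha z \<dots> = lam (T_op H z * x * y)"
      by (simp add: T_op_form mult.assoc)
    finally show "lam ((ract H x (nu H) * T_op H z - T_op H z * x) * y) = 0"
      by (simp add: left_diff_distrib lf_diff[OF lf_lam0])
  qed
  then show ?thesis by (simp add: L_set_def)
qed

lemma L_diff: "z \<in> L_set H \<Longrightarrow> w \<in> L_set H \<Longrightarrow> z - w \<in> L_set H"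
  by (simp add: L_set_def right_diff_distrib left_diff_distrib)

lemma T_N_iff: assumes z: "z \<in> L_set H"
  shows "T_op H z - z \<in> N_set H lam \<longleftrightarrow> (\<forall>a \<in> Z_center H. lam (T_op H z * a) = lam (z * a))"
  using L_diff[OF T_op_L[OF z] z]
  by (simp add: N_set_def left_diff_distrib lf_diff[OF lf_lam0])

text \<open>Cyclicity brings b next to a as S^2(b) S(a), which sums to u. With theta this gives a G,
  and the powers of G are gathered on the right by cyclicity.\<close>

lemma antipode_form: assumes z: "z \<in> L_set H"
  shows "RR (\<lambda>a b. alpha z (S a * tw * S x * G * b)) = lam (T_op H z * x)"
proof -
  have "RR (\<lambda>a b. alpha z (S a * tw * S x * G * b)) = RR (\<lambda>a b. alpha z (S (S b) * S a * (tw * S x * G)))"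
    by (subst al_cyclic[OF z]) (simp add: mult.assoc)
  also have "\<dots> = RR (\<lambda>a b. alpha z (S b * a * (tw * S x * G)))"
    by (rule SS_R) (intro lina)
  also have "\<dots> = alpha z (u * (tw * S x * G))"
    by (rule lf_u[where f="\<lambda>w. alpha z (w * (tw * S x * G))", symmetric]) (intro lina)
  also have "u * (tw * S x * G) = G * S x * G"
    unfolding G_def by (metis mult.assoc tw_central)
  also have "alpha z (G * S x * G) = alpha z (G * G * S x)"
    by (subst al_cyclic[OF z]) (simp add: SS_G mult.assoc)
  also have "\<dots> = alpha z (S x * (G * G))"
    by (subst (2) al_cyclic[OF z]) (simp add: S_mult SS_G mult.assoc)
  finally show ?thesis by (simp add: T_op_form)
qed

section \<open>The slide form and its comparison with condition (b)\<close>

definition slide :: "'h \<Rightarrow> 'h \<Rightarrow> 'h \<Rightarrow> 'k" where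
  "slide z x y = Sw y (\<lambda>a b. alpha z a * alpha z (x * b))"

lemma bil_slide: "bil (slide z)"
  unfolding slide_def by (intro lina)

text \<open>With six components of h the value is alpha(S(h4) p h5) alpha(S(h1) x h2 S(h3) q h6),
  where p and q are the components of y. Here h2 S(h3) cancels, then \<open>al_inv\<close> removes
  h4, h5 and finally h1, h6.\<close>

lemma inv_slide: assumes z: "z \<in> L_set H" shows "inv_form (slide z)"
  unfolding inv_form_def
proof (intro conjI allI bil_slide)
  fix x y h
  note l = lina
  have "Sw h (\<lambda>h' h''. Sw h' (\<lambda>a b. Sw h'' (\<lambda>c d. slide z (S a * x * b) (S c * y * d)))) =
    Sw h (\<lambda>h' h''. Sw h' (\<lambda>a b. Sw h'' (\<lambda>c d. Sw c (\<lambda>c1 c2. Sw y (\<lambda>p q. Sw d (\<lambda>d1 d2.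
      alpha z (S c2 * p * d1) * alpha z (S a * x * b * (S c1 * q * d2))))))))"
    unfolding slide_def
    by (subst Sw_mult, intro l, subst Sw_mult, intro l, subst Sw_S, intro l) (rule refl)
  also have "\<dots> = Sw h (\<lambda>a m. Sw m (\<lambda>b h''. Sw h'' (\<lambda>c d. Sw c (\<lambda>c1 c2. Sw y (\<lambda>p q. Sw d (\<lambda>d1 d2.
      alpha z (S c2 * p * d1) * alpha z (S a * x * b * (S c1 * q * d2))))))))"
    by (rule coassoc) (intro l)
  also have "\<dots> = Sw h (\<lambda>a m. Sw m (\<lambda>b h''. Sw h'' (\<lambda>c1 k. Sw k (\<lambda>c2 d. Sw y (\<lambda>p q. Sw d (\<lambda>d1 d2.
      alpha z (S c2 * p * d1) * alpha z (S a * x * (b * S c1) * q * d2)))))))"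
    by (subst coassoc[where F="\<lambda>c1 c2 d. Sw y (\<lambda>p q. Sw d (\<lambda>d1 d2.
      alpha z (S c2 * p * d1) * alpha z (S _ * x * _ * (S c1 * q * d2))))"]) (intro l | simp add: mult.assoc)+
  also have "\<dots> = Sw h (\<lambda>a m. Sw m (\<lambda>c2 d. Sw y (\<lambda>p q. Sw d (\<lambda>d1 d2.
      alpha z (S c2 * p * d1) * alpha z (S a * x * 1 * q * d2)))))"
    by (subst cancel_Sr1[where F="\<lambda>w k. Sw k (\<lambda>c2 d. Sw y (\<lambda>p q. Sw d (\<lambda>d1 d2.
      alpha z (S c2 * p * d1) * alpha z (S _ * x * w * q * d2))))"]) (intro l refl)+
  also have "\<dots> = Sw h (\<lambda>a m. Sw y (\<lambda>p q. Sw m (\<lambda>c2 d. Sw d (\<lambda>d1 d2.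
      alpha z (S c2 * p * d1) * alpha z (S a * (x * q) * d2)))))"
    by (simp only: ext2_swap[of "cop H y"] mult.assoc mult_1_left)
  also have "\<dots> = Sw h (\<lambda>a m. Sw y (\<lambda>p q. Sw m (\<lambda>e d2. Sw e (\<lambda>c2 d1.
      alpha z (S c2 * p * d1) * alpha z (S a * (x * q) * d2)))))"
    by (subst coassoc[where F="\<lambda>c2 d1 d2. alpha z (S c2 * _ * d1) * alpha z (S _ * _ * d2)"]) (intro l refl)+
  also have "\<dots> = Sw h (\<lambda>a m. Sw y (\<lambda>p q. Sw m (\<lambda>e d2. cu e * (alpha z p * alpha z (S a * (x * q) * d2)))))"
    by (simp only: ext2_multr al_inv[OF z]) (simp only: mult.assoc)
  also have "\<dots> = Sw h (\<lambda>a m. Sw y (\<lambda>p q. alpha z p * alpha z (S a * (x * q) * m)))"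
    by (subst counit_l) (intro l refl)+
  also have "\<dots> = Sw y (\<lambda>p q. alpha z p * Sw h (\<lambda>a m. alpha z (S a * (x * q) * m)))"
    by (subst ext2_swap) (simp add: ext2_multl)
  also have "\<dots> = cu h * slide z x y"
    by (simp only: al_inv[OF z] slide_def ext2_multl[symmetric] mult.left_commute)
  finally show "Sw h (\<lambda>h' h''. Sw h' (\<lambda>a b. Sw h'' (\<lambda>c d. slide z (S a * x * b) (S c * y * d)))) =
    cu h * slide z x y" .
qed

lemma slide_rot: assumes z: "z \<in> L_set H" and X: "adinv X"
  shows "ext2 H (rot X) (\<lambda>x y. Sw x (\<lambda>a b. alpha z a * alpha z (b * y))) = ext2 H X (slide z)"
proof -
  have "ext2 H (rot X) (\<lambda>x y. Sw x (\<lambda>a b. alpha z a * alpha z (b * y))) =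
    ext2 H X (\<lambda>x y. Sw (Gi * y * G) (\<lambda>a b. alpha z a * alpha z (b * x)))"
    by (rule ext2_rot) (intro lina)
  also have "\<dots> = ext2 H X (\<lambda>x y. slide z x (S (G * G) * y * (G * G)))"
  proof -
    have "Sw (Gi * y * G) (\<lambda>a b. alpha z a * alpha z (b * x)) = slide z x (S (G * G) * y * (G * G))" for x y
    proof -
      \<comment> \<open>This is S^-4(y), chosen because alpha is blind to S^2. In this shape it is y
        acted on by the grouplike G^2, which leads to \<open>tau\<close> at G^2.\<close>
      define w where "w = S (G * G) * y * (G * G)"
      have w: "Gi * y * G = S (S w)"
      proof -
        have "S (S w) = (G * Gi) * (Gi * y * G) * (G * Gi)"
          unfolding w_def SS_eq by (simp add: S_mult S_G mult.assoc)
        then show ?thesis by (simp add: G_Gi)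
      qed
      have "Sw (Gi * y * G) (\<lambda>a b. alpha z a * alpha z (b * x)) = Sw (S w) (\<lambda>a b. alpha z (S b) * alpha z (S a * x))"
        unfolding w by (subst Sw_S) (intro lina refl)+
      also have "\<dots> = Sw w (\<lambda>a b. alpha z (S (S a)) * alpha z (S (S b) * x))"
        by (subst Sw_S) (intro lina refl)+
      also have "\<dots> = slide z x w"
        by (simp only: slide_def al_SS[OF z] al_cyclic[OF z, of x])
      finally show ?thesis by (simp add: w_def)
    qed
    then show ?thesis by simp
  qed
  also have "\<dots> = tau X (slide z) (G * G)"
    unfolding tau_def by (subst Sw_GG) (intro lina bil2[OF bil_slide] refl)+
  also have "\<dots> = ext2 H X (slide z)"
    by (rule tau_GG[OF X inv_slide[OF z]])
  finally show ?thesis .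
qed

lemma cu_GG: "cu (G * G) = 1"
  using cu_mult[of G Gi] cu_S[of G] by (simp add: G_Gi cu_one cu_mult S_G)

text \<open>Four turns conjugate both legs by G^2, which is the diagonal action of a grouplike and
  trivial on invariant tensors. Three turns thus serve as the inverse of one.\<close>

lemma rot_4: assumes X: "adinv X" and F: "bil F"
  shows "ext2 H (rot (rot (rot (rot X)))) F = ext2 H X F"
proof -
  note l = lina bil1[OF F] bil2[OF F]
  have "ext2 H (rot (rot (rot (rot X)))) F =
    ext2 H X (\<lambda>x y. F (Gi * (Gi * x * G) * G) (Gi * (Gi * y * G) * G))"
    by (subst ext2_rot, intro l)+ (rule refl)
  also have "\<dots> = ext2 H X (\<lambda>x y. F (S (G * G) * x * (G * G)) (S (G * G) * y * (G * G)))"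
    by (simp add: S_mult S_G mult.assoc)
  also have "\<dots> = ext2 H X (\<lambda>x y. Sw (G * G) (\<lambda>h' h''. Sw h' (\<lambda>a b. Sw h'' (\<lambda>c d. F (S a * x * b) (S c * y * d)))))"
    by (subst Sw_GG, intro l)+ (rule refl)
  also have "\<dots> = ext2 H X F"
    by (simp add: adinvD[OF X F] cu_GG)
  finally show ?thesis .
qed

text \<open>X is replaced by its fourth turn so that \<open>slide_rot\<close> can take one turn
  off.\<close>

lemma slide_conv: assumes z: "z \<in> L_set H" and X: "adinv X"
  shows "ext2 H X (\<lambda>x y. Sw x (\<lambda>a b. alpha z a * alpha z (b * y))) = ext2 H (rot (rot (rot X))) (slide z)"
    and "ext2 H X (\<lambda>x y. alpha z x * alpha z y) = ext2 H (rot (rot (rot X))) (\<lambda>x y. alpha z x * alpha z y)"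
proof -
  have X3: "adinv (rot (rot (rot X)))" by (intro rot_adinv X)
  have "ext2 H X (\<lambda>x y. Sw x (\<lambda>a b. alpha z a * alpha z (b * y))) =
    ext2 H (rot (rot (rot (rot X)))) (\<lambda>x y. Sw x (\<lambda>a b. alpha z a * alpha z (b * y)))"
    by (rule rot_4[OF X, symmetric]) (intro lina)
  then show "ext2 H X (\<lambda>x y. Sw x (\<lambda>a b. alpha z a * alpha z (b * y))) = ext2 H (rot (rot (rot X))) (slide z)"
    by (simp add: slide_rot[OF z X3])
  have 1: "ext2 H (rot Y) (\<lambda>x y. alpha z x * alpha z y) = ext2 H Y (\<lambda>x y. alpha z x * alpha z y)" for Y
  proof -
    have "alpha z (Gi * y * G) = alpha z y" for y
      using al_cyclic[OF z, of "Gi * y" G] by (simp add: SS_G mult.assoc[symmetric] G_Gi)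
    then show ?thesis by (subst ext2_rot) (intro lina | simp add: mult.commute)+
  qed
  show "ext2 H X (\<lambda>x y. alpha z x * alpha z y) = ext2 H (rot (rot (rot X))) (\<lambda>x y. alpha z x * alpha z y)"
    by (simp add: 1)
qed

lemma slide_iff: assumes z: "z \<in> L_set H"
  shows "(\<forall>X \<in> V2_set H. ext2 H X (slide z) = ext2 H X (\<lambda>x y. alpha z x * alpha z y)) \<longleftrightarrow>
    (\<forall>X \<in> V2_set H. ext2 H X (\<lambda>x y. Sw x (\<lambda>a b. alpha z a * alpha z (b * y))) =
      ext2 H X (\<lambda>x y. alpha z x * alpha z y))" (is "?l \<longleftrightarrow> ?r")
proof -
  have V2: "X \<in> V2_set H \<Longrightarrow> adinv X \<and> rot X \<in> V2_set H" for X
    using V2_iff[of X] V2_iff[OF rot_tensor2, of X] rot_adinv[of X] by (auto simp: V2_set_def)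
  show ?thesis
  proof
    assume l: ?l
    show ?r
    proof
      fix X assume X: "X \<in> V2_set H"
      then have "rot (rot (rot X)) \<in> V2_set H" using V2 by blast
      with l slide_conv[OF z, of X] V2[OF X]
      show "ext2 H X (\<lambda>x y. Sw x (\<lambda>a b. alpha z a * alpha z (b * y))) = ext2 H X (\<lambda>x y. alpha z x * alpha z y)"
        by simp
    qed
  next
    assume r: ?r
    show ?l
    proof
      fix X assume X: "X \<in> V2_set H"
      have "alpha z (Gi * y * G) = alpha z y" for y
        using al_cyclic[OF z, of "Gi * y" G] by (simp add: SS_G mult.assoc[symmetric] G_Gi)
      then have "ext2 H (rot X) (\<lambda>x y. alpha z x * alpha z y) = ext2 H X (\<lambda>x y. alpha z x * alpha z y)"
        by (subst ext2_rot) (intro lina | simp add: mult.commute)+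
      then show "ext2 H X (slide z) = ext2 H X (\<lambda>x y. alpha z x * alpha z y)"
        using r V2[OF X] slide_rot[OF z, of X] by simp
    qed
  qed
qed

subsection \<open>Negligibility conditions\<close>

lemma phi_eq: "phi H lam z b k = (if b \<in> B then alpha z b else 0)"
  by (simp add: phi_def alpha_def)

lemma phi_hom: assumes z: "z \<in> L_set H" shows "phi H lam z \<in> hom (unit_mod H) (A_mod H)"
proof -
  have "(phi H lam z \<odot> act (unit_mod H) h) c k = (act (A_mod H) h \<odot> phi H lam z) c k" for h c k
  proof (cases "c \<in> B")
    case True
    have "(act (A_mod H) h \<odot> phi H lam z) c k = (\<Sum>b\<in>B. act (A_mod H) h c b * alpha z b)"
      by (subst mcomp_sum[OF finite_B]) (auto simp: phi_eq)
    also have "\<dots> = Sw h (\<lambda>a d. alpha z (S a * c * d))"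
      by (rule sum_A[OF _ True]) (intro lina)
    also have "\<dots> = cu h * alpha z c" by (rule al_inv[OF z])
    finally show ?thesis using True by (simp add: mcomp_unit unit_sel phi_eq)
  next
    case False
    then have "(act (A_mod H) h \<odot> phi H lam z) c k = 0"
      by (auto intro!: mcomp_zero simp: A_out)
    then show ?thesis using False by (simp add: mcomp_unit phi_eq)
  qed
  then show ?thesis by (auto simp: hom_def A_sel unit_sel phi_eq fun_eq_iff)
qed

lemma row_phi: "(theta_row w \<odot> phi H lam z) () () = lam (z * w)"
proof -
  have "(theta_row w \<odot> phi H lam z) () () = (\<Sum>b\<in>B. crd H w b * alpha z b)"
    by (subst mcomp_sum[OF finite_B]) (auto simp: phi_eq theta_row_def crd_out)
  also have "\<dots> = alpha z w" by (rule lf_expand) (intro lina)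
  finally show ?thesis by (simp add: alpha_def)
qed

lemma S_A_phi: assumes z: "z \<in> L_set H"
  shows "S_A H \<odot> phi H lam z = phi H lam (T_op H z)"
proof (intro ext)
  fix c k
  have "(S_A H \<odot> phi H lam z) c k = (\<Sum>b\<in>B. transp antip_el c b * alpha z b)"
    unfolding S_A_eq by (subst mcomp_sum[OF finite_B]) (auto simp: phi_eq)
  also have "\<dots> = (if c \<in> B then (\<Sum>b\<in>B. crd H (antip_el c) b * alpha z b) else 0)"
    by (simp add: transp_def)
  also have "(\<Sum>b\<in>B. crd H (antip_el c) b * alpha z b) = alpha z (antip_el c)"
    by (rule lf_expand) (intro lina)
  also have "alpha z (antip_el c) = lam (T_op H z * c)"
    by (subst lf_antip_el) (intro lina | simp add: antipode_form[OF z])+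
  finally show "(S_A H \<odot> phi H lam z) c k = phi H lam (T_op H z) c k"
    by (simp only: phi_eq[of "T_op H z"] alpha_def)
qed

lemma neg_S: assumes z: "z \<in> L_set H"
  shows "negligible H (unit_mod H) (A_mod H) (S_A H \<odot> phi H lam z - phi H lam z) \<longleftrightarrow>
    (\<forall>a \<in> Z_center H. lam (T_op H z * a) = lam (z * a))"
proof -
  have "(theta_row w \<odot> (phi H lam v - phi H lam z)) () () = lam (v * w) - lam (z * w)" for v w
  proof -
    have "phi H lam v - phi H lam z = phi H lam (v - z)"
      by (simp add: fun_eq_iff phi_def left_diff_distrib lf_diff[OF lf_lam0])
    then show ?thesis by (simp add: row_phi left_diff_distrib lf_diff[OF lf_lam0])
  qed
  moreover have "negligible H (unit_mod H) (A_mod H) (S_A H \<odot> phi H lam z - phi H lam z) \<longleftrightarrow>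
    (\<forall>w \<in> Z_center H. (theta_row w \<odot> (phi H lam (T_op H z) - phi H lam z)) () () = 0)"
  proof -
    have "hom (A_mod H) (unit_mod H) = theta_row ` Z_center H"
      using hom_A_unit by (auto simp: image_iff)
    then show ?thesis unfolding negligible_unit S_A_phi[OF z] by simp
  qed
  ultimately show ?thesis by simp
qed

lemma Gamma_phi: assumes z: "z \<in> L_set H"
  defines "aa \<equiv> (phi H lam z \<otimes> phi H lam z) \<odot> lunit_inv (unit_mod H)"
  shows "aa (x, y) () = (if x \<in> B \<and> y \<in> B then alpha z x * alpha z y else 0)"
    and "(Gamma_l H \<odot> aa) (x, y) () = (if x \<in> B \<and> y \<in> B then slide z x y else 0)"
proof -
  have fin2: "finite (B \<times> B)" using finite_B by simp
  show aa: "aa (x, y) () = (if x \<in> B \<and> y \<in> B then alpha z x * alpha z y else 0)" for x y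
    unfolding aa_def
    by (subst mcomp_single[of "((), ())"]) (auto simp: mtens_apply phi_eq lunit_inv_def reindex_def unit_sel)
  have "(Gamma_l H \<odot> aa) (x, y) () = (\<Sum>r\<in>B \<times> B. Gamma_l H (x, y) r * aa r ())"
    by (rule mcomp_sum[OF fin2]) (auto simp: aa split: if_splits)
  also have "\<dots> = (\<Sum>p\<in>B. \<Sum>q\<in>B. if x \<in> B \<and> y \<in> B
      then mult_ext y (\<lambda>v w. (crd H (x * v) p * crd H w q) * (alpha z p * alpha z q)) else 0)"
    unfolding sum.cartesian_product' by (intro sum.cong refl) (simp add: aa Gamma_l_eq mu_multr)
  also have "\<dots> = (if x \<in> B \<and> y \<in> B then
      mult_ext y (\<lambda>v w. \<Sum>p\<in>B. \<Sum>q\<in>B. (crd H (x * v) p * crd H w q) * (alpha z p * alpha z q)) else 0)"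
    by (auto simp: mu_sum intro!: sum.neutral)
  also have "\<dots> = (if x \<in> B \<and> y \<in> B then mult_ext y (\<lambda>v w. alpha z (x * v) * alpha z w) else 0)"
    by (subst bil_expand) (intro lina refl)+
  also have "mult_ext y (\<lambda>v w. alpha z (x * v) * alpha z w) = slide z x y"
  proof -
    \<comment> \<open>Invariance of alpha reduces b to eps(b), after which (id \<otimes> eps)(R) = 1
      removes the R-matrix.\<close>
    have "mult_ext y (\<lambda>v w. alpha z (x * v) * alpha z w) =
      Sw y (\<lambda>c1 c2. RR (\<lambda>a b. alpha z (x * (c2 * a)) * (cu b * alpha z c1)))"
      unfolding mult_ext_def by (simp add: ext2_multl al_inv[OF z])
    also have "\<dots> = Sw y (\<lambda>c1 c2. alpha z c1 * RR (\<lambda>a b. alpha z (x * (c2 * a)) * cu b))"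
      by (simp add: ext2_multl[symmetric] ac_simps)
    also have "\<dots> = Sw y (\<lambda>c1 c2. alpha z c1 * alpha z (x * (c2 * 1)))"
      by (subst R_cu_r) (intro lina refl)+
    finally show ?thesis by (simp add: slide_def)
  qed
  finally show "(Gamma_l H \<odot> aa) (x, y) () = (if x \<in> B \<and> y \<in> B then slide z x y else 0)" .
qed

lemma neg_Gamma: assumes z: "z \<in> L_set H"
  defines "aa \<equiv> (phi H lam z \<otimes> phi H lam z) \<odot> lunit_inv (unit_mod H)"
  shows "negligible H (unit_mod H) (tens_mod H (A_mod H) (A_mod H)) (Gamma_l H \<odot> aa - aa) \<longleftrightarrow>
    (\<forall>X \<in> V2_set H. ext2 H X (slide z) = ext2 H X (\<lambda>x y. alpha z x * alpha z y))"
proof -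
  have fin2: "finite (B \<times> B)" using finite_B by simp
  have val: "(g \<odot> (Gamma_l H \<odot> aa - aa)) () () = ext2 H (g ()) (slide z) - ext2 H (g ()) (\<lambda>x y. alpha z x * alpha z y)"
    for g :: "unit \<Rightarrow> 'h \<times> 'h \<Rightarrow> 'k"
  proof -
    have "(g \<odot> (Gamma_l H \<odot> aa - aa)) () () = (\<Sum>r\<in>B \<times> B. g () r * (Gamma_l H \<odot> aa - aa) r ())"
      by (rule mcomp_sum[OF fin2]) (auto simp: Gamma_phi[OF z, folded aa_def] split: if_splits)
    also have "\<dots> = (\<Sum>x\<in>B. \<Sum>y\<in>B. g () (x, y) * (slide z x y - alpha z x * alpha z y))"
      unfolding sum.cartesian_product'
      by (intro sum.cong refl) (simp add: Gamma_phi[OF z, folded aa_def])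
    finally show ?thesis
      by (simp add: ext2_eq right_diff_distrib sum_subtractf)
  qed
  \<comment> \<open>Every tensor is the row of some matrix, so quantifying over morphisms to the
    unit is quantifying over \<open>V2_set\<close>.\<close>
  have ex: "\<exists>g. g () = X" for X :: "'h \<times> 'h \<Rightarrow> 'k" by (rule exI[of _ "\<lambda>_. X"]) simp
  show ?thesis
    unfolding negligible_unit hom_A2_unit Ball_def mem_Collect_eq val
    using ex by (metis eq_iff_diff_eq_0)
qed

lemma I_set_iff: "z \<in> I_set H lam \<longleftrightarrow> z \<in> L_set H \<and> T_op H z - z \<in> N_set H lam \<and>
   (\<forall>X \<in> V2_set H. ext2 H X (\<lambda>x y. Sw x (\<lambda>x1 x2. lam (z * x1) * lam (z * x2 * y))) =
      ext2 H X (\<lambda>x y. lam (z * x) * lam (z * y)))"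
proof (cases "z \<in> L_set H")
  case True
  have "z \<in> I_set H lam \<longleftrightarrow> T_op H z - z \<in> N_set H lam \<and>
    (\<forall>X \<in> V2_set H. ext2 H X (slide z) = ext2 H X (\<lambda>x y. alpha z x * alpha z y))"
    unfolding I_set_def I_rep_def Let_def
    using True phi_hom[OF True] neg_S[OF True] neg_Gamma[OF True] T_N_iff[OF True] by simp
  then show ?thesis
    unfolding slide_iff[OF True] using True by (simp add: alpha_def mult.assoc)
next
  case False
  then show ?thesis by (simp add: I_set_def)
qed

text \<open>Pairing the H-valued identity with lam( . y) yields (b) termwise, before any sum over an
  invariant tensor.\<close>

lemma I_set_sub: assumes z: "z \<in> L_set H" and T: "T_op H z = z"
  and s: "\<And>x. ext2H H (cop H x) (\<lambda>x1 x2. sc (lam (z * x1)) (z * x2)) = sc (lam (z * x)) z"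
  shows "z \<in> I_set H lam"
proof -
  have "T_op H z - z \<in> N_set H lam"
    unfolding T_N_iff[OF z] using T by simp
  moreover have "Sw x (\<lambda>x1 x2. lam (z * x1) * lam (z * x2 * y)) = lam (z * x) * lam (z * y)" for x y
  proof -
    have l: "lf (\<lambda>w. lam (w * y))" by (intro linl)
    show ?thesis
      using arg_cong[OF s[of x], of "\<lambda>w. lam (w * y)"]
      by (simp add: ext2H_lf[OF l] lfD[OF l])
  qed
  ultimately show ?thesis using z by (simp add: I_set_iff)
qed

lemma I_set_norm_iff: "z \<in> I_set H lam \<Longrightarrow> z \<in> I_set_norm H lam \<longleftrightarrow>
    lam (z * tw) \<noteq> 0 \<and> lam (z * twist_inv H) \<noteq> 0"
  by (auto simp: I_set_def I_set_norm_def I_rep_norm_def Theta_eq row_phi)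

end

theorem theorem4p8:
  fixes H :: "('k::field, 'h::ring_1) ribbon_data"
    and lam :: "'h \<Rightarrow> 'k"
  assumes "ribbon_hopf_algebra H"
    and "right_integral_dual H lam"
    and "\<exists>x. lam x \<noteq> 0"
  shows "(I_set H lam =
      {z \<in> L_set H.
         T_op H z - z \<in> N_set H lam \<and>
         (\<forall>X \<in> V2_set H.
            ext2 H X (\<lambda>x y. ext2 H (cop H x) (\<lambda>x1 x2. lam (z * x1) * lam (z * x2 * y))) =
            ext2 H X (\<lambda>x y. lam (z * x) * lam (z * y)))}) \<and>
    (\<forall>z \<in> L_set H. T_op H z - z \<in> N_set H lam \<longleftrightarrow>
      (\<forall>a \<in> Z_center H. lam (T_op H z * a) = lam (z * a))) \<and>
    ({z \<in> L_set H.
        T_op H z = z \<and>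
        (\<forall>x. ext2H H (cop H x) (\<lambda>x1 x2. scal H (lam (z * x1)) (z * x2)) =
             scal H (lam (z * x)) z)} \<subseteq> I_set H lam) \<and>
    (\<forall>z \<in> I_set H lam. z \<in> I_set_norm H lam \<longleftrightarrow>
      lam (z * twist H) \<noteq> 0 \<and> lam (z * twist_inv H) \<noteq> 0)"
proof -
  interpret ribbon_integral H lam
    using assms by unfold_locales
  show ?thesis
  proof (intro conjI ballI subsetI)
    show "I_set H lam =
      {z \<in> L_set H.
         T_op H z - z \<in> N_set H lam \<and>
         (\<forall>X \<in> V2_set H.
            ext2 H X (\<lambda>x y. ext2 H (cop H x) (\<lambda>x1 x2. lam (z * x1) * lam (z * x2 * y))) =
            ext2 H X (\<lambda>x y. lam (z * x) * lam (z * y)))}"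
      using I_set_iff by blast
  qed (use T_N_iff I_set_norm_iff I_set_sub in blast)+
qed

end
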